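(* Let $\{\mathbf X_1,\dots,\mathbf X_n\}$ be a sample drawn from a distribution $P$ on $\mathcal X$ whose probability array $\mathbf p\in\mathcal P$ has support $\mathcal S_{\mathbf p}=\mathrm{Supp}(\mathbf p)$ such that $\Gamma(\mathcal S_{\mathbf p})\neq\emptyset$. Let $\boldsymbol\gamma_{\mathbf p}=\mathcal I_\Gamma(\mathbf p)$ be the copula array of $\mathbf p$, let $\widehat{\mathbf p}_n$ be the smoothed empirical probability array and $\widehat{\boldsymbol\gamma}_n=\mathcal I_\Gamma(\widehat{\mathbf p}_n)$ the empirical copula array. Write $\underline{\boldsymbol p}=\mathrm{vec}(\mathbf p)$, $\widehat{\underline{\boldsymbol p}}_n=\mathrm{vec}(\widehat{\mathbf p}_n)$, $\underline{\boldsymbol\gamma}_{\mathbf p}=\mathrm{vec}(\boldsymbol\gamma_{\mathbf p})$, $\widehat{\underline{\boldsymbol\gamma}}_n=\mathrm{vec}(\widehat{\boldsymbol\gamma}_n)$, $N=\prod_{\ell=1}^d r_\ell$. (a) If $\widehat{\mathbf p}_n\to\mathbf p$ in probability (resp. almost surely) as $n\to\infty$, then $\widehat{\boldsymbol\gamma}_n\to\boldsymbol\gamma_{\mathbf p}$ in probability (resp. almost surely) as $n\to\infty$. Assume moreover that $d_\circ=\dim(\boldsymbol\Delta^\circ(\mathcal S_{\mathbf p}))\ge 1$, let $\Delta_1,\dots,\Delta_{d_\circ}$ be a basis of $\boldsymbol\Delta^\circ(\mathcal S_{\mathbf p})$, let $A$ be the $N\times d_\circ$ matrix with columns $\mathrm{vec}(\Delta_1),\dots,\mathrm{vec}(\Delta_{d_\circ})$,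 let $R=R_{\mathcal S_{\mathbf p}}$ be the entry selection matrix of $\mathcal S_{\mathbf p}$ and $\widetilde A=RA$. (b) If $\rho_n(\widehat{\underline{\boldsymbol p}}_n-\underline{\boldsymbol p})\to\boldsymbol Z$ in distribution as $n\to\infty$, for some sequence $\rho_n\to\infty$ and some $N$-dimensional random vector $\boldsymbol Z$, then $$\rho_n(\widehat{\underline{\boldsymbol\gamma}}_n-\underline{\boldsymbol\gamma}_{\mathbf p})\to J\,\boldsymbol Z\quad\text{in distribution},\qquad J=A\left[\widetilde A^{\top}\mathrm{diag}^{-1}(R\,\underline{\boldsymbol\gamma}_{\mathbf p})\widetilde A\right]^{-1}\widetilde A^{\top}\mathrm{diag}^{-1}(R\,\underline{\boldsymbol p})\,R .$$ (c) In particular, if $\{\mathbf X_1,\dots,\mathbf X_n\}$ is an i.i.d. sample drawn from $P$, so that $\sqrt n(\widehat{\underline{\boldsymbol p}}_n-\underline{\boldsymbol p})\to\mathcal N_N(\mathbf 0,\mathrm{diag}(\underline{\boldsymbol p})-\underline{\boldsymbol p}\,\underline{\boldsymbol p}^{\top})$ in distribution, then $$\sqrt n\,(\widehat{\underline{\boldsymbol\gamma}}_n-\underline{\boldsymbol\gamma}_{\mathbf p})\to\mathcal N_N(\mathbf 0,\boldsymbol\Sigma_{\gamma})\quad\text{in distribution as }n\to\infty,$$ where $$\boldsymbol\Sigma_\gamma=A\left[\widetilde A^{\top}\mathrm{diag}^{-1}(R\,\underline{\boldsymbol\gamma}_{\mathbf p})\widetilde A\right]^{-1}\left[\widetilde A^{\top}\mathrm{diag}^{-1}(R\,\underline{\boldsymbol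 p})\widetilde A\right]\left[\widetilde A^{\top}\mathrm{diag}^{-1}(R\,\underline{\boldsymbol\gamma}_{\mathbf p})\widetilde A\right]^{-1}A^{\top}.$$
   Context: Arrays. Fix positive integers $d$ and $r_1,\dots,r_d$; $[s]=\{1,\dots,s\}$; $\mathcal R=[r_1]\times\cdots\times[r_d]$; $\mathbb R^{r_1\times\cdots\times r_d}$ is the set of real arrays $\mathbf a=(a_{\boldsymbol i})_{\boldsymbol i\in\mathcal R}$; $\mathrm{Supp}(\mathbf a)=\{\boldsymbol i\in\mathcal R:a_{\boldsymbol i}\ne0\}$. The $\ell$-th margin of $\mathbf a$ is the vector $(a^{(\ell)}_i)_{i\in[r_\ell]}$ with $a^{(\ell)}_i=\sum_{\boldsymbol i\in\mathcal R:\,i_\ell=i}a_{\boldsymbol i}$. $\mathcal P$ is the set of arrays $\mathbf p$ with entries in $[0,1]$ summing to $1$ and with $p^{(\ell)}_i>0$ for all $\ell\in[d]$, $i\in[r_\ell]$. $\Gamma=\{\boldsymbol\gamma\in\mathcal P:\gamma^{(\ell)}_i=1/r_\ell\ \forall \ell\in[d],i\in[r_\ell]\}$ is the set of copula arrays. For nonempty $\mathcal S\subseteq\mathcal R$, $\Gamma(\mathcal S)=\{\boldsymbol\gamma\in\Gamma:\mathrm{Supp}(\boldsymbol\gamma)=\mathcal S\}$, and $\boldsymbol\Delta^\circ(\mathcal S)$ is the linear space of arrays $\mathbf a\in\mathbb R^{r_1\times\cdots\times r_d}$ with $\mathrm{Supp}(\mathbf a)\subseteq\mathcal S$ and $a^{(\ell)}_i=0$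 for all $\ell\in[d]$, $i\in[r_\ell]$. $\mathcal I$-projection. For $\mathbf p,\mathbf q\in\mathcal P$, $\mathcal I(\mathbf q\|\mathbf p)=\sum_{\boldsymbol i\in\mathrm{Supp}(\mathbf p)}q_{\boldsymbol i}\log(q_{\boldsymbol i}/p_{\boldsymbol i})$ if $\mathrm{Supp}(\mathbf q)\subseteq\mathrm{Supp}(\mathbf p)$ (with $0\log0=0$) and $\infty$ otherwise. $\mathcal I_\Gamma(\mathbf p)$ denotes the minimiser of $\boldsymbol\gamma\mapsto\mathcal I(\boldsymbol\gamma\|\mathbf p)$ over $\Gamma$; when $\Gamma(\mathrm{Supp}(\mathbf p))\neq\emptyset$ it exists, is unique, and has support $\mathrm{Supp}(\mathbf p)$; it is called the copula array of $\mathbf p$. Vectorisation. $\mathrm{vec}:\mathbb R^{r_1\times\cdots\times r_d}\to\mathbb R^{N}$, $N=\prod_\ell r_\ell$, is column-major vectorisation: $\mathrm{vec}(\mathbf a)_{\phi(\boldsymbol i)}=a_{\boldsymbol i}$ with $\phi(\boldsymbol i)=i_1+\sum_{k=2}^d(i_k-1)\prod_{m=1}^{k-1}r_m$. $R_{\mathcal S}$ is the $|\mathcal S|\times N$ matrix obtained from the $N\times N$ identity matrix by deleting the rows with index $\phi(\boldsymbol i)$, $\boldsymbol i\in\mathcal R\setminus\mathcal S$. For a vector $\boldsymbol v$ with nonzero entries, $\mathrm{diag}^{-1}(\boldsymbol v)$ is the inverse of the diagonal matrix $\mathrm{diag}(\boldsymbol v)$. Sampling. $\mathcal X=\mathcal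 X_1\times\cdots\times\mathcal X_d$ with $\mathcal X_\ell=\{x^{(\ell)}_1<\dots<x^{(\ell)}_{r_\ell}\}\subset\mathbb R$. The probability array of $P$ is $p_{\boldsymbol i}=P(\{(x^{(1)}_{i_1},\dots,x^{(d)}_{i_d})\})$, assumed to lie in $\mathcal P$. $\mathbf X_1,\dots,\mathbf X_n$ are random vectors each with distribution $P$ (not assumed independent unless stated). The empirical array $\mathbf p_n$ has entries $p_{\boldsymbol i;n}=\frac1n\sum_{k=1}^n\mathbf 1\{\mathbf X_k=(x^{(1)}_{i_1},\dots,x^{(d)}_{i_d})\}$, and $\widehat{\mathbf p}_n=\frac{n}{n+1}\mathbf p_n+\frac1{n+1}\mathbf q$, where $q_{\boldsymbol i}=|\mathcal S_{\mathbf p}|^{-1}\mathbf 1\{\boldsymbol i\in\mathcal S_{\mathbf p}\}$ (the support $\mathcal S_{\mathbf p}$ is known). *)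

theory Defs
  imports "HOL-Probability.Probability" "HOL-Library.Function_Algebras"
begin

text \<open>
  Multi-indices are extensional functions on \<open>{1..d}\<close>.  Arrays are real functions of multi-indices
  that vanish outside the index set, so that equality of arrays is equality of functions and the
  arrays form a linear subspace of a function space.  The pointwise vector space structure on
  functions completes the additive one of Function_Algebras.
\<close>

instantiation "fun" :: (type, real_vector) real_vector
begin

definition "scaleR c f = (\<lambda>x. c *\<^sub>R f x)"

instance
  by standard (auto simp: scaleR_fun_def fun_eq_iff scaleR_add_right scaleR_add_left)

end

type_synonym multi_index = "nat \<Rightarrow> nat"
type_synonym real_array = "multi_index \<Rightarrow> real"

definition idx_set :: "nat \<Rightarrow> (nat \<Rightarrow> nat) \<Rightarrow> multi_index set" where
  "idx_set d r = (\<Pi>\<^sub>E l\<in>{1..d}. {1..r l})"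

definition arrays :: "nat \<Rightarrow> (nat \<Rightarrow> nat) \<Rightarrow> real_array set" where
  "arrays d r = {a. \<forall>i. i \<notin> idx_set d r \<longrightarrow> a i = 0}"

definition supp :: "nat \<Rightarrow> (nat \<Rightarrow> nat) \<Rightarrow> real_array \<Rightarrow> multi_index set" where
  "supp d r a = {i \<in> idx_set d r. a i \<noteq> 0}"

definition margin :: "nat \<Rightarrow> (nat \<Rightarrow> nat) \<Rightarrow> real_array \<Rightarrow> nat \<Rightarrow> nat \<Rightarrow> real" where
  "margin d r a l j = (\<Sum>i \<in> {i \<in> idx_set d r. i l = j}. a i)"

definition prob_arrays :: "nat \<Rightarrow> (nat \<Rightarrow> nat) \<Rightarrow> real_array set" where
  "prob_arrays d r = {p \<in> arrays d r. (\<forall>i \<in> idx_set d r. 0 \<le> p i \<and> p i \<le> 1) \<and>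
     (\<Sum>i \<in> idx_set d r. p i) = 1 \<and> (\<forall>l \<in> {1..d}. \<forall>j \<in> {1..r l}. margin d r p l j > 0)}"

definition copula_arrays :: "nat \<Rightarrow> (nat \<Rightarrow> nat) \<Rightarrow> real_array set" where
  "copula_arrays d r =
     {g \<in> prob_arrays d r. \<forall>l \<in> {1..d}. \<forall>j \<in> {1..r l}. margin d r g l j = 1 / real (r l)}"

definition copula_arrays_on :: "nat \<Rightarrow> (nat \<Rightarrow> nat) \<Rightarrow> multi_index set \<Rightarrow> real_array set" where
  "copula_arrays_on d r S = {g \<in> copula_arrays d r. supp d r g = S}"

definition zero_margin_space :: "nat \<Rightarrow> (nat \<Rightarrow> nat) \<Rightarrow> multi_index set \<Rightarrow> real_array set" where
  "zero_margin_space d r S = {a \<in> arrays d r. supp d r a \<subseteq> S \<and>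
     (\<forall>l \<in> {1..d}. \<forall>j \<in> {1..r l}. margin d r a l j = 0)}"

text \<open>The convention \<open>0 log 0 = 0\<close> holds automatically because of the factor \<open>q i\<close>.\<close>

definition I_div :: "nat \<Rightarrow> (nat \<Rightarrow> nat) \<Rightarrow> real_array \<Rightarrow> real_array \<Rightarrow> ereal" where
  "I_div d r q p = (if supp d r q \<subseteq> supp d r p
     then ereal (\<Sum>i \<in> supp d r p. q i * ln (q i / p i)) else \<infinity>)"

definition I_proj :: "nat \<Rightarrow> (nat \<Rightarrow> nat) \<Rightarrow> real_array \<Rightarrow> real_array" where
  "I_proj d r p = (ARG_MIN (\<lambda>g. I_div d r g p) g. g \<in> copula_arrays d r)"

text \<open>
  Coordinates of \<open>real ^ 'n\<close> are numbered \<open>1, \<dots>, CARD('n)\<close> by the linear order of \<open>'n\<close>.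
\<close>

definition coord_pos :: "'n::{finite,linorder} \<Rightarrow> nat" where
  "coord_pos c = card {..c}"

definition col_major :: "nat \<Rightarrow> (nat \<Rightarrow> nat) \<Rightarrow> multi_index \<Rightarrow> nat" where
  "col_major d r i = i 1 + (\<Sum>k = 2..d. (i k - 1) * (\<Prod>m = 1..k - 1. r m))"

text \<open>
  When \<open>CARD('n) = (\<Prod>l = 1..d. r l)\<close>, the function \<open>col_major d r\<close> is a bijection from the index set
  onto \<open>{1..CARD('n)}\<close>, and the coordinate at position \<open>col_major d r i\<close> is the entry \<open>a i\<close>.
\<close>

definition vectorise :: "nat \<Rightarrow> (nat \<Rightarrow> nat) \<Rightarrow> real_array \<Rightarrow> real ^ 'n::{finite,linorder}" where
  "vectorise d r a = (\<chi> c. a (inv_into (idx_set d r) (col_major d r) (coord_pos c)))"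

text \<open>
  Deleting from the identity matrix the rows at positions \<open>col_major d r i\<close>, \<open>i \<notin> S\<close>, leaves the rows
  at positions in \<open>col_major d r ` S\<close>, in increasing order; row \<open>s\<close> of the result is the one at the
  \<open>coord_pos s\<close>-th smallest of these positions (list indices start at 0).
\<close>

definition selection_matrix ::
  "nat \<Rightarrow> (nat \<Rightarrow> nat) \<Rightarrow> multi_index set \<Rightarrow> real ^ 'n::{finite,linorder} ^ 's::{finite,linorder}" where
  "selection_matrix d r S = (\<chi> s c.
     if coord_pos c = sorted_list_of_set (col_major d r ` S) ! (coord_pos s - 1) then 1 else 0)"

definition diag_matrix :: "real ^ 'm \<Rightarrow> real ^ 'm ^ 'm" where
  "diag_matrix v = (\<chi> i j. if i = j then v $ i else 0)"

definition diag_matrix_inv :: "real ^ 'm \<Rightarrow> real ^ 'm ^ 'm" where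
  "diag_matrix_inv v = matrix_inv (diag_matrix v)"

definition outer_product :: "real ^ 'm \<Rightarrow> real ^ 'm \<Rightarrow> real ^ 'm ^ 'm" where
  "outer_product u v = (\<chi> i j. u $ i * v $ j)"

definition grid_point :: "nat \<Rightarrow> (nat \<Rightarrow> nat \<Rightarrow> real) \<Rightarrow> multi_index \<Rightarrow> (nat \<Rightarrow> real)" where
  "grid_point d x i = (\<lambda>l \<in> {1..d}. x l (i l))"

definition grid :: "nat \<Rightarrow> (nat \<Rightarrow> nat) \<Rightarrow> (nat \<Rightarrow> nat \<Rightarrow> real) \<Rightarrow> (nat \<Rightarrow> real) set" where
  "grid d r x = (\<Pi>\<^sub>E l\<in>{1..d}. x l ` {1..r l})"

abbreviation borel_pow :: "nat \<Rightarrow> (nat \<Rightarrow> real) measure" where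
  "borel_pow d \<equiv> PiM {1..d} (\<lambda>_. borel)"

definition prob_array_of ::
  "nat \<Rightarrow> (nat \<Rightarrow> nat) \<Rightarrow> (nat \<Rightarrow> nat \<Rightarrow> real) \<Rightarrow> (nat \<Rightarrow> real) measure \<Rightarrow> real_array" where
  "prob_array_of d r x P = (\<lambda>i. if i \<in> idx_set d r then measure P {grid_point d x i} else 0)"

definition empirical_array ::
  "nat \<Rightarrow> (nat \<Rightarrow> nat) \<Rightarrow> (nat \<Rightarrow> nat \<Rightarrow> real) \<Rightarrow> (nat \<Rightarrow> 'w \<Rightarrow> nat \<Rightarrow> real) \<Rightarrow> nat \<Rightarrow> 'w \<Rightarrow> real_array" where
  "empirical_array d r x X n \<omega> = (\<lambda>i. if i \<in> idx_set d r
     then 1 / real n * (\<Sum>k = 1..n. indicator {grid_point d x i} (X k \<omega>)) else 0)"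

definition smoothed_array ::
  "nat \<Rightarrow> (nat \<Rightarrow> nat) \<Rightarrow> (nat \<Rightarrow> nat \<Rightarrow> real) \<Rightarrow> multi_index set \<Rightarrow> (nat \<Rightarrow> 'w \<Rightarrow> nat \<Rightarrow> real)
     \<Rightarrow> nat \<Rightarrow> 'w \<Rightarrow> real_array" where
  "smoothed_array d r x S X n \<omega> = (\<lambda>i. real n / (real n + 1) * empirical_array d r x X n \<omega> i
     + 1 / (real n + 1) * (1 / real (card S) * indicator S i))"

definition array_dist :: "nat \<Rightarrow> (nat \<Rightarrow> nat) \<Rightarrow> real_array \<Rightarrow> real_array \<Rightarrow> real" where
  "array_dist d r a b = L2_set (\<lambda>i. a i - b i) (idx_set d r)"

definition conv_in_prob ::
  "nat \<Rightarrow> (nat \<Rightarrow> nat) \<Rightarrow> 'w measure \<Rightarrow> (nat \<Rightarrow> 'w \<Rightarrow> real_array) \<Rightarrow> real_array \<Rightarrow> bool" where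
  "conv_in_prob d r M Y y \<longleftrightarrow>
     (\<forall>n. \<forall>i \<in> idx_set d r. (\<lambda>\<omega>. Y n \<omega> i) \<in> borel_measurable M) \<and>
     (\<forall>\<epsilon>>0. (\<lambda>n. measure M {\<omega> \<in> space M. array_dist d r (Y n \<omega>) y > \<epsilon>}) \<longlonglongrightarrow> 0)"

definition conv_almost_surely ::
  "nat \<Rightarrow> (nat \<Rightarrow> nat) \<Rightarrow> 'w measure \<Rightarrow> (nat \<Rightarrow> 'w \<Rightarrow> real_array) \<Rightarrow> real_array \<Rightarrow> bool" where
  "conv_almost_surely d r M Y y \<longleftrightarrow>
     (\<forall>n. \<forall>i \<in> idx_set d r. (\<lambda>\<omega>. Y n \<omega> i) \<in> borel_measurable M) \<and>
     (AE \<omega> in M. (\<lambda>n. array_dist d r (Y n \<omega>) y) \<longlonglongrightarrow> 0)"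

text \<open>
  Convergence in distribution of random vectors \<open>Y n\<close> on the probability space \<open>M\<close> to the law \<open>\<mu>\<close>.
  The library's weak convergence of measures is restricted to the real line.
\<close>

definition conv_in_distr ::
  "'w measure \<Rightarrow> (nat \<Rightarrow> 'w \<Rightarrow> real ^ 'm) \<Rightarrow> (real ^ 'm) measure \<Rightarrow> bool" where
  "conv_in_distr M Y \<mu> \<longleftrightarrow>
     (\<forall>n. Y n \<in> borel_measurable M) \<and> prob_space \<mu> \<and> sets \<mu> = sets borel \<and>
     (\<forall>f :: real ^ 'm \<Rightarrow> real. continuous_on UNIV f \<and> bounded (range f) \<longrightarrow>
        (\<lambda>n. \<integral>\<omega>. f (Y n \<omega>) \<partial>M) \<longlonglongrightarrow> (\<integral>v. f v \<partial>\<mu>))"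

definition normal_law :: "real \<Rightarrow> real \<Rightarrow> real measure" where
  "normal_law m v = (if v = 0 then return borel m else density lborel (normal_density m (sqrt v)))"

text \<open>
  Possibly degenerate multivariate normal law with mean \<open>m\<close> and covariance matrix \<open>V\<close>: every linear
  combination \<open>t \<bullet> v\<close> of the coordinates has the corresponding univariate normal law, point masses
  being the normal laws of variance 0.  This determines \<open>\<mu>\<close> uniquely.
\<close>

definition mv_normal :: "(real ^ 'm) measure \<Rightarrow> real ^ 'm \<Rightarrow> real ^ 'm ^ 'm \<Rightarrow> bool" where
  "mv_normal \<mu> m V \<longleftrightarrow> prob_space \<mu> \<and> sets \<mu> = sets borel \<and>
     transpose V = V \<and> (\<forall>t. 0 \<le> t \<bullet> (V *v t)) \<and>
     (\<forall>t. distr \<mu> borel (\<lambda>v. t \<bullet> v) = normal_law (t \<bullet> m) (t \<bullet> (V *v t)))"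

definition conv_to_normal ::
  "'w measure \<Rightarrow> (nat \<Rightarrow> 'w \<Rightarrow> real ^ 'm) \<Rightarrow> real ^ 'm \<Rightarrow> real ^ 'm ^ 'm \<Rightarrow> bool" where
  "conv_to_normal M Y m V \<longleftrightarrow> (\<exists>\<mu>. mv_normal \<mu> m V \<and> conv_in_distr M Y \<mu>)"

end

theory Submission
  imports Defs
begin

text \<open>
  On arrays with support \<open>S\<close> the projection \<open>g = I_proj d r p\<close> is positive on \<open>S\<close>, and \<open>ln g - ln p\<close> is
  orthogonal to the zero-margin space.  For two such arrays \<open>p\<close>, \<open>q\<close> the difference \<open>u\<close> of the
  projections \<open>g\<close>, \<open>h\<close> lies in that space.  Testing against \<open>u\<close> and using
  \<open>(ln s - ln t) (s - t) \<ge> (s - t)\<^sup>2\<close> on \<open>(0, 1]\<close> yields \<open>\<parallel>h - g\<parallel> \<le> \<parallel>ln q - ln p\<parallel>\<close>: consistency.  Testing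
  against a basis and linearising the logarithms yields a linear system with matrix \<open>G\<close> for the
  coordinates of \<open>u\<close>, so that \<open>p \<mapsto> I_proj d r p\<close> has derivative \<open>J\<close> with a quadratic remainder: delta method.
  The multivariate central limit theorem follows from the one on the line by the Cramer-Wold device,
  which rests on tightness and approximation by trigonometric polynomials.
\<close>

subsection \<open>The projection onto the copula arrays\<close>

text \<open>The obstacle is the boundary: a minimiser might vanish at a point of \<open>S\<close>,
  where \<open>t * ln t\<close> has slope -\<infinity> and no derivative condition can be written.
  Positivity is therefore settled first, from an inequality whose logarithms sit at positive
  competitors; only then is every zero-margin direction admissible with both signs. The constant 1
  in the strong monotonicity of \<open>ln\<close> is the minimum of 1 / t on (0, 1]. It makes the
  Lipschitz constant in logarithmic coordinates independent of the arrays, so the Taylor remainders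
  at \<open>p\<close> and at its projection are both quadratic in the distance from \<open>q\<close>
  to \<open>p\<close>. The covariance simplifies because zero-margin arrays have total zero: the
  part \<open>p p\<^sup>T\<close> of the multinomial covariance is annihilated, and the rest is the
  Gram matrix \<open>H\<close>. Trigonometric polynomials are the right test functions for
  projections, since cos (t \<bullet> v) and sin (t \<bullet> v) each depend on v through a single
  projection.\<close>

lemma finite_idx_set: "finite (idx_set d r)"
  unfolding idx_set_def by (intro finite_PiE) auto

text \<open>Continuity up to the boundary point 0 is what lets the compactness argument include
  arrays that vanish somewhere on the support.\<close>

lemma continuous_on_mult_ln: "continuous_on {0..} (\<lambda>x::real. x * ln x)"
proof (intro continuous_on_eq_continuous_within[THEN iffD2] ballI)
  fix x :: real assume x: "x \<in> {0..}"
  show "continuous (at x within {0..}) (\<lambda>x. x * ln x)"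
  proof (cases "x = 0")
    case True
    have bd: "norm (y * ln y) \<le> 2 * sqrt y" if "0 \<le> y" "y \<le> 1" for y :: real
    proof (cases "y = 0")
      case False
      then have y: "0 < y" using that by simp
      \<comment> \<open>The square root matters: the same inequality applied to 1 / y would only
        bound y |ln y|, whereas here the bound 2 sqrt y tends to 0.\<close>
      have "ln (1 / sqrt y) \<le> 1 / sqrt y - 1" using y by (intro ln_le_minus_one) simp
      then have "- ln y \<le> 2 / sqrt y" using y by (simp add: ln_div ln_sqrt)
      then have "y * (- ln y) \<le> y * (2 / sqrt y)" using y by (intro mult_left_mono) auto
      also have "\<dots> = 2 * sqrt y" using real_div_sqrt[of y] y by (simp add: field_simps)
      finally show ?thesis using y that by (simp add: abs_mult abs_of_nonpos)
    qed simp
    have "((\<lambda>x::real. x * ln x) \<longlongrightarrow> 0) (at 0 within {0..})"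
    proof (rule Lim_null_comparison)
      show "\<forall>\<^sub>F y in at 0 within {0..}. norm (y * ln y) \<le> 2 * sqrt y"
        unfolding eventually_at by (rule exI[of _ 1]) (use bd in \<open>auto simp: dist_real_def\<close>)
      show "((\<lambda>y. 2 * sqrt y) \<longlongrightarrow> 0) (at 0 within {0..})"
        by (auto intro!: tendsto_eq_intros)
    qed
    then show ?thesis using True by (simp add: continuous_within)
  next
    case False
    then show ?thesis using x by (intro continuous_intros) auto
  qed
qed

text \<open>Tangent-line inequality for the convex function \<open>t * ln (t / c)\<close>. The point
  of tangency must be positive, but the other point may be 0: this asymmetry is what the variational
  inequality exploits.\<close>

lemma mult_ln_gradient:
  fixes x y c :: real
  assumes "0 \<le> x" "0 < y" "0 < c"
  shows "y * ln (y / c) + (ln (y / c) + 1) * (x - y) \<le> x * ln (x / c)"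
proof (cases "x = 0")
  case True
  then show ?thesis using assms by (simp add: algebra_simps)
next
  case False
  then have x: "0 < x" using assms by simp
  have "ln (y / x) \<le> y / x - 1" using x assms by (intro ln_le_minus_one) simp
  then have "x * ln (y / x) \<le> x * (y / x - 1)" using x by (intro mult_left_mono) auto
  then have "x * (ln y - ln x) \<le> y - x" using x assms by (simp add: ln_div algebra_simps)
  then show ?thesis using x assms by (simp add: ln_div algebra_simps)
qed

text \<open>The derivative 1 / t of the logarithm is at least 1 on (0, 1]. The claim is symmetric in
  the two points, so one order suffices.\<close>

lemma ln_strongly_mono:
  fixes x y :: real
  assumes "0 < x" "x \<le> 1" "0 < y" "y \<le> 1"
  shows "(x - y)\<^sup>2 \<le> (ln x - ln y) * (x - y)"
proof -
  have *: "(x - y)\<^sup>2 \<le> (ln x - ln y) * (x - y)" if "0 < y" "y \<le> x" "x \<le> 1" for x y :: real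
  proof -
    have "ln (y / x) \<le> y / x - 1" using that by (intro ln_le_minus_one) simp
    then have "(x - y) / x \<le> ln x - ln y" using that by (simp add: ln_div diff_divide_distrib)
    moreover have "x - y \<le> (x - y) / x" using that by (simp add: le_divide_eq mult_left_le)
    ultimately have "x - y \<le> ln x - ln y" by simp
    then show ?thesis using that by (simp add: power2_eq_square mult_right_mono)
  qed
  show ?thesis
  proof (cases "y \<le> x")
    case True then show ?thesis using * assms by blast
  next
    case False
    then have "(y - x)\<^sup>2 \<le> (ln y - ln x) * (y - x)" using * assms by simp
    then show ?thesis by (simp add: power2_eq_square algebra_simps)
  qed
qed

lemma sum_idx_set_margin:
  assumes "l \<in> {1..d}"
  shows "(\<Sum>i \<in> idx_set d r. a i) = (\<Sum>j = 1..r l. margin d r a l j)"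
  unfolding margin_def
  by (rule sum.group[OF finite_idx_set, symmetric]) (use assms in \<open>auto simp: idx_set_def PiE_iff\<close>)

lemma margin_add: "margin d r (\<lambda>i. a i + b i) l j = margin d r a l j + margin d r b l j"
  by (simp add: margin_def sum.distrib)

lemma margin_cmult: "margin d r (\<lambda>i. c * a i) l j = c * margin d r a l j"
  by (simp add: margin_def sum_distrib_left)

lemma margin_diff: "margin d r (\<lambda>i. a i - b i) l j = margin d r a l j - margin d r b l j"
  by (simp add: margin_def sum_subtractf)

section \<open>Existence, positivity and optimality of the projection\<close>

locale copula_support =
  fixes d :: nat and r :: "nat \<Rightarrow> nat" and S :: "multi_index set"
  assumes d_pos: "1 \<le> d"
    and r_pos: "\<And>l. l \<in> {1..d} \<Longrightarrow> 1 \<le> r l"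
    and copula_ex: "copula_arrays_on d r S \<noteq> {}"
begin

text \<open>The context fixes the support but no array, so the facts below serve \<open>p\<close>
  and every estimate of \<open>p\<close> with the same support.\<close>

definition positive_on :: "real_array \<Rightarrow> bool" where
  "positive_on a \<longleftrightarrow> a \<in> arrays d r \<and> supp d r a = S \<and> (\<forall>i \<in> S. 0 < a i)"

lemma S_subset: "S \<subseteq> idx_set d r"
  using copula_ex by (auto simp: copula_arrays_on_def supp_def)

lemma positive_onI:
  assumes "\<And>i. i \<notin> S \<Longrightarrow> a i = 0" "\<And>i. i \<in> S \<Longrightarrow> 0 < a i"
  shows "positive_on a"
proof -
  have "a i \<noteq> 0 \<longleftrightarrow> i \<in> S" for i
    using assms[of i] by (cases "i \<in> S") auto
  then have "supp d r a = S"
    using S_subset unfolding supp_def by blast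
  then show ?thesis
    using assms S_subset unfolding positive_on_def arrays_def by blast
qed

lemma finite_S: "finite S"
  using S_subset finite_idx_set finite_subset by blast

lemma sum_S: 
  assumes "supp d r a \<subseteq> S"
  shows "(\<Sum>i \<in> idx_set d r. a i) = (\<Sum>i \<in> S. a i)"
  by (rule sum.mono_neutral_right) (use assms S_subset in \<open>auto simp: finite_idx_set supp_def\<close>)

text \<open>The margins in one direction already determine the total. This removes the constant 1
  from the derivative of \<open>t * ln (t / c)\<close>, and later the rank-one part of the
  multinomial covariance.\<close>

lemma sum_zero_margin:
  assumes "a \<in> zero_margin_space d r S"
  shows "(\<Sum>i \<in> S. a i) = 0"
proof -
  have "(\<Sum>i \<in> S. a i) = (\<Sum>j = 1..r 1. margin d r a 1 j)"
    using sum_S[of a] sum_idx_set_margin[of 1 d a r] assms d_pos by (simp add: zero_margin_space_def)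
  also have "\<dots> = 0" using assms d_pos by (intro sum.neutral) (auto simp: zero_margin_space_def)
  finally show ?thesis .
qed

lemma zero_margin_outside: "a \<in> zero_margin_space d r S \<Longrightarrow> i \<notin> S \<Longrightarrow> a i = 0"
  by (auto simp: zero_margin_space_def supp_def arrays_def)

text \<open>Uniform margins force total mass 1, and nonnegative entries are then at most 1; so a
  perturbed copula array has to be checked for signs and margins only.\<close>

lemma copula_arraysI:
  assumes "\<And>i. i \<notin> S \<Longrightarrow> g i = 0" "\<And>i. i \<in> S \<Longrightarrow> 0 \<le> g i"
    and "\<And>l j. l \<in> {1..d} \<Longrightarrow> j \<in> {1..r l} \<Longrightarrow> margin d r g l j = 1 / real (r l)"
  shows "g \<in> copula_arrays d r"
proof -
  have nn: "0 \<le> g i" for i using assms by (cases "i \<in> S") auto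
  have "(\<Sum>i \<in> idx_set d r. g i) = (\<Sum>j = 1..r 1. margin d r g 1 j)"
    using d_pos by (intro sum_idx_set_margin) auto
  also have "\<dots> = 1" using assms(3) d_pos r_pos[of 1] by simp
  finally have 1: "(\<Sum>i \<in> idx_set d r. g i) = 1" .
  have le: "g i \<le> 1" if "i \<in> idx_set d r" for i
    using member_le_sum[OF that, of g] nn finite_idx_set 1 by simp
  have "0 < margin d r g l j" if "l \<in> {1..d}" "j \<in> {1..r l}" for l j
    using assms(3)[OF that] r_pos[of l] that by simp
  then show ?thesis
    using 1 nn le assms S_subset unfolding copula_arrays_def prob_arrays_def arrays_def by blast
qed

lemma copula_diff_zero_margin:
  assumes "g \<in> copula_arrays d r" "g' \<in> copula_arrays d r" "supp d r g \<subseteq> S" "supp d r g' \<subseteq> S"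
  shows "(\<lambda>i. g i - g' i) \<in> zero_margin_space d r S"
  using assms unfolding zero_margin_space_def
  by (auto simp: copula_arrays_def prob_arrays_def margin_diff arrays_def supp_def subset_iff)

lemma copula_outside:
  assumes "g \<in> copula_arrays d r" "supp d r g \<subseteq> S" "i \<notin> S"
  shows "g i = 0"
  using assms by (auto simp: copula_arrays_def prob_arrays_def arrays_def supp_def)

text \<open>The competitors supported in \<open>S\<close> form a compact set in the product
  topology, and the objective is continuous on it.\<close>

lemma ex_minimiser:
  assumes p: "positive_on p"
  shows "\<exists>g \<in> copula_arrays d r. supp d r g \<subseteq> S \<and>
    (\<forall>g' \<in> copula_arrays d r. supp d r g' \<subseteq> S \<longrightarrow>
      (\<Sum>i \<in> S. g i * ln (g i / p i)) \<le> (\<Sum>i \<in> S. g' i * ln (g' i / p i)))"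
proof -
  \<comment> \<open>The factors {0} off \<open>S\<close> keep the product over all multi-indices
    compact (Tychonoff) and at the same time force support in \<open>S\<close>.\<close>
  define B where "B = (\<Pi>\<^sub>E i \<in> UNIV. if i \<in> S then {0..1::real} else {0})"
  define K where "K = B \<inter> {g. \<forall>l \<in> {1..d}. \<forall>j \<in> {1..r l}. margin d r g l j = 1 / real (r l)}"
  have "compactin (product_topology (\<lambda>i. euclidean) UNIV) B"
    unfolding B_def by (subst compactin_PiE) auto
  then have B: "compact B" by (simp add: euclidean_product_topology)
  have "closed {g. margin d r g l j = 1 / real (r l)}" for l j
    unfolding margin_def
    by (intro closed_Collect_eq continuous_on_sum continuous_on_const
        continuous_on_product_coordinates)
  then have "compact K" unfolding K_def
    using B by (intro compact_Int_closed) (auto simp: Collect_ball_eq intro!: closed_INT)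
  moreover have K: "g \<in> K \<longleftrightarrow> g \<in> copula_arrays d r \<and> supp d r g \<subseteq> S" for g
  proof
    assume "g \<in> K"
    then have g: "g i \<in> (if i \<in> S then {0..1} else {0})" for i by (auto simp: K_def B_def PiE_iff)
    have g0: "g i = 0" if "i \<notin> S" for i using g[of i] that by auto
    have g1: "0 \<le> g i" if "i \<in> S" for i using g[of i] that by auto
    show "g \<in> copula_arrays d r \<and> supp d r g \<subseteq> S"
      using g0 g1 \<open>g \<in> K\<close> by (auto intro!: copula_arraysI simp: K_def supp_def)
  next
    assume "g \<in> copula_arrays d r \<and> supp d r g \<subseteq> S"
    then show "g \<in> K"
      using S_subset by (auto simp: K_def B_def PiE_iff copula_arrays_def prob_arrays_def arrays_def supp_def)
  qed
  moreover have "K \<noteq> {}"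
    using copula_ex K by (auto simp: copula_arrays_on_def)
  moreover have "continuous_on K (\<lambda>g. \<Sum>i \<in> S. g i * ln (g i / p i))"
  proof (rule continuous_on_sum)
    fix i assume i: "i \<in> S"
    \<comment> \<open>Splitting the logarithm of the quotient confines the boundary problem to
      \<open>t * ln t\<close>; at \<open>g i = 0\<close> both forms vanish.\<close>
    have "continuous_on K (\<lambda>g. g i * ln (g i) - g i * ln (p i))"
    proof (rule continuous_on_diff)
      have c: "continuous_on K (\<lambda>g. g i)"
        by (rule continuous_on_subset[OF continuous_on_product_coordinates]) simp
      have "(\<lambda>g. g i) ` K \<subseteq> {0..}" using K i S_subset by (auto simp: copula_arrays_def prob_arrays_def)
      then show "continuous_on K (\<lambda>g. g i * ln (g i))"
        using continuous_on_compose2[OF continuous_on_mult_ln c] by blast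
      show "continuous_on K (\<lambda>g. g i * ln (p i))"
        by (intro continuous_on_mult c continuous_on_const)
    qed
    moreover have "g i * ln (g i / p i) = g i * ln (g i) - g i * ln (p i)" if "g \<in> K" for g
    proof -
      have "0 < p i" "0 \<le> g i" using i p that K[of g] S_subset
        by (auto simp: positive_on_def copula_arrays_def prob_arrays_def)
      then show ?thesis by (cases "g i = 0") (auto simp: ln_div algebra_simps)
    qed
    ultimately show "continuous_on K (\<lambda>g. g i * ln (g i / p i))"
      by (simp cong: continuous_on_cong)
  qed
  ultimately show ?thesis
    using continuous_attains_inf[of K "\<lambda>g. \<Sum>i \<in> S. g i * ln (g i / p i)"] by blast
qed

text \<open>\<open>I_proj\<close> is a choice, so it has properties only once some minimiser is
  exhibited. Competitors whose support leaves \<open>S\<close> have divergence \<infinity>; hence a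
  minimiser among arrays supported in \<open>S\<close> is a global one, and every global one has
  finite divergence and therefore support in \<open>S\<close>.\<close>

lemma I_proj_minimises:
  assumes p: "positive_on p"
  shows "I_proj d r p \<in> copula_arrays d r" "supp d r (I_proj d r p) \<subseteq> S"
    and "\<And>g. g \<in> copula_arrays d r \<Longrightarrow> supp d r g \<subseteq> S \<Longrightarrow>
      (\<Sum>i \<in> S. I_proj d r p i * ln (I_proj d r p i / p i)) \<le> (\<Sum>i \<in> S. g i * ln (g i / p i))"
proof -
  obtain g where g: "g \<in> copula_arrays d r" "supp d r g \<subseteq> S"
    and gmin: "\<And>g'. g' \<in> copula_arrays d r \<Longrightarrow> supp d r g' \<subseteq> S \<Longrightarrow>
      (\<Sum>i \<in> S. g i * ln (g i / p i)) \<le> (\<Sum>i \<in> S. g' i * ln (g' i / p i))"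
    using ex_minimiser[OF p] by blast
  have sp: "supp d r p = S" using p by (simp add: positive_on_def)
  have "is_arg_min (\<lambda>g. I_div d r g p) (\<lambda>g. g \<in> copula_arrays d r) g"
    unfolding is_arg_min_linorder
  proof (intro conjI allI impI)
    fix g' assume "g' \<in> copula_arrays d r"
    then show "I_div d r g p \<le> I_div d r g' p"
      using gmin[of g'] g sp by (cases "supp d r g' \<subseteq> S") (auto simp: I_div_def)
  qed (rule g)
  then have "is_arg_min (\<lambda>g. I_div d r g p) (\<lambda>g. g \<in> copula_arrays d r) (I_proj d r p)"
    unfolding I_proj_def arg_min_def by (rule someI[of "is_arg_min _ _"])
  then have *: "I_proj d r p \<in> copula_arrays d r"
    "\<And>g'. g' \<in> copula_arrays d r \<Longrightarrow> I_div d r (I_proj d r p) p \<le> I_div d r g' p"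
    by (auto simp: is_arg_min_linorder)
  show "I_proj d r p \<in> copula_arrays d r" by (rule *)
  show s: "supp d r (I_proj d r p) \<subseteq> S"
    using *(2)[OF g(1)] g(2) sp by (auto simp: I_div_def split: if_splits)
  show "(\<Sum>i \<in> S. I_proj d r p i * ln (I_proj d r p i / p i)) \<le> (\<Sum>i \<in> S. g i * ln (g i / p i))"
    if "g \<in> copula_arrays d r" "supp d r g \<subseteq> S" for g
    using *(2)[OF that(1)] that(2) sp s by (simp add: I_div_def)
qed

text \<open>
  Minty's form of the optimality condition: the derivative is evaluated at the competitor \<open>g\<close>, which
  is positive on \<open>S\<close>, and not at the minimiser, which might a priori vanish somewhere on \<open>S\<close>.
\<close>

lemma I_proj_variational:
  assumes p: "positive_on p" and g: "g \<in> copula_arrays d r" "positive_on g"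
  shows "0 \<le> (\<Sum>i \<in> S. ln (g i / p i) * (g i - I_proj d r p i))"
proof -
  let ?h = "I_proj d r p"
  note h = I_proj_minimises[OF p]
  have sg: "supp d r g \<subseteq> S" using g by (simp add: positive_on_def)
  have "(\<Sum>i \<in> S. g i * ln (g i / p i) + (ln (g i / p i) + 1) * (?h i - g i))
      \<le> (\<Sum>i \<in> S. ?h i * ln (?h i / p i))"
    using p g h(1) S_subset
    by (intro sum_mono mult_ln_gradient) (auto simp: positive_on_def copula_arrays_def prob_arrays_def)
  also have "\<dots> \<le> (\<Sum>i \<in> S. g i * ln (g i / p i))" by (rule h(3)[OF g(1) sg])
  finally have "(\<Sum>i \<in> S. (ln (g i / p i) + 1) * (?h i - g i)) \<le> 0" by (simp add: sum.distrib)
  moreover have "(\<Sum>i \<in> S. (ln (g i / p i) + 1) * (?h i - g i)) =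
      (\<Sum>i \<in> S. ?h i - g i) - (\<Sum>i \<in> S. ln (g i / p i) * (g i - ?h i))"
    by (simp add: sum_subtractf[symmetric] algebra_simps)
  moreover have "(\<Sum>i \<in> S. ?h i - g i) = 0"
    using sum_zero_margin[OF copula_diff_zero_margin[OF h(1) g(1) h(2) sg]] by simp
  ultimately show ?thesis by simp
qed

text \<open>If the minimiser vanished at \<open>j\<close>, moving it slightly towards a copula array
  \<open>g\<close> that is positive on \<open>S\<close> would decrease the divergence, because of
  the infinite slope at 0. Quantitatively: in the variational inequality at the mixture
  \<open>gt\<close>, the term at \<open>j\<close> can be made arbitrarily negative while the other
  terms stay bounded above.\<close>

lemma I_proj_positive:
  assumes p: "positive_on p"
  shows "positive_on (I_proj d r p)"
proof -
  let ?h = "I_proj d r p"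
  note h = I_proj_minimises[OF p]
  have nn: "0 \<le> ?h i" if "i \<in> S" for i
    using h(1) S_subset that by (auto simp: copula_arrays_def prob_arrays_def)
  obtain g where g: "g \<in> copula_arrays d r" "supp d r g = S"
    using copula_ex by (auto simp: copula_arrays_on_def)
  have gpos: "0 < g i" if "i \<in> S" for i
    using g that S_subset by (auto simp: copula_arrays_def prob_arrays_def supp_def less_le)
  have ppos: "0 < p i" if "i \<in> S" for i using p that by (simp add: positive_on_def)
  have "?h j \<noteq> 0" if j: "j \<in> S" for j
  proof
    assume hj: "?h j = 0"
    define C where "C = (\<Sum>i \<in> S - {j}. ln (g i / p i) * (g i - ?h i))"
    \<comment> \<open>Chosen so that \<open>gt j / p j = t * g j / p j\<close> is at most
      \<open>exp (- (\<bar>C\<bar> + 1) / g j)\<close>; the term at \<open>j\<close> is then at most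
      \<open>- (\<bar>C\<bar> + 1)\<close>, which outweighs \<open>C\<close>.\<close>
    define t where "t = min 1 (p j / g j * exp (- (\<bar>C\<bar> + 1) / g j))"
    have t: "0 < t" "t \<le> 1" using gpos[OF j] ppos[OF j] by (auto simp: t_def)
    define gt where "gt = (\<lambda>i. ?h i + t * (g i - ?h i))"
    have gt_alt: "gt i = (1 - t) * ?h i + t * g i" for i by (simp add: gt_def algebra_simps)
    have gtpos: "0 < gt i" if "i \<in> S" for i
      unfolding gt_alt using t nn[OF that] gpos[OF that] by (intro add_nonneg_pos mult_nonneg_nonneg) auto
    have gt0: "gt i = 0" if "i \<notin> S" for i
      using that h(1,2) g copula_outside[OF h(1,2) that] copula_outside[OF g(1) _ that] by (simp add: gt_def)
    have gtc: "gt \<in> copula_arrays d r"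
    proof (rule copula_arraysI)
      fix l j assume "l \<in> {1..d}" "j \<in> {1..r l}"
      then show "margin d r gt l j = 1 / real (r l)"
        using h(1) g(1) unfolding gt_def
        by (simp add: margin_add margin_cmult margin_diff copula_arrays_def)
    qed (use gt0 gtpos less_imp_le in blast)+
    have gtp: "positive_on gt" by (rule positive_onI[OF gt0 gtpos])
    have "0 \<le> (\<Sum>i \<in> S. ln (gt i / p i) * (gt i - ?h i))"
      by (rule I_proj_variational[OF p gtc gtp])
    also have "\<dots> = t * (\<Sum>i \<in> S. ln (gt i / p i) * (g i - ?h i))"
      by (simp add: gt_def sum_distrib_left algebra_simps)
    finally have "0 \<le> (\<Sum>i \<in> S. ln (gt i / p i) * (g i - ?h i))"
      using t(1) by (simp add: zero_le_mult_iff)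
    also have "\<dots> = ln (gt j / p j) * (g j - ?h j) + (\<Sum>i \<in> S - {j}. ln (gt i / p i) * (g i - ?h i))"
      by (rule sum.remove[OF finite_S j])
    \<comment> \<open>Since \<open>gt i\<close> lies between \<open>?h i\<close> and
      \<open>g i\<close>, replacing it by \<open>g i\<close> moves the logarithm in the direction of
      the sign of \<open>g i - ?h i\<close>. The resulting bound \<open>C\<close> does not depend on
      \<open>t\<close>, so \<open>t\<close> may be chosen in terms of it.\<close>
    also have "(\<Sum>i \<in> S - {j}. ln (gt i / p i) * (g i - ?h i)) \<le> C"
      unfolding C_def
    proof (rule sum_mono)
      fix i assume "i \<in> S - {j}"
      then have i: "i \<in> S" by simp
      show "ln (gt i / p i) * (g i - ?h i) \<le> ln (g i / p i) * (g i - ?h i)"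
      proof (cases "?h i \<le> g i")
        case True
        have "gt i = g i - (1 - t) * (g i - ?h i)" by (simp add: gt_def algebra_simps)
        then have "gt i \<le> g i" using True t by simp
        then have "ln (gt i / p i) \<le> ln (g i / p i)"
          using gtpos[OF i] gpos[OF i] ppos[OF i] by (simp add: divide_right_mono)
        then show ?thesis using True by (intro mult_right_mono) auto
      next
        case False
        have "gt i = g i + (1 - t) * (?h i - g i)" by (simp add: gt_def algebra_simps)
        then have "g i \<le> gt i" using False t by simp
        then have "ln (g i / p i) \<le> ln (gt i / p i)"
          using gtpos[OF i] gpos[OF i] ppos[OF i] by (simp add: divide_right_mono)
        then show ?thesis using False by (intro mult_right_mono_neg) auto
      qed
    qed
    also have "ln (gt j / p j) * (g j - ?h j) \<le> - (\<bar>C\<bar> + 1)"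
    proof -
      have "gt j / p j = t * (g j / p j)" by (simp add: gt_def hj)
      also have "\<dots> \<le> (p j / g j * exp (- (\<bar>C\<bar> + 1) / g j)) * (g j / p j)"
        using gpos[OF j] ppos[OF j] by (intro mult_right_mono) (auto simp: t_def)
      also have "\<dots> = exp (- (\<bar>C\<bar> + 1) / g j)" using gpos[OF j] ppos[OF j] by simp
      finally have "ln (gt j / p j) \<le> - (\<bar>C\<bar> + 1) / g j"
        using gtpos[OF j] ppos[OF j] by (metis divide_pos_pos ln_exp ln_mono exp_gt_zero)
      then have "ln (gt j / p j) * g j \<le> (- (\<bar>C\<bar> + 1) / g j) * g j"
        using gpos[OF j] by (intro mult_right_mono) auto
      then show ?thesis using gpos[OF j] hj by simp
    qed
    finally show False by linarith
  qed
  then show ?thesis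
    using nn copula_outside[OF h(1,2)] by (intro positive_onI) (simp_all add: less_le)
qed

lemma I_proj_le_1: "positive_on p \<Longrightarrow> i \<in> S \<Longrightarrow> I_proj d r p i \<le> 1"
  using I_proj_minimises(1)[of p] S_subset by (auto simp: copula_arrays_def prob_arrays_def)

text \<open>A positive minimiser may be moved a little along any zero-margin direction
  \<open>a\<close>. The variational inequality at \<open>?h + t a\<close>, divided by t and taken to
  the limit t \<rightarrow> 0+, gives one sign; the direction -a gives the other.\<close>

lemma I_proj_orthogonal:
  assumes p: "positive_on p" and a: "a \<in> zero_margin_space d r S"
  shows "(\<Sum>i \<in> S. (ln (I_proj d r p i) - ln (p i)) * a i) = 0"
proof -
  let ?h = "I_proj d r p"
  have hpos: "0 < ?h i" "0 < p i" if "i \<in> S" for i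
    using that p I_proj_positive[OF p] by (auto simp: positive_on_def)
  have *: "0 \<le> (\<Sum>i \<in> S. ln (?h i / p i) * a i)" if a: "a \<in> zero_margin_space d r S" for a
  proof -
    have lim: "((\<lambda>t. ?h i + t * a i) \<longlongrightarrow> ?h i) (at_right 0)" for i
      by (auto intro!: tendsto_eq_intros)
    have "\<forall>\<^sub>F t in at_right 0. \<forall>i \<in> S. 0 < ?h i + t * a i"
      using order_tendstoD(1)[OF lim] hpos finite_S by (intro eventually_ball_finite) auto
    then have ev: "\<forall>\<^sub>F t in at_right 0. 0 \<le> (\<Sum>i \<in> S. ln ((?h i + t * a i) / p i) * a i)"
      using eventually_at_right_less[of 0]
    proof eventually_elim
      case (elim t)
      define g where "g = (\<lambda>i. ?h i + t * a i)"
      have g0: "g i = 0" if "i \<notin> S" for i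
        using that I_proj_positive[OF p] zero_margin_outside[OF a that]
        by (auto simp: g_def positive_on_def supp_def arrays_def)
      have "g \<in> copula_arrays d r"
      proof (rule copula_arraysI)
        fix l j assume "l \<in> {1..d}" "j \<in> {1..r l}"
        then show "margin d r g l j = 1 / real (r l)"
          using I_proj_minimises(1)[OF p] a unfolding g_def
          by (simp add: margin_add margin_cmult copula_arrays_def zero_margin_space_def)
      qed (use g0 elim in \<open>auto simp: g_def less_imp_le\<close>)
      moreover have "positive_on g"
        by (rule positive_onI) (use g0 elim in \<open>auto simp: g_def\<close>)
      ultimately have "0 \<le> (\<Sum>i \<in> S. ln (g i / p i) * (g i - ?h i))"
        by (rule I_proj_variational[OF p])
      also have "\<dots> = t * (\<Sum>i \<in> S. ln ((?h i + t * a i) / p i) * a i)"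
        by (simp add: g_def sum_distrib_left algebra_simps)
      finally show ?case using elim by (simp add: zero_le_mult_iff)
    qed
    have "((\<lambda>t. \<Sum>i \<in> S. ln ((?h i + t * a i) / p i) * a i) \<longlongrightarrow> (\<Sum>i \<in> S. ln (?h i / p i) * a i)) (at_right 0)"
    proof (intro tendsto_sum tendsto_mult tendsto_const tendsto_ln tendsto_divide lim)
      fix i assume "i \<in> S"
      from hpos[OF this] show "p i \<noteq> 0" "?h i / p i \<noteq> 0" by auto
    qed
    from tendsto_lowerbound[OF this ev] show ?thesis by simp
  qed
  have "(\<lambda>i. (-1) * a i) \<in> zero_margin_space d r S"
    using a unfolding zero_margin_space_def arrays_def supp_def
    by (simp only: mem_Collect_eq margin_cmult) auto
  from *[OF this] *[OF a] have "(\<Sum>i \<in> S. ln (?h i / p i) * a i) = 0"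
    by (simp add: sum_negf)
  moreover have "ln (?h i / p i) = ln (?h i) - ln (p i)" if "i \<in> S" for i
    using hpos[OF that] by (simp add: ln_div)
  ultimately show ?thesis by simp
qed

lemma array_dist_S:
  assumes "supp d r a \<subseteq> S" "supp d r b \<subseteq> S"
  shows "array_dist d r a b = L2_set (\<lambda>i. a i - b i) S"
proof -
  have "a i = 0 \<and> b i = 0" if "i \<in> idx_set d r - S" for i
    using assms that unfolding supp_def by blast
  then have "(\<Sum>i \<in> idx_set d r. (a i - b i)\<^sup>2) = (\<Sum>i \<in> S. (a i - b i)\<^sup>2)"
    using S_subset finite_idx_set by (intro sum.mono_neutral_right) auto
  then show ?thesis by (simp add: array_dist_def L2_set_def)
qed

text \<open>
  Testing the two orthogonality relations against the difference of the projections, the strong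
  monotonicity of the logarithm on \<open>(0, 1]\<close> and the Cauchy-Schwarz inequality give a global
  Lipschitz bound in logarithmic coordinates.
\<close>

lemma I_proj_lipschitz_ln:
  assumes p: "positive_on p" and q: "positive_on q"
  shows "array_dist d r (I_proj d r q) (I_proj d r p) \<le> L2_set (\<lambda>i. ln (q i) - ln (p i)) S"
proof -
  define u where "u = (\<lambda>i. I_proj d r q i - I_proj d r p i)"
  have u: "u \<in> zero_margin_space d r S" unfolding u_def
    by (intro copula_diff_zero_margin I_proj_minimises p q)
  have pos: "0 < I_proj d r q i" "0 < I_proj d r p i" if "i \<in> S" for i
    using that I_proj_positive[OF p] I_proj_positive[OF q] by (auto simp: positive_on_def)
  have D: "array_dist d r (I_proj d r q) (I_proj d r p) = L2_set u S"
    unfolding u_def by (intro array_dist_S I_proj_minimises p q)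
  have "(L2_set u S)\<^sup>2 = (\<Sum>i \<in> S. (u i)\<^sup>2)"
    by (simp add: L2_set_def sum_nonneg)
  also have "\<dots> \<le> (\<Sum>i \<in> S. (ln (I_proj d r q i) - ln (I_proj d r p i)) * u i)"
    unfolding u_def by (intro sum_mono ln_strongly_mono pos I_proj_le_1 p q)
  also have "\<dots> = (\<Sum>i \<in> S. (ln (q i) - ln (p i)) * u i)"
    using I_proj_orthogonal[OF q u] I_proj_orthogonal[OF p u]
    by (simp add: left_diff_distrib sum_subtractf)
  also have "\<dots> \<le> (\<Sum>i \<in> S. \<bar>ln (q i) - ln (p i)\<bar> * \<bar>u i\<bar>)"
    by (intro sum_mono) (metis abs_ge_self abs_mult)
  also have "\<dots> \<le> L2_set (\<lambda>i. ln (q i) - ln (p i)) S * L2_set u S"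
    by (rule L2_set_mult_ineq)
  finally have "L2_set u S * L2_set u S \<le> L2_set (\<lambda>i. ln (q i) - ln (p i)) S * L2_set u S"
    by (simp add: power2_eq_square)
  then show ?thesis unfolding D
    by (metis L2_set_nonneg less_eq_real_def mult_right_le_imp_le)
qed

end

subsection \<open>Coordinates and matrices\<close>

lemma coord_pos_bij: "bij_betw coord_pos (UNIV :: 'n::{finite,linorder} set) {1..CARD('n)}"
proof -
  have less: "coord_pos a < coord_pos b" if "a < b" for a b :: 'n
    unfolding coord_pos_def using that by (intro psubset_card_mono) auto
  have inj: "inj (coord_pos :: 'n \<Rightarrow> nat)"
  proof (rule injI)
    fix a b :: 'n assume "coord_pos a = coord_pos b"
    then show "a = b" using less[of a b] less[of b a] by (cases a b rule: linorder_cases) auto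
  qed
  have "coord_pos c \<in> {1..CARD('n)}" for c :: 'n
    unfolding coord_pos_def by (auto simp: Suc_le_eq card_gt_0_iff intro!: card_mono)
  then have "range (coord_pos :: 'n \<Rightarrow> nat) \<subseteq> {1..CARD('n)}" by auto
  moreover have "card (range (coord_pos :: 'n \<Rightarrow> nat)) = card {1..CARD('n)}"
    using inj by (simp add: card_image)
  ultimately have "range (coord_pos :: 'n \<Rightarrow> nat) = {1..CARD('n)}"
    by (intro card_subset_eq) auto
  then show ?thesis using inj by (simp add: bij_betw_def)
qed

text \<open>Uniqueness of division with remainder, with remainders in 1..N instead of 0..N-1,
  because positions are counted from 1.\<close>

lemma mixed_radix_unique:
  fixes a b x y N :: nat
  assumes eq: "a + x * N = b + y * N" and a: "1 \<le> a" "a \<le> N" and b: "1 \<le> b" "b \<le> N"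
  shows "a = b \<and> x = y"
proof -
  have *: "y \<le> x" if "a + x * N = b + y * N" "a \<le> N" "1 \<le> b" for a b x y
  proof (rule ccontr)
    assume "\<not> y \<le> x"
    then obtain k where "y = x + Suc k" using less_imp_Suc_add by (metis add_Suc_right not_le)
    then have "a = b + N + k * N" using that(1) by (simp add: algebra_simps)
    then show False using that(2,3) by simp
  qed
  have "x = y" using *[OF eq a(2) b(1)] *[OF eq[symmetric] b(2) a(1)] by simp
  then show ?thesis using eq by simp
qed

text \<open>The last index is the most significant digit: induction on \<open>d\<close> peels it
  off, and the position in the first \<open>d\<close> directions is the remainder.\<close>

lemma col_major_Suc:
  "1 \<le> d \<Longrightarrow> col_major (Suc d) r i = col_major d r i + (i (Suc d) - 1) * (\<Prod>m = 1..d. r m)"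
  by (simp add: col_major_def)

lemma col_major_bound:
  assumes "1 \<le> d" "\<And>l. l \<in> {1..d} \<Longrightarrow> i l \<in> {1..r l}"
  shows "col_major d r i \<in> {1..\<Prod>l = 1..d. r l}"
  using assms
proof (induction d rule: nat_induct_at_least)
  case base
  then show ?case by (auto simp: col_major_def)
next
  case (Suc d)
  let ?N = "\<Prod>l = 1..d. r l"
  have IH: "col_major d r i \<in> {1..?N}" using Suc by simp
  have "i (Suc d) - 1 + 1 \<le> r (Suc d)" using Suc.prems[of "Suc d"] by simp
  then have "(i (Suc d) - 1 + 1) * ?N \<le> r (Suc d) * ?N" by (rule mult_right_mono) simp
  then have "(i (Suc d) - 1) * ?N + ?N \<le> r (Suc d) * ?N" by (simp add: algebra_simps)
  then show ?case using IH Suc.hyps by (simp add: col_major_Suc mult.commute)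
qed

lemma col_major_eqD:
  assumes "1 \<le> d" "\<And>l. l \<in> {1..d} \<Longrightarrow> i l \<in> {1..r l}" "\<And>l. l \<in> {1..d} \<Longrightarrow> j l \<in> {1..r l}"
    and "col_major d r i = col_major d r j"
  shows "\<forall>l \<in> {1..d}. i l = j l"
  using assms
proof (induction d rule: nat_induct_at_least)
  case base
  then show ?case by (auto simp: col_major_def)
next
  case (Suc d)
  have mem: "i l \<in> {1..r l}" "j l \<in> {1..r l}" if "l \<in> {1..d}" for l
    using that Suc.prems(1,2)[of l] by simp_all
  have i: "col_major d r i \<in> {1..\<Prod>l = 1..d. r l}" and j: "col_major d r j \<in> {1..\<Prod>l = 1..d. r l}"
    using mem Suc.hyps by (blast intro: col_major_bound)+
  have "col_major d r i = col_major d r j \<and> i (Suc d) - 1 = j (Suc d) - 1"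
    by (rule mixed_radix_unique[where N = "\<Prod>l = 1..d. r l"])
      (use i j Suc.prems(3) Suc.hyps in \<open>auto simp: col_major_Suc\<close>)
  moreover have "1 \<le> i (Suc d)" "1 \<le> j (Suc d)"
    using Suc.prems(1,2)[of "Suc d"] by auto
  moreover have "\<forall>l \<in> {1..d}. i l = j l" if "col_major d r i = col_major d r j"
    using Suc.IH[OF mem that] by simp
  ultimately have "i l = j l" if "l \<in> {1..Suc d}" for l
    using that by (cases "l = Suc d") auto
  then show ?case by blast
qed

text \<open>An injection into a finite set of the same size is onto, so no digits have to be
  computed from a position.\<close>

lemma col_major_bij:
  assumes "1 \<le> d"
  shows "bij_betw (col_major d r) (idx_set d r) {1..\<Prod>l = 1..d. r l}"
proof -
  have mem: "i l \<in> {1..r l}" if "i \<in> idx_set d r" "l \<in> {1..d}" for i l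
    using that by (auto simp: idx_set_def)
  have inj: "inj_on (col_major d r) (idx_set d r)"
  proof (rule inj_onI)
    fix i j assume ij: "i \<in> idx_set d r" "j \<in> idx_set d r" "col_major d r i = col_major d r j"
    then have "\<forall>l \<in> {1..d}. i l = j l" using mem by (intro col_major_eqD[OF assms]) auto
    then show "i = j" using ij by (auto simp: idx_set_def intro: PiE_ext)
  qed
  have "col_major d r ` idx_set d r \<subseteq> {1..\<Prod>l = 1..d. r l}"
    using col_major_bound[OF assms] mem by blast
  moreover have "card (col_major d r ` idx_set d r) = card {1..\<Prod>l = 1..d. r l}"
    using inj by (simp add: card_image idx_set_def card_PiE)
  ultimately have "col_major d r ` idx_set d r = {1..\<Prod>l = 1..d. r l}"
    by (intro card_subset_eq) auto
  then show ?thesis using inj by (simp add: bij_betw_def)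
qed

definition entry :: "nat \<Rightarrow> (nat \<Rightarrow> nat) \<Rightarrow> 'n::{finite,linorder} \<Rightarrow> multi_index" where
  "entry d r c = inv_into (idx_set d r) (col_major d r) (coord_pos c)"

lemma vectorise_nth: "vectorise d r a $ c = a (entry d r c)"
  by (simp add: vectorise_def entry_def)

lemma entry_bij:
  assumes "1 \<le> d" and "CARD('n::{finite,linorder}) = (\<Prod>l = 1..d. r l)"
  shows "bij_betw (entry d r :: 'n \<Rightarrow> multi_index) UNIV (idx_set d r)"
proof -
  have "bij_betw (inv_into (idx_set d r) (col_major d r) \<circ> (coord_pos :: 'n \<Rightarrow> nat)) UNIV (idx_set d r)"
    using coord_pos_bij[where 'n = 'n] bij_betw_inv_into[OF col_major_bij[OF assms(1), of r]] assms(2)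
    by (intro bij_betw_trans) auto
  moreover have "entry d r = inv_into (idx_set d r) (col_major d r) \<circ> (coord_pos :: 'n \<Rightarrow> nat)"
    by (simp add: fun_eq_iff entry_def)
  ultimately show ?thesis by simp
qed

text \<open>The column of the 1 in row \<open>s\<close>, so that the selection matrix acts on
  vectors as composition with this map.\<close>

definition selected :: "nat \<Rightarrow> (nat \<Rightarrow> nat) \<Rightarrow> multi_index set \<Rightarrow> 's::{finite,linorder} \<Rightarrow> 'n::{finite,linorder}" where
  "selected d r S s =
     inv_into UNIV coord_pos (sorted_list_of_set (col_major d r ` S) ! (coord_pos s - 1))"

text \<open>The rows enumerate \<open>S\<close> without repetition, which turns sums over the row
  type into sums over \<open>S\<close>. The order of the rows then disappears from every later
  argument.\<close>

lemma
  assumes d: "1 \<le> d" and n: "CARD('n::{finite,linorder}) = (\<Prod>l = 1..d. r l)"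
    and S: "S \<subseteq> idx_set d r" and s: "CARD('s::{finite,linorder}) = card S"
  shows selection_matrix_nth: "\<And>(i :: 's) (c :: 'n). selection_matrix d r S $ i $ c = (if c = selected d r S i then 1 else 0)"
    and entry_selected_bij: "bij_betw (\<lambda>i :: 's. entry d r (selected d r S i :: 'n)) UNIV S"
proof -
  let ?L = "sorted_list_of_set (col_major d r ` S)"
  have fin: "finite S" using S finite_idx_set finite_subset by blast
  have inj: "inj_on (col_major d r) S"
    using col_major_bij[OF d, of r] S by (meson bij_betw_def inj_on_subset)
  have "col_major d r ` S \<subseteq> {1..CARD('n)}"
    using col_major_bij[OF d, of r] S n by (auto simp: bij_betw_def)
  have len: "length ?L = card S" using inj by (simp add: card_image)
  \<comment> \<open>Coordinates are numbered from 1 and list positions from 0, hence the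
    shift.\<close>
  have b1: "bij_betw (\<lambda>i :: 's. coord_pos i - 1) UNIV {..<card S}"
  proof -
    have "bij_betw (\<lambda>k. k - 1) {1..card S} {..<card S}"
      by (rule bij_betwI[where g = Suc]) auto
    from bij_betw_trans[OF _ this, of coord_pos] show ?thesis
      using coord_pos_bij[where 'n = 's] s by (simp add: comp_def)
  qed
  have b2: "bij_betw (\<lambda>k. ?L ! k) {..<card S} (col_major d r ` S)"
    by (rule bij_betw_nth) (use fin len in auto)
  have b12: "bij_betw (\<lambda>i :: 's. ?L ! (coord_pos i - 1)) UNIV (col_major d r ` S)"
    using bij_betw_trans[OF b1 b2] by (simp add: comp_def)
  have pos: "coord_pos (selected d r S i :: 'n) = ?L ! (coord_pos i - 1)" for i :: 's
  proof -
    have "?L ! (coord_pos i - 1) \<in> range (coord_pos :: 'n \<Rightarrow> nat)"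
      using bij_betwE[OF b12] \<open>col_major d r ` S \<subseteq> _\<close> bij_betw_imp_surj_on[OF coord_pos_bij[where 'n = 'n]]
      by blast
    then show ?thesis unfolding selected_def by (rule f_inv_into_f)
  qed
  show "selection_matrix d r S $ i $ c = (if c = selected d r S i then 1 else 0)" for i :: 's and c :: 'n
    using pos[of i] inj_eq[OF bij_betw_imp_inj_on[OF coord_pos_bij[where 'n = 'n]], of c "selected d r S i"]
    by (simp add: selection_matrix_def)
  have "bij_betw (inv_into (idx_set d r) (col_major d r)) (col_major d r ` S) S"
    using col_major_bij[OF d, of r] S by (meson bij_betw_def bij_betw_inv_into_subset)
  from bij_betw_trans[OF b12 this]
  show "bij_betw (\<lambda>i :: 's. entry d r (selected d r S i :: 'n)) UNIV S"
    by (simp add: comp_def entry_def pos)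
qed

section \<open>Inverses, diagonal matrices and the expansion of the logarithm\<close>

lemma matrix_inv_works:
  fixes A :: "real ^ 'n ^ 'm"
  assumes "invertible A"
  shows "A ** matrix_inv A = mat 1" "matrix_inv A ** A = mat 1"
  using someI_ex[OF assms[unfolded invertible_def]] by (auto simp: matrix_inv_def)

lemma matrix_inv_eqI:
  fixes A :: "real ^ 'n ^ 'm"
  assumes "A ** B = mat 1" "B ** A = mat 1"
  shows "matrix_inv A = B"
proof -
  have "invertible A" using assms by (auto simp: invertible_def)
  then have "matrix_inv A ** (A ** B) = B"
    by (simp add: matrix_mul_assoc matrix_inv_works)
  then show ?thesis by (simp add: assms)
qed

lemma diag_matrix_mult: "diag_matrix u ** diag_matrix v = diag_matrix (\<chi> i. u $ i * v $ i)"
  by (simp add: vec_eq_iff diag_matrix_def matrix_matrix_mult_def if_distrib[of "\<lambda>x. x * _"]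
      sum.delta' cong: if_cong)

lemma diag_matrix_vector: "diag_matrix u *v w = (\<chi> i. u $ i * w $ i)"
  by (simp add: vec_eq_iff diag_matrix_def matrix_vector_mult_def if_distrib[of "\<lambda>x. x * _"] cong: if_cong)

lemma diag_matrix_inv_eq:
  assumes "\<And>i. v $ i \<noteq> 0"
  shows "diag_matrix_inv v = diag_matrix (\<chi> i. 1 / v $ i)"
  unfolding diag_matrix_inv_def
  by (rule matrix_inv_eqI)
    (use assms in \<open>simp_all add: diag_matrix_mult\<close>, simp_all add: vec_eq_iff diag_matrix_def mat_def)

lemma transpose_diag_matrix: "transpose (diag_matrix v) = diag_matrix v"
  by (auto simp: vec_eq_iff transpose_def diag_matrix_def)

lemma transpose_matrix_inv:
  fixes A :: "real ^ 'n ^ 'n"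
  assumes "invertible A"
  shows "transpose (matrix_inv A) = matrix_inv (transpose A)"
  by (rule matrix_inv_eqI[symmetric])
    (simp_all add: matrix_transpose_mul[symmetric] matrix_inv_works[OF assms] transpose_mat)

lemma inner_transpose_matrix_vector:
  fixes B :: "real ^ 'n ^ 'm"
  shows "y \<bullet> (transpose B *v w) = (B *v y) \<bullet> w"
  by (metis dot_lmul_matrix inner_commute transpose_matrix_vector)

lemma sum_fun_apply: "(\<Sum>k \<in> K. f k) x = (\<Sum>k \<in> K. f k x)"
  for f :: "'a \<Rightarrow> 'b \<Rightarrow> 'c::comm_monoid_add"
  by (induction K rule: infinite_finite_induct) auto

text \<open>With x = (q - p) / p the difference of logarithms is ln (1 + x), and |x| \<le> h / m
  \<le> 1 / 2 is the range in which |ln (1 + x) - x| \<le> 2 x^2. The common bounds \<open>m\<close>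
  and \<open>h\<close> make the estimate uniform over the entries of an array.\<close>

lemma abs_ln_diff_minus_quotient_le:
  fixes p q m h :: real
  assumes m: "0 < m" "m \<le> p" and h: "\<bar>q - p\<bar> \<le> h" "h \<le> m / 2"
  shows "\<bar>ln q - ln p - (q - p) / p\<bar> \<le> 2 * (h / m)\<^sup>2" "\<bar>ln q - ln p\<bar> \<le> 2 * (h / m)"
proof -
  define x where "x = (q - p) / p"
  have p: "0 < p" using m by simp
  have q: "0 < q" using m h by (auto simp: abs_if split: if_splits)
  have "\<bar>x\<bar> = \<bar>q - p\<bar> / p" using p by (simp add: x_def)
  also have "\<dots> \<le> h / m" using m h by (intro frac_le) auto
  finally have x: "\<bar>x\<bar> \<le> h / m" .
  have "h / m \<le> 1 / 2" using m h by (simp add: field_simps)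
  then have x2: "\<bar>x\<bar> \<le> 1 / 2" using x by linarith
  have "1 + x = q / p" using p by (simp add: x_def field_simps)
  then have "ln (1 + x) = ln q - ln p" using p q by (simp add: ln_div)
  then have b: "\<bar>ln q - ln p - x\<bar> \<le> 2 * x\<^sup>2"
    using abs_ln_one_plus_x_minus_x_bound[OF x2] by simp
  have sq: "x\<^sup>2 \<le> (h / m)\<^sup>2" using x by (metis abs_ge_zero power2_abs power_mono)
  show "\<bar>ln q - ln p - (q - p) / p\<bar> \<le> 2 * (h / m)\<^sup>2" using b sq by (simp add: x_def)
  have "2 * x\<^sup>2 \<le> \<bar>x\<bar>" using x2 mult_right_mono[OF x2, of "\<bar>x\<bar>"] by (simp add: power2_eq_square abs_mult[symmetric])
  then show "\<bar>ln q - ln p\<bar> \<le> 2 * (h / m)" using b x by linarith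
qed

section \<open>The linearised projection in coordinates\<close>

locale copula_coordinates = copula_support d r S
  for d r S +
  fixes p :: real_array
    and \<Delta> :: "'k::finite \<Rightarrow> real_array"
    and A :: "real ^ 'k ^ 'n::{finite,linorder}"
    and R :: "real ^ 'n::{finite,linorder} ^ 's::{finite,linorder}"
    and At :: "real ^ 'k ^ 's::{finite,linorder}"
    and G H :: "real ^ 'k ^ 'k"
    and J \<Sigma>\<^sub>\<gamma> :: "real ^ 'n::{finite,linorder} ^ 'n::{finite,linorder}"
  assumes p_pos: "positive_on p"
    and A_def: "A = (\<chi> c j. (vectorise d r (\<Delta> j) :: real ^ 'n::{finite,linorder}) $ c)"
    and R_def: "R = selection_matrix d r S"
    and At_def: "At = R ** A"
    and G_def: "G = transpose At ** diag_matrix_inv (R *v vectorise d r (I_proj d r p)) ** At"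
    and H_def: "H = transpose At ** diag_matrix_inv (R *v vectorise d r p) ** At"
    and J_def: "J = A ** matrix_inv G ** transpose At
                      ** diag_matrix_inv (R *v vectorise d r p) ** R"
    and Sigma_def: "\<Sigma>\<^sub>\<gamma> = A ** matrix_inv G ** H ** matrix_inv G ** transpose A"
    and card_n: "CARD('n) = (\<Prod>l = 1..d. r l)" and card_s: "CARD('s) = card S"
    and basis: "inj \<Delta>" "independent (range \<Delta>)" "span (range \<Delta>) = zero_margin_space d r S"
begin

definition sel :: "'s::{finite,linorder} \<Rightarrow> 'n::{finite,linorder}" where "sel = selected d r S"

definition ent :: "'s::{finite,linorder} \<Rightarrow> multi_index" where "ent s = entry d r (sel s)"

abbreviation vct :: "real_array \<Rightarrow> real ^ 'n::{finite,linorder}" where "vct \<equiv> vectorise d r"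

text \<open>The isomorphism from coefficient vectors onto the zero-margin space; \<open>A\<close>
  and \<open>At\<close> are its coordinate forms on all multi-indices and on
  \<open>S\<close>.\<close>

definition lincomb :: "real ^ 'k::finite \<Rightarrow> real_array" where
  "lincomb y = (\<lambda>i. \<Sum>k \<in> UNIV. y $ k * \<Delta> k i)"

lemma ent_bij: "bij_betw ent UNIV S"
  using entry_selected_bij[OF d_pos card_n S_subset card_s] by (simp add: ent_def[abs_def] sel_def)

lemma ent_mem: "ent s \<in> S"
  using ent_bij by (auto simp: bij_betw_def)

lemma sel_inj: "inj sel"
  by (rule inj_on_imageI2[of "entry d r"])
    (use ent_bij in \<open>simp add: ent_def[abs_def] comp_def bij_betw_def\<close>)

lemma sum_ent: "(\<Sum>s \<in> UNIV. f (ent s)) = (\<Sum>i \<in> S. f i)"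
  by (rule sum.reindex_bij_betw[OF ent_bij])

lemma R_nth: "R $ s $ c = (if c = sel s then 1 else 0)"
  unfolding R_def sel_def by (rule selection_matrix_nth[OF d_pos card_n S_subset card_s])

lemma R_vector: "(R *v v) $ s = v $ sel s"
  by (simp add: matrix_vector_mult_def R_nth if_distrib[of "\<lambda>x. x * _"] cong: if_cong)

lemma R_vec: "(R *v vct a) $ s = a (ent s)"
  by (simp add: R_vector vectorise_nth ent_def)

lemma A_vector: "A *v y = vct (lincomb y)"
  by (simp add: vec_eq_iff matrix_vector_mult_def A_def vectorise_nth lincomb_def mult.commute)

lemma At_vector: "(At *v y) $ s = lincomb y (ent s)"
proof -
  have "At *v y = R *v (A *v y)" by (simp add: At_def matrix_vector_mul_assoc)
  then show ?thesis by (simp add: A_vector R_vec)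
qed

text \<open>\<open>transpose At\<close> tests a vector on \<open>S\<close> against all basis arrays
  at once, so orthogonality to the zero-margin space becomes one vector equation.\<close>

lemma transpose_At_vector: "(transpose At *v w) $ k = (\<Sum>s \<in> UNIV. \<Delta> k (ent s) * w $ s)"
proof -
  have "At $ s $ k = \<Delta> k (ent s)" for s
  proof -
    have "At $ s $ k = (At *v axis k 1) $ s" by (simp add: matrix_vector_mul_component inner_axis)
    also have "\<dots> = \<Delta> k (ent s)"
      by (simp add: At_vector lincomb_def axis_def if_distrib[of "\<lambda>x. x * _"] cong: if_cong)
    finally show ?thesis .
  qed
  then show ?thesis by (simp add: matrix_vector_mult_def transpose_def del: transpose_matrix_vector)
qed

lemma lincomb_eq: "lincomb y = (\<Sum>k \<in> UNIV. y $ k *\<^sub>R \<Delta> k)"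
  by (rule ext) (simp add: lincomb_def sum_fun_apply scaleR_fun_def)

lemma Delta_zero_margin: "\<Delta> k \<in> zero_margin_space d r S"
  using basis(3) by (metis rangeI span_base)

lemma lincomb_zero_margin: "lincomb y \<in> zero_margin_space d r S"
  unfolding lincomb_eq basis(3)[symmetric] by (intro span_sum span_scale span_base) simp

lemma ex_lincomb:
  assumes "a \<in> zero_margin_space d r S"
  obtains y where "a = lincomb y"
proof -
  have "a \<in> span (range \<Delta>)" using assms basis(3) by simp
  then obtain f where f: "a = (\<Sum>v \<in> range \<Delta>. f v *\<^sub>R v)"
    by (subst (asm) span_finite) auto
  have "a = (\<Sum>k \<in> UNIV. f (\<Delta> k) *\<^sub>R \<Delta> k)"
    unfolding f by (simp add: sum.reindex[OF basis(1)])
  then have "a = lincomb (\<chi> k. f (\<Delta> k))" by (simp add: lincomb_eq)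
  then show thesis by (rule that)
qed

lemma lincomb_eq_0D:
  assumes "lincomb y = 0"
  shows "y = 0"
proof -
  \<comment> \<open>Independence is a property of the set of basis arrays; injectivity of the family
    makes coefficients indexed by \<open>k\<close> into coefficients of its elements.\<close>
  define f where "f v = y $ inv \<Delta> v" for v
  have "(\<Sum>v \<in> range \<Delta>. f v *\<^sub>R v) = 0"
    using assms by (simp add: sum.reindex[OF basis(1)] f_def lincomb_eq inv_f_f[OF basis(1)])
  then have "f (\<Delta> k) = 0" for k
    using independentD[OF basis(2), of "range \<Delta>" f "\<Delta> k"] by simp
  then show ?thesis by (simp add: f_def vec_eq_iff inv_f_f[OF basis(1)])
qed

lemma p_ent_pos: "0 < p (ent s)" and proj_ent_pos: "0 < I_proj d r p (ent s)"
  using p_pos I_proj_positive[OF p_pos] ent_mem by (auto simp: positive_on_def)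

lemma diag_inv_p: "diag_matrix_inv (R *v vct p) = diag_matrix (\<chi> s. 1 / p (ent s))"
  using p_ent_pos by (subst diag_matrix_inv_eq) (auto simp: R_vec less_le)

lemma diag_inv_proj: "diag_matrix_inv (R *v vct (I_proj d r p)) = diag_matrix (\<chi> s. 1 / I_proj d r p (ent s))"
  using proj_ent_pos by (subst diag_matrix_inv_eq) (auto simp: R_vec less_le)

lemma G_vector: "G *v y = transpose At *v (\<chi> s. lincomb y (ent s) / I_proj d r p (ent s))"
  by (simp add: G_def diag_inv_proj matrix_vector_mul_assoc[symmetric] diag_matrix_vector At_vector
      del: transpose_matrix_vector)

lemma H_vector: "H *v y = transpose At *v (\<chi> s. lincomb y (ent s) / p (ent s))"
  by (simp add: H_def diag_inv_p matrix_vector_mul_assoc[symmetric] diag_matrix_vector At_vector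
      del: transpose_matrix_vector)

lemma J_vector: "J *v v = A *v (matrix_inv G *v (transpose At *v (\<chi> s. v $ sel s / p (ent s))))"
  by (simp add: J_def diag_inv_p matrix_vector_mul_assoc[symmetric] diag_matrix_vector R_vector
      del: transpose_matrix_vector)

text \<open>\<open>G\<close> is the Gram matrix of the basis for the inner product with weights 1 /
  \<open>I_proj d r p\<close> on \<open>S\<close>. The weights are positive, an array of the space
  that vanishes on \<open>S\<close> is zero, and the basis is independent; so the kernel is
  trivial.\<close>

lemma G_invertible: "invertible G"
proof -
  have "y = 0" if "G *v y = 0" for y
  proof -
    have "0 = y \<bullet> (G *v y)" using that by simp
    also have "\<dots> = (\<Sum>s \<in> UNIV. (lincomb y (ent s))\<^sup>2 / I_proj d r p (ent s))"
      unfolding G_vector inner_transpose_matrix_vector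
      by (simp add: inner_vec_def At_vector power2_eq_square)
    finally have "(\<Sum>s \<in> UNIV. (lincomb y (ent s))\<^sup>2 / I_proj d r p (ent s)) = 0" by simp
    then have "\<forall>s. (lincomb y (ent s))\<^sup>2 / I_proj d r p (ent s) = 0"
      by (subst (asm) sum_nonneg_eq_0_iff) (auto intro: divide_nonneg_pos proj_ent_pos)
    then have *: "lincomb y (ent s) = 0" for s
      using proj_ent_pos[of s] by (auto dest: spec[of _ s])
    have "lincomb y i = 0" for i
    proof (cases "i \<in> S")
      case True
      then obtain s where "i = ent s" using ent_bij by (auto simp: bij_betw_def)
      then show ?thesis using * by simp
    qed (use zero_margin_outside[OF lincomb_zero_margin] in simp)
    then have "lincomb y = 0" by (simp add: fun_eq_iff)
    then show ?thesis by (rule lincomb_eq_0D)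
  qed
  then show ?thesis using matrix_left_invertible_ker[of G] by (auto simp: invertible_left_inverse)
qed

lemma norm_vec_diff: "norm (vct a - vct b) = array_dist d r a b"
proof -
  have "(\<Sum>c \<in> (UNIV :: 'n set). (a (entry d r c) - b (entry d r c))\<^sup>2) = (\<Sum>i \<in> idx_set d r. (a i - b i)\<^sup>2)"
    by (rule sum.reindex_bij_betw[OF entry_bij[OF d_pos card_n]])
  then show ?thesis
    by (simp add: norm_vec_def L2_set_def array_dist_def vectorise_nth)
qed

lemma abs_diff_le_norm_vec:
  assumes "i \<in> S"
  shows "\<bar>a i - b i\<bar> \<le> norm (vct a - vct b)"
proof -
  obtain c :: 'n where "i = entry d r c"
    using assms S_subset entry_bij[OF d_pos card_n] by (auto simp: bij_betw_def)
  then show ?thesis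
    using component_le_norm_cart[of "vct a - vct b" c] by (simp add: vectorise_nth)
qed

text \<open>
  Linearising both logarithms in the orthogonality relations leaves a linear system with matrix \<open>G\<close>
  for the coordinates of the difference of the projections; no implicit function theorem is needed,
  since the Lipschitz bound already makes the remainders quadratic.
\<close>

lemma I_proj_expansion:
  obtains C \<delta> where "0 < \<delta>" "0 \<le> C"
    and "\<And>q. positive_on q \<Longrightarrow> norm (vct q - vct p) < \<delta> \<Longrightarrow>
      norm (vct (I_proj d r q) - vct (I_proj d r p) - J *v (vct q - vct p)) \<le> C * (norm (vct q - vct p))\<^sup>2"
proof -
  define g where "g = I_proj d r p"
  have gpos: "positive_on g" unfolding g_def by (rule I_proj_positive[OF p_pos])
  \<comment> \<open>A common lower bound for \<open>p\<close> and its projection on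
    \<open>S\<close>; the inserted 1 guarantees a nonempty set.\<close>
  define m where "m = Min (insert 1 (p ` S \<union> g ` S))"
  have fin: "finite (insert 1 (p ` S \<union> g ` S))" using finite_S by simp
  have m: "0 < m" unfolding m_def using fin p_pos gpos
    by (subst Min_gr_iff) (auto simp: positive_on_def)
  have mp: "m \<le> p i" and mg: "m \<le> g i" if "i \<in> S" for i
    unfolding m_def using fin that by (auto intro!: Min_le)
  \<comment> \<open>Lipschitz constant of the projection near \<open>p\<close>:
    \<open>card S\<close> logarithmic differences, each at most 2 / m times the distance.\<close>
  define B where "B = real (card S) * (2 / m)"
  have B: "0 \<le> B" using m by (simp add: B_def)
  \<comment> \<open>One Taylor remainder at \<open>p\<close>, where entries move by at most
    \<open>N\<close>, and one at the projection \<open>g\<close>, where they move by at most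
    \<open>B * N\<close>.\<close>
  define E where "E = 2 * (1 / m)\<^sup>2 + 2 * (B / m)\<^sup>2"
  define K where "K = A ** matrix_inv G ** transpose At"
  define C where "C = onorm ((*v) K) * (real CARD('s) * E)"
  \<comment> \<open>The two bounds ensure \<open>N \<le> m / 2\<close> and
    \<open>B * N \<le> m / 2\<close>, as the two expansions require; \<open>B + 1\<close> keeps the
    denominator positive.\<close>
  define \<delta> where "\<delta> = min (m / 2) (m / (2 * (B + 1)))"
  have "0 < \<delta>" using m B by (simp add: \<delta>_def)
  moreover have E0: "0 \<le> E" by (simp add: E_def)
  then have "0 \<le> C" by (simp add: C_def onorm_pos_le)
  moreover have "norm (vct (I_proj d r q) - vct (I_proj d r p) - J *v (vct q - vct p))
      \<le> C * (norm (vct q - vct p))\<^sup>2"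
    if q: "positive_on q" and qN: "norm (vct q - vct p) < \<delta>" for q
  proof -
    define N where "N = norm (vct q - vct p)"
    define h where "h = I_proj d r q"
    define u where "u = (\<lambda>i. h i - g i)"
    have N: "0 \<le> N" "N \<le> m / 2" using qN by (auto simp: N_def \<delta>_def)
    have "N < m / (2 * (B + 1))" using qN by (simp add: N_def \<delta>_def)
    then have "N * (2 * (B + 1)) < m" using B by (simp add: pos_less_divide_eq)
    then have BN: "B * N \<le> m / 2" using N by (simp add: algebra_simps)
    have qp: "\<bar>q i - p i\<bar> \<le> N" if "i \<in> S" for i
      unfolding N_def by (rule abs_diff_le_norm_vec[OF that])
    note lnp = abs_ln_diff_minus_quotient_le[OF m mp qp N(2)]
    have ub: "\<bar>h i - g i\<bar> \<le> B * N" if "i \<in> S" for i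
    proof -
      have "\<bar>h i - g i\<bar> \<le> array_dist d r h g"
        using abs_diff_le_norm_vec[OF that, of h g] by (simp add: norm_vec_diff)
      also have "\<dots> \<le> L2_set (\<lambda>i. ln (q i) - ln (p i)) S"
        unfolding h_def g_def by (rule I_proj_lipschitz_ln[OF p_pos q])
      also have "\<dots> \<le> (\<Sum>i \<in> S. \<bar>ln (q i) - ln (p i)\<bar>)" by (rule L2_set_le_sum_abs)
      also have "\<dots> \<le> (\<Sum>i \<in> S. 2 * (N / m))" by (intro sum_mono lnp)
      also have "\<dots> = B * N" by (simp add: B_def)
      finally show ?thesis .
    qed
    note lng = abs_ln_diff_minus_quotient_le[OF m mg ub BN]
    have uz: "u \<in> zero_margin_space d r S"
      unfolding u_def h_def g_def by (intro copula_diff_zero_margin I_proj_minimises p_pos q)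
    then obtain y where y: "u = lincomb y" by (rule ex_lincomb)
    \<comment> \<open>The remainder at \<open>p\<close> minus the remainder at \<open>g\<close>:
      exactly the error made when both logarithmic differences are replaced by quotients.\<close>
    define w :: "real ^ 's::{finite,linorder}" where "w = (\<chi> s. (ln (q (ent s)) - ln (p (ent s)) - (q (ent s) - p (ent s)) / p (ent s))
       - (ln (h (ent s)) - ln (g (ent s)) - (h (ent s) - g (ent s)) / g (ent s)))"
    have "\<bar>w $ s\<bar> \<le> E * N\<^sup>2" for s
    proof -
      have "\<bar>w $ s\<bar> \<le> 2 * (N / m)\<^sup>2 + 2 * (B * N / m)\<^sup>2"
        unfolding w_def vec_lambda_beta using lnp(1)[of "ent s"] lng(1)[of "ent s"] ent_mem[of s] by linarith
      also have "\<dots> = E * N\<^sup>2" by (simp add: E_def power_mult_distrib power_divide algebra_simps)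
      finally show ?thesis .
    qed
    then have "norm w \<le> (\<Sum>s \<in> (UNIV :: 's set). E * N\<^sup>2)"
      by (intro order.trans[OF norm_le_l1_cart] sum_mono)
    then have w: "norm w \<le> real CARD('s) * E * N\<^sup>2" by simp
    have "G *v y = transpose At *v (\<chi> s. (vct q - vct p) $ sel s / p (ent s)) + transpose At *v w"
    proof -
      have "(G *v y) $ k = (transpose At *v (\<chi> s. (vct q - vct p) $ sel s / p (ent s))) $ k + (transpose At *v w) $ k" for k
      proof -
        have "(\<Sum>i \<in> S. (ln (h i) - ln (q i)) * \<Delta> k i) = 0" "(\<Sum>i \<in> S. (ln (g i) - ln (p i)) * \<Delta> k i) = 0"
          unfolding h_def g_def by (intro I_proj_orthogonal p_pos q Delta_zero_margin)+
        \<comment> \<open>The difference of the orthogonality relations for \<open>q\<close> and for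
          \<open>p\<close>, both tested against the same basis array.\<close>
        then have "(\<Sum>i \<in> S. ((ln (q i) - ln (p i)) - (ln (h i) - ln (g i))) * \<Delta> k i) = 0"
          by (simp add: left_diff_distrib sum_subtractf)
        then have "(\<Sum>s \<in> UNIV. ((ln (q (ent s)) - ln (p (ent s))) - (ln (h (ent s)) - ln (g (ent s)))) * \<Delta> k (ent s)) = 0"
          using sum_ent[of "\<lambda>i. ((ln (q i) - ln (p i)) - (ln (h i) - ln (g i))) * \<Delta> k i"] by simp
        moreover have "(\<Sum>s \<in> UNIV. \<Delta> k (ent s) * ((q (ent s) - p (ent s)) / p (ent s))) + (\<Sum>s \<in> UNIV. \<Delta> k (ent s) * w $ s)
            - (\<Sum>s \<in> UNIV. \<Delta> k (ent s) * (u (ent s) / g (ent s)))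
            = (\<Sum>s \<in> UNIV. ((ln (q (ent s)) - ln (p (ent s))) - (ln (h (ent s)) - ln (g (ent s)))) * \<Delta> k (ent s))"
          unfolding sum.distrib[symmetric] sum_subtractf[symmetric]
          by (rule sum.cong) (simp_all add: w_def u_def algebra_simps)
        ultimately show ?thesis
          by (simp add: G_vector transpose_At_vector y g_def vectorise_nth ent_def del: transpose_matrix_vector)
      qed
      then show ?thesis by (simp add: vec_eq_iff del: transpose_matrix_vector)
    qed
    then have "matrix_inv G *v (G *v y) = matrix_inv G *v (transpose At *v (\<chi> s. (vct q - vct p) $ sel s / p (ent s)))
        + matrix_inv G *v (transpose At *v w)"
      by (simp add: matrix_vector_right_distrib del: transpose_matrix_vector)
    then have "y = matrix_inv G *v (transpose At *v (\<chi> s. (vct q - vct p) $ sel s / p (ent s)))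
        + matrix_inv G *v (transpose At *v w)"
      by (simp add: matrix_vector_mul_assoc matrix_inv_works[OF G_invertible] del: transpose_matrix_vector)
    then have "A *v y = J *v (vct q - vct p) + K *v w"
      by (simp add: J_vector K_def matrix_vector_mul_assoc[symmetric] matrix_vector_right_distrib del: transpose_matrix_vector)
    moreover have "A *v y = vct h - vct g"
      by (simp add: A_vector y[symmetric] u_def vec_eq_iff vectorise_nth)
    ultimately have "vct h - vct g - J *v (vct q - vct p) = K *v w" by simp
    moreover have "norm (K *v w) \<le> onorm ((*v) K) * norm w" by (rule onorm) simp
    also have "\<dots> \<le> onorm ((*v) K) * (real CARD('s) * E * N\<^sup>2)"
      by (intro mult_left_mono w onorm_pos_le) simp
    ultimately show ?thesis by (simp add: C_def N_def h_def g_def mult.assoc)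
  qed
  ultimately show thesis by (rule that)
qed

lemma transpose_G: "transpose G = G"
  by (simp add: G_def diag_inv_proj matrix_transpose_mul transpose_diag_matrix transpose_transpose matrix_mul_assoc)

lemma transpose_H: "transpose H = H"
  by (simp add: H_def diag_inv_p matrix_transpose_mul transpose_diag_matrix transpose_transpose matrix_mul_assoc)

lemma transpose_inv_G: "transpose (matrix_inv G) = matrix_inv G"
  by (simp add: transpose_matrix_inv[OF G_invertible] transpose_G)

lemma transpose_Sigma: "transpose \<Sigma>\<^sub>\<gamma> = \<Sigma>\<^sub>\<gamma>"
  by (simp add: Sigma_def matrix_transpose_mul transpose_transpose transpose_inv_G transpose_H matrix_mul_assoc)

text \<open>This identifies J V J^T with the stated covariance through quadratic forms. With
  \<open>y\<close> the image of \<open>t\<close> under \<open>matrix_inv G ** transpose A\<close>,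
  the vector \<open>transpose J *v t\<close> is \<open>lincomb y\<close> divided by \<open>p\<close>
  on \<open>S\<close>; the diagonal part of \<open>V\<close> yields
  \<open>y \<bullet> (H *v y)\<close>.\<close>

lemma Sigma_quadratic:
  defines "V \<equiv> diag_matrix (vct p) - outer_product (vct p) (vct p)"
  shows "t \<bullet> (\<Sigma>\<^sub>\<gamma> *v t) = (transpose J *v t) \<bullet> (V *v (transpose J *v t))"
proof -
  define y where "y = matrix_inv G *v (transpose A *v t)"
  define z :: "real ^ 's::{finite,linorder}" where "z = (\<chi> s. lincomb y (ent s) / p (ent s))"
  define w where "w = transpose R *v z"
  have wJ: "transpose J *v t = w"
    by (simp add: J_def diag_inv_p matrix_transpose_mul transpose_transpose transpose_inv_G
        transpose_diag_matrix matrix_vector_mul_assoc[symmetric] diag_matrix_vector At_vector y_def[symmetric]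
        w_def z_def del: transpose_matrix_vector)
  have wsel: "w $ sel s = z $ s" for s
    by (simp add: w_def matrix_vector_mult_def transpose_def R_nth inj_eq[OF sel_inj]
        if_distrib[of "\<lambda>x. x * _"] cong: if_cong del: transpose_matrix_vector)
  have inner_w: "w \<bullet> v = (\<Sum>s \<in> UNIV. z $ s * v $ sel s)" for v
    unfolding w_def using inner_transpose_matrix_vector[of v R z]
    by (simp add: inner_commute inner_vec_def R_vector mult.commute del: transpose_matrix_vector)
  \<comment> \<open>The weights \<open>p\<close> cancel and the total of a zero-margin array
    remains, so the rank-one part of \<open>V\<close> contributes nothing.\<close>
  have "w \<bullet> vct p = (\<Sum>s \<in> UNIV. lincomb y (ent s))"
    unfolding inner_w by (rule sum.cong) (use p_ent_pos in \<open>auto simp: z_def vectorise_nth ent_def[symmetric] less_le\<close>)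
  also have "\<dots> = 0"
    by (simp add: sum_ent sum_zero_margin[OF lincomb_zero_margin])
  finally have wp: "w \<bullet> vct p = 0" .
  have "V *v w = (\<chi> c. vct p $ c * w $ c) - (w \<bullet> vct p) *\<^sub>R vct p"
    by (simp add: V_def matrix_vector_mult_diff_rdistrib diag_matrix_vector)
      (simp add: vec_eq_iff outer_product_def matrix_vector_mult_def inner_vec_def sum_distrib_left sum_distrib_right mult_ac)
  then have "V *v w = (\<chi> c. vct p $ c * w $ c)" by (simp add: wp)
  then have "w \<bullet> (V *v w) = (\<Sum>s \<in> UNIV. z $ s * (p (ent s) * z $ s))"
    by (simp add: inner_w wsel vectorise_nth ent_def)
  also have "\<dots> = (At *v y) \<bullet> z"
    unfolding inner_vec_def
    by (rule sum.cong) (use p_ent_pos in \<open>auto simp: z_def At_vector less_le\<close>)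
  also have "\<dots> = y \<bullet> (H *v y)"
    unfolding H_vector inner_transpose_matrix_vector z_def ..
  also have "\<dots> = t \<bullet> (\<Sigma>\<^sub>\<gamma> *v t)"
  proof -
    have "t \<bullet> (\<Sigma>\<^sub>\<gamma> *v t) = t \<bullet> (transpose (matrix_inv G ** transpose A) *v (H *v y))"
      by (simp add: Sigma_def y_def matrix_transpose_mul transpose_transpose transpose_inv_G matrix_vector_mul_assoc matrix_mul_assoc
          del: transpose_matrix_vector)
    also have "\<dots> = ((matrix_inv G ** transpose A) *v t) \<bullet> (H *v y)"
      by (rule inner_transpose_matrix_vector)
    also have "\<dots> = y \<bullet> (H *v y)"
      by (simp add: y_def matrix_vector_mul_assoc del: transpose_matrix_vector)
    finally show ?thesis by simp
  qed
  finally show ?thesis by (simp add: wJ del: transpose_matrix_vector)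
qed

end

subsection \<open>Weak convergence in Euclidean space\<close>

text \<open>The common estimate behind both approximation arguments below: \<eta> off the
  exceptional event, and the trivial bound 2 B on it.\<close>

lemma (in prob_space) abs_expectation_diff_le:
  fixes f g :: "'a \<Rightarrow> real"
  assumes [measurable]: "f \<in> borel_measurable M" "g \<in> borel_measurable M" "E \<in> sets M"
    and f: "\<And>\<omega>. \<bar>f \<omega>\<bar> \<le> B" and g: "\<And>\<omega>. \<bar>g \<omega>\<bar> \<le> B"
    and le: "\<And>\<omega>. \<omega> \<in> space M \<Longrightarrow> \<omega> \<notin> E \<Longrightarrow> \<bar>f \<omega> - g \<omega>\<bar> \<le> \<eta>" and "0 \<le> \<eta>"
  shows "\<bar>expectation f - expectation g\<bar> \<le> \<eta> + 2 * B * prob E"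
proof -
  have [simp]: "integrable M f" "integrable M g"
    using f g by (auto intro!: integrable_const_bound[of _ B])
  have B: "0 \<le> B" using f[of undefined] by linarith
  have ind: "integrable M (indicator E :: 'a \<Rightarrow> real)"
    by (rule integrable_real_indicator) (auto simp: emeasure_eq_measure)
  have "\<bar>expectation f - expectation g\<bar> = \<bar>expectation (\<lambda>\<omega>. f \<omega> - g \<omega>)\<bar>" by simp
  also have "\<dots> \<le> expectation (\<lambda>\<omega>. \<bar>f \<omega> - g \<omega>\<bar>)" by (rule integral_abs_bound)
  also have "\<dots> \<le> expectation (\<lambda>\<omega>. \<eta> + 2 * B * indicator E \<omega>)"
  proof (rule integral_mono)
    fix \<omega> assume "\<omega> \<in> space M"
    then show "\<bar>f \<omega> - g \<omega>\<bar> \<le> \<eta> + 2 * B * indicator E \<omega>"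
      using le[of \<omega>] f[of \<omega>] g[of \<omega>] \<open>0 \<le> \<eta>\<close> by (cases "\<omega> \<in> E") auto
  qed (use ind in auto)
  also have "\<dots> = \<eta> + 2 * B * prob E" using ind by (simp add: prob_space)
  finally show ?thesis .
qed

text \<open>Indicators of balls are not continuous, but the ramp lies between the indicators of norm
  > K + 1 and norm > K, which carries tightness from \<mu> to the sequence. Asking for ramp limits
  only makes the lemma usable both for vectors and for one coordinate on the real line.\<close>

lemma (in prob_space) tight_of_ramp_limits:
  fixes Y :: "nat \<Rightarrow> 'a \<Rightarrow> 'b::euclidean_space" and \<mu> :: "'b measure"
  assumes [measurable]: "\<And>n. Y n \<in> borel_measurable M"
    and mu: "prob_space \<mu>" and sets[measurable_cong]: "sets \<mu> = sets borel"
    and lim: "\<And>K. (\<lambda>n. \<integral>\<omega>. max 0 (min 1 (norm (Y n \<omega>) - K)) \<partial>M) \<longlonglongrightarrow> (\<integral>v. max 0 (min 1 (norm v - K)) \<partial>\<mu>)"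
    and "0 < \<epsilon>"
  obtains K where "0 < K" "\<forall>\<^sub>F n in sequentially. prob {\<omega> \<in> space M. norm (Y n \<omega>) > K} < \<epsilon>"
    "measure \<mu> {v. norm v > K} < \<epsilon>"
proof -
  interpret mu: prob_space \<mu> by (rule mu)
  have sp: "space \<mu> = UNIV" using sets_eq_imp_space_eq[OF sets] by simp
  have "(\<lambda>k. measure \<mu> {v. norm v > real k}) \<longlonglongrightarrow> measure \<mu> (\<Inter>k. {v. norm v > real k})"
    by (rule mu.finite_Lim_measure_decseq) (auto simp: decseq_def sets)
  moreover have "(\<Inter>k. {v :: 'b. norm v > real k}) = {}"
    by auto (meson less_irrefl real_arch_simple order_less_le_trans)
  ultimately have "(\<lambda>k. measure \<mu> {v. norm v > real k}) \<longlonglongrightarrow> 0" by simp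
  then have "\<forall>\<^sub>F k in sequentially. measure \<mu> {v. norm v > real k} < \<epsilon>"
    using \<open>0 < \<epsilon>\<close> by (rule order_tendstoD)
  then obtain k where k: "measure \<mu> {v. norm v > real k} < \<epsilon>"
    by (auto simp: eventually_sequentially)
  have "(\<integral>v. max 0 (min 1 (norm v - real k)) \<partial>\<mu>) \<le> (\<integral>v. indicator {v. norm v > real k} v \<partial>\<mu>)"
  proof (rule integral_mono)
    show "integrable \<mu> (\<lambda>v. max 0 (min 1 (norm v - real k)))"
      by (rule mu.integrable_const_bound[of _ 1]) auto
  qed (auto simp: indicator_def sp sets intro!: mu.integrable_const_bound[of _ 1])
  also have "\<dots> < \<epsilon>" using k by (simp add: sp)
  finally have "\<forall>\<^sub>F n in sequentially. (\<integral>\<omega>. max 0 (min 1 (norm (Y n \<omega>) - real k)) \<partial>M) < \<epsilon>"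
    by (rule order_tendstoD(2)[OF lim])
  then have "\<forall>\<^sub>F n in sequentially. prob {\<omega> \<in> space M. norm (Y n \<omega>) > real k + 1} < \<epsilon>"
  proof eventually_elim
    case (elim n)
    have "prob {\<omega> \<in> space M. norm (Y n \<omega>) > real k + 1}
        = (\<integral>\<omega>. indicator {\<omega> \<in> space M. norm (Y n \<omega>) > real k + 1} \<omega> \<partial>M)" by simp
    also have "\<dots> \<le> (\<integral>\<omega>. max 0 (min 1 (norm (Y n \<omega>) - real k)) \<partial>M)"
    proof (rule integral_mono)
      show "integrable M (\<lambda>\<omega>. max 0 (min 1 (norm (Y n \<omega>) - real k)))"
        by (rule integrable_const_bound[of _ 1]) auto
    qed (auto simp: indicator_def intro!: integrable_const_bound[of _ 1])
    finally show ?case using elim by simp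
  qed
  moreover have "measure \<mu> {v. norm v > real k + 1} \<le> measure \<mu> {v. norm v > real k}"
    by (rule mu.finite_measure_mono) (auto simp: sets)
  ultimately show thesis using k by (intro that[of "real k + 1"]) auto
qed

lemma bounded_range_real:
  fixes f :: "'a \<Rightarrow> real"
  assumes "bounded (range f)"
  obtains B where "0 < B" "\<And>x. \<bar>f x\<bar> \<le> B"
  using assms by (auto simp: bounded_pos)

lemma conv_in_distrD:
  fixes Y :: "nat \<Rightarrow> 'w \<Rightarrow> real ^ 'm" and f :: "real ^ 'm \<Rightarrow> real"
  assumes "conv_in_distr M Y \<mu>" "continuous_on UNIV f" "bounded (range f)"
  shows "(\<lambda>n. \<integral>\<omega>. f (Y n \<omega>) \<partial>M) \<longlonglongrightarrow> (\<integral>v. f v \<partial>\<mu>)"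
  using assms by (simp add: conv_in_distr_def)

lemma (in prob_space) conv_in_distr_tight:
  assumes Y: "conv_in_distr M Y \<mu>" and "0 < \<epsilon>"
  obtains K where "0 < K" "\<forall>\<^sub>F n in sequentially. prob {\<omega> \<in> space M. norm (Y n \<omega>) > K} < \<epsilon>"
proof (rule tight_of_ramp_limits[of Y \<mu> \<epsilon>])
  fix K :: real
  have "continuous_on UNIV (\<lambda>v :: real ^ 'b. max 0 (min 1 (norm v - K)))"
    by (intro continuous_intros)
  moreover have "bounded (range (\<lambda>v :: real ^ 'b. max 0 (min 1 (norm v - K))))"
    by (rule boundedI[of _ 1]) auto
  ultimately show "(\<lambda>n. \<integral>\<omega>. max 0 (min 1 (norm (Y n \<omega>) - K)) \<partial>M) \<longlonglongrightarrow> (\<integral>v. max 0 (min 1 (norm v - K)) \<partial>\<mu>)"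
    by (rule conv_in_distrD[OF Y])
qed (use assms that in \<open>auto simp: conv_in_distr_def\<close>)

text \<open>A bounded continuous function need not be uniformly continuous, but it is so on balls,
  and tightness keeps \<open>Y n\<close> in a ball up to small probability.\<close>

theorem (in prob_space) conv_in_distr_slutsky:
  assumes Y: "conv_in_distr M Y \<mu>" and W: "\<And>n. W n \<in> borel_measurable M"
    and diff: "\<And>\<epsilon>. 0 < \<epsilon> \<Longrightarrow> (\<lambda>n. prob {\<omega> \<in> space M. norm (W n \<omega> - Y n \<omega>) > \<epsilon>}) \<longlonglongrightarrow> 0"
  shows "conv_in_distr M W \<mu>"
  unfolding conv_in_distr_def
proof (intro conjI allI impI)
  show "prob_space \<mu>" "sets \<mu> = sets borel" using Y by (auto simp: conv_in_distr_def)
  note [measurable] = W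
  have [measurable]: "\<And>n. Y n \<in> borel_measurable M" using Y by (auto simp: conv_in_distr_def)
  fix f :: "real ^ 'b \<Rightarrow> real"
  assume f: "continuous_on UNIV f \<and> bounded (range f)"
  have [measurable]: "f \<in> borel_measurable borel" using f by (intro borel_measurable_continuous_onI) simp
  obtain B where B: "0 < B" "\<And>x. \<bar>f x\<bar> \<le> B" using f bounded_range_real by blast
  have "(\<lambda>n. (\<integral>\<omega>. f (W n \<omega>) \<partial>M) - (\<integral>\<omega>. f (Y n \<omega>) \<partial>M)) \<longlonglongrightarrow> 0"
  proof (rule tendstoI)
    fix \<epsilon> :: real assume \<epsilon>: "0 < \<epsilon>"
    \<comment> \<open>Two exceptional events of probability below \<eta> cost at most 2 B * 2 \<eta>
      = \<epsilon> / 3.\<close>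
    define \<eta> where "\<eta> = \<epsilon> / (12 * B)"
    have \<eta>: "0 < \<eta>" using \<epsilon> B by (simp add: \<eta>_def)
    obtain K where K: "0 < K" "\<forall>\<^sub>F n in sequentially. prob {\<omega> \<in> space M. norm (Y n \<omega>) > K} < \<eta>"
      using conv_in_distr_tight[OF Y \<eta>] .
    have "uniformly_continuous_on (cball 0 (K + 1)) f"
      using f by (intro compact_uniformly_continuous) (auto intro: continuous_on_subset)
    then obtain \<delta> where \<delta>: "0 < \<delta>"
      "\<And>x y. x \<in> cball 0 (K + 1) \<Longrightarrow> y \<in> cball 0 (K + 1) \<Longrightarrow> dist y x < \<delta> \<Longrightarrow> dist (f y) (f x) < \<epsilon> / 3"
      using \<epsilon> unfolding uniformly_continuous_on_def by (metis divide_pos_pos zero_less_numeral)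
    \<comment> \<open>Half of \<delta> turns the non-strict bound off the event into a strict one;
      the cap 1 keeps \<open>W n\<close> in the ball of radius \<open>K + 1\<close>.\<close>
    define \<delta>' where "\<delta>' = min (\<delta> / 2) 1"
    have \<delta>': "0 < \<delta>'" "\<delta>' < \<delta>" "\<delta>' \<le> 1" using \<delta>(1) by (auto simp: \<delta>'_def)
    have "\<forall>\<^sub>F n in sequentially. prob {\<omega> \<in> space M. norm (W n \<omega> - Y n \<omega>) > \<delta>'} < \<eta>"
      by (rule order_tendstoD(2)[OF diff[OF \<delta>'(1)] \<eta>])
    then show "\<forall>\<^sub>F n in sequentially. dist ((\<integral>\<omega>. f (W n \<omega>) \<partial>M) - (\<integral>\<omega>. f (Y n \<omega>) \<partial>M)) 0 < \<epsilon>"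
      using K(2)
    proof eventually_elim
      case (elim n)
      let ?E1 = "{\<omega> \<in> space M. norm (W n \<omega> - Y n \<omega>) > \<delta>'}" and ?E2 = "{\<omega> \<in> space M. norm (Y n \<omega>) > K}"
      have "\<bar>(\<integral>\<omega>. f (W n \<omega>) \<partial>M) - (\<integral>\<omega>. f (Y n \<omega>) \<partial>M)\<bar> \<le> \<epsilon> / 3 + 2 * B * prob (?E1 \<union> ?E2)"
      proof (rule abs_expectation_diff_le)
        fix \<omega> assume \<omega>: "\<omega> \<in> space M" "\<omega> \<notin> ?E1 \<union> ?E2"
        then have 1: "norm (W n \<omega> - Y n \<omega>) \<le> \<delta>'" "norm (Y n \<omega>) \<le> K" by auto
        have "norm (W n \<omega>) \<le> norm (Y n \<omega>) + norm (W n \<omega> - Y n \<omega>)" by (rule norm_triangle_sub)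
        then have "norm (W n \<omega>) \<le> K + 1" using 1 \<delta>' by linarith
        then have "dist (f (W n \<omega>)) (f (Y n \<omega>)) < \<epsilon> / 3"
          using 1 \<delta>' by (intro \<delta>(2)) (auto simp: dist_norm)
        then show "\<bar>f (W n \<omega>) - f (Y n \<omega>)\<bar> \<le> \<epsilon> / 3" by (simp add: dist_real_def)
      qed (use B \<epsilon> in auto)
      also have "prob (?E1 \<union> ?E2) \<le> prob ?E1 + prob ?E2" by (rule measure_Un_le) auto
      also have "\<dots> \<le> 2 * \<eta>" using elim by simp
      also have "\<epsilon> / 3 + 2 * B * (2 * \<eta>) < \<epsilon>" using B \<epsilon> by (simp add: \<eta>_def field_simps)
      finally show ?case using B by (simp add: dist_real_def)
    qed
  qed
  moreover have "(\<lambda>n. \<integral>\<omega>. f (Y n \<omega>) \<partial>M) \<longlonglongrightarrow> (\<integral>v. f v \<partial>\<mu>)" using Y f by (simp add: conv_in_distr_def)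
  ultimately show "(\<lambda>n. \<integral>\<omega>. f (W n \<omega>) \<partial>M) \<longlonglongrightarrow> (\<integral>v. f v \<partial>\<mu>)" using tendsto_add by fastforce
qed (use W in auto)

lemma conv_in_distr_matrix:
  fixes J :: "real ^ 'a ^ 'b"
  assumes Y: "conv_in_distr M Y \<mu>"
  shows "conv_in_distr M (\<lambda>n \<omega>. J *v Y n \<omega>) (distr \<mu> borel ((*v) J))"
  unfolding conv_in_distr_def
proof (intro conjI allI impI)
  have c: "continuous_on UNIV ((*v) J)" by (intro linear_continuous_on) (simp add: linear_linear)
  have s[measurable_cong]: "sets \<mu> = sets borel" using Y by (simp add: conv_in_distr_def)
  have mJ[measurable]: "(*v) J \<in> borel_measurable borel" using c by (rule borel_measurable_continuous_onI)
  have mY[measurable]: "\<And>n. Y n \<in> borel_measurable M" using Y by (simp add: conv_in_distr_def)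
  show "\<And>n. (\<lambda>\<omega>. J *v Y n \<omega>) \<in> borel_measurable M" by measurable
  show "prob_space (distr \<mu> borel ((*v) J))"
    using Y by (intro prob_space.prob_space_distr) (auto simp: conv_in_distr_def)
  fix f :: "real ^ 'b \<Rightarrow> real"
  assume f: "continuous_on UNIV f \<and> bounded (range f)"
  have [measurable]: "f \<in> borel_measurable borel" using f by (intro borel_measurable_continuous_onI) simp
  have "continuous_on UNIV (\<lambda>v. f (J *v v))" using f c by (auto intro: continuous_on_compose2)
  moreover have "bounded (range (\<lambda>v. f (J *v v)))" using f by (auto elim!: bounded_subset)
  ultimately have "(\<lambda>n. \<integral>\<omega>. f (J *v Y n \<omega>) \<partial>M) \<longlonglongrightarrow> (\<integral>v. f (J *v v) \<partial>\<mu>)"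
    by (rule conv_in_distrD[OF Y])
  also have "(\<integral>v. f (J *v v) \<partial>\<mu>) = (\<integral>v. f v \<partial>distr \<mu> borel ((*v) J))"
    by (simp add: integral_distr)
  finally show "(\<lambda>n. \<integral>\<omega>. f (J *v Y n \<omega>) \<partial>M) \<longlonglongrightarrow> (\<integral>v. f v \<partial>distr \<mu> borel ((*v) J))" .
qed simp

text \<open>Where \<rho> |a| \<le> K, the rescaled remainder is at most C (\<rho> |a|)^2 / \<rho>
  \<le> C K^2 / \<rho>, which vanishes; tightness makes the complement improbable. The expansion is
  asked for almost surely, since the smoothed array has the right support only almost
  surely.\<close>

theorem (in prob_space) delta_method:
  fixes J :: "real ^ 'b ^ 'c"
  assumes Y: "conv_in_distr M (\<lambda>n \<omega>. \<rho> n *\<^sub>R a n \<omega>) \<mu>" and \<rho>: "filterlim \<rho> at_top sequentially"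
    and a: "\<And>n. a n \<in> borel_measurable M" and b: "\<And>n. b n \<in> borel_measurable M"
    and "0 < \<delta>" "0 \<le> C"
    and expand: "\<And>n. AE \<omega> in M. norm (a n \<omega>) < \<delta> \<longrightarrow> norm (b n \<omega> - J *v a n \<omega>) \<le> C * (norm (a n \<omega>))\<^sup>2"
  shows "conv_in_distr M (\<lambda>n \<omega>. \<rho> n *\<^sub>R b n \<omega>) (distr \<mu> borel ((*v) J))"
proof (rule conv_in_distr_slutsky)
  note [measurable] = a b
  have c: "continuous_on UNIV ((*v) J)" by (intro linear_continuous_on) (simp add: linear_linear)
  have mJ[measurable]: "(*v) J \<in> borel_measurable borel" using c by (rule borel_measurable_continuous_onI)
  show "conv_in_distr M (\<lambda>n \<omega>. J *v (\<rho> n *\<^sub>R a n \<omega>)) (distr \<mu> borel ((*v) J))"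
    using Y by (rule conv_in_distr_matrix)
  show "\<And>n. (\<lambda>\<omega>. \<rho> n *\<^sub>R b n \<omega>) \<in> borel_measurable M" by measurable
  fix \<epsilon> :: real assume \<epsilon>: "0 < \<epsilon>"
  show "(\<lambda>n. prob {\<omega> \<in> space M. norm (\<rho> n *\<^sub>R b n \<omega> - J *v (\<rho> n *\<^sub>R a n \<omega>)) > \<epsilon>}) \<longlonglongrightarrow> 0"
  proof (rule order_tendstoI)
    fix \<eta> :: real assume \<eta>: "0 < \<eta>"
    obtain K where K: "0 < K" "\<forall>\<^sub>F n in sequentially. prob {\<omega> \<in> space M. norm (\<rho> n *\<^sub>R a n \<omega>) > K} < \<eta>"
      using conv_in_distr_tight[OF Y \<eta>] .
    \<comment> \<open>The first bound brings \<open>a n\<close> into the range of the expansion, the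
      second makes the rescaled remainder at most \<epsilon>.\<close>
    have "\<forall>\<^sub>F n in sequentially. \<rho> n > max (K / \<delta>) (C * K\<^sup>2 / \<epsilon>)"
      using \<rho> unfolding filterlim_at_top_dense by blast
    then show "\<forall>\<^sub>F n in sequentially. prob {\<omega> \<in> space M. norm (\<rho> n *\<^sub>R b n \<omega> - J *v (\<rho> n *\<^sub>R a n \<omega>)) > \<epsilon>} < \<eta>"
      using K(2)
    proof eventually_elim
      case (elim n)
      have r0: "0 < \<rho> n" using elim K(1) \<open>0 < \<delta>\<close> by (meson divide_pos_pos max_less_iff_conj order_less_trans)
      have r1: "K < \<delta> * \<rho> n" using elim \<open>0 < \<delta>\<close> by (simp add: pos_divide_less_eq mult.commute)
      have r2: "C * K\<^sup>2 \<le> \<epsilon> * \<rho> n" using elim \<epsilon> by (simp add: pos_divide_less_eq mult.commute less_imp_le)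
      have "prob {\<omega> \<in> space M. norm (\<rho> n *\<^sub>R b n \<omega> - J *v (\<rho> n *\<^sub>R a n \<omega>)) > \<epsilon>}
          \<le> prob {\<omega> \<in> space M. norm (\<rho> n *\<^sub>R a n \<omega>) > K}"
      proof (rule finite_measure_mono_AE)
        show "AE \<omega> in M. \<omega> \<in> {\<omega> \<in> space M. norm (\<rho> n *\<^sub>R b n \<omega> - J *v (\<rho> n *\<^sub>R a n \<omega>)) > \<epsilon>} \<longrightarrow>
            \<omega> \<in> {\<omega> \<in> space M. norm (\<rho> n *\<^sub>R a n \<omega>) > K}"
          using expand[of n]
        proof eventually_elim
          case (elim \<omega>)
          have "norm (\<rho> n *\<^sub>R b n \<omega> - J *v (\<rho> n *\<^sub>R a n \<omega>)) \<le> \<epsilon>" if "norm (\<rho> n *\<^sub>R a n \<omega>) \<le> K"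
          proof -
            have k: "\<rho> n * norm (a n \<omega>) \<le> K" using that r0 by simp
            then have "\<rho> n * norm (a n \<omega>) < \<rho> n * \<delta>" using r1 by (simp add: mult.commute)
            then have "norm (a n \<omega>) < \<delta>" using r0 by simp
            with elim have e: "norm (b n \<omega> - J *v a n \<omega>) \<le> C * (norm (a n \<omega>))\<^sup>2" by simp
            have "\<rho> n *\<^sub>R b n \<omega> - J *v (\<rho> n *\<^sub>R a n \<omega>) = \<rho> n *\<^sub>R (b n \<omega> - J *v a n \<omega>)"
              by (simp add: scaleR_diff_right matrix_vector_mult_scaleR)
            then have "norm (\<rho> n *\<^sub>R b n \<omega> - J *v (\<rho> n *\<^sub>R a n \<omega>)) \<le> \<rho> n * (C * (norm (a n \<omega>))\<^sup>2)"
              using e r0 by simp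
            also have "\<dots> = C * (\<rho> n * norm (a n \<omega>))\<^sup>2 / \<rho> n" using r0 by (simp add: power2_eq_square)
            also have "\<dots> \<le> C * K\<^sup>2 / \<rho> n"
              using r0 k \<open>0 \<le> C\<close> by (intro divide_right_mono mult_left_mono power_mono) auto
            also have "\<dots> \<le> \<epsilon>" using r0 r2 by (simp add: pos_divide_le_eq)
            finally show ?thesis .
          qed
          then show ?case by force
        qed
      qed measurable
      then show ?case using elim by linarith
    qed
  qed (metis (no_types, lifting) always_eventually less_le_trans measure_nonneg)
qed

section \<open>Trigonometric polynomials and the Cramer-Wold device\<close>

inductive trig_poly :: "(real ^ 'm \<Rightarrow> real) \<Rightarrow> bool" where
  cos: "trig_poly (\<lambda>v. c * cos (t \<bullet> v))"
| sin: "trig_poly (\<lambda>v. c * sin (t \<bullet> v))"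
| add: "trig_poly f \<Longrightarrow> trig_poly g \<Longrightarrow> trig_poly (\<lambda>v. f v + g v)"

lemma trig_poly_const: "trig_poly (\<lambda>v. c)"
  using trig_poly.cos[of c 0] by simp

lemma trig_poly_cos_mult: "trig_poly f \<Longrightarrow> trig_poly (\<lambda>v. (c * cos (t \<bullet> v)) * f v)"
proof (induction rule: trig_poly.induct)
  case (cos c' t')
  have "(\<lambda>v. (c * cos (t \<bullet> v)) * (c' * cos (t' \<bullet> v)))
      = (\<lambda>v. (c * c' / 2) * cos ((t - t') \<bullet> v) + (c * c' / 2) * cos ((t + t') \<bullet> v))"
    by (simp add: inner_diff_left inner_add_left cos_diff cos_add algebra_simps)
  then show ?case by (simp only:) (intro trig_poly.intros)
next
  case (sin c' t')
  have "(\<lambda>v. (c * cos (t \<bullet> v)) * (c' * sin (t' \<bullet> v)))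
      = (\<lambda>v. (c * c' / 2) * sin ((t' + t) \<bullet> v) + (c * c' / 2) * sin ((t' - t) \<bullet> v))"
    by (simp add: inner_diff_left inner_add_left sin_diff sin_add algebra_simps)
  then show ?case by (simp only:) (intro trig_poly.intros)
next
  case (add f g)
  then show ?case by (simp only: distrib_left trig_poly.add)
qed

lemma trig_poly_sin_mult: "trig_poly f \<Longrightarrow> trig_poly (\<lambda>v. (c * sin (t \<bullet> v)) * f v)"
proof (induction rule: trig_poly.induct)
  case (cos c' t')
  have "(\<lambda>v. (c * sin (t \<bullet> v)) * (c' * cos (t' \<bullet> v)))
      = (\<lambda>v. (c * c' / 2) * sin ((t + t') \<bullet> v) + (c * c' / 2) * sin ((t - t') \<bullet> v))"
    by (simp add: inner_diff_left inner_add_left sin_diff sin_add algebra_simps)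
  then show ?case by (simp only:) (intro trig_poly.intros)
next
  case (sin c' t')
  have "(\<lambda>v. (c * sin (t \<bullet> v)) * (c' * sin (t' \<bullet> v)))
      = (\<lambda>v. (c * c' / 2) * cos ((t - t') \<bullet> v) + (- (c * c') / 2) * cos ((t + t') \<bullet> v))"
    by (simp add: inner_diff_left inner_add_left cos_diff cos_add algebra_simps)
  then show ?case by (simp only:) (intro trig_poly.intros)
next
  case (add f g)
  then show ?case by (simp only: distrib_left trig_poly.add)
qed

text \<open>By the product-to-sum formulas. Because products are derived and not generators, an
  induction over trigonometric polynomials meets only functions of one projection and sums, which is
  what limits of expectations can handle.\<close>

lemma trig_poly_mult: "trig_poly f \<Longrightarrow> trig_poly g \<Longrightarrow> trig_poly (\<lambda>v. f v * g v)"
proof (induction rule: trig_poly.induct)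
  case (add f f')
  then show ?case by (simp only: distrib_right trig_poly.add)
qed (rule trig_poly_cos_mult trig_poly_sin_mult; assumption)+

lemma trig_poly_sum: "(\<And>k. k \<in> K \<Longrightarrow> trig_poly (f k)) \<Longrightarrow> trig_poly (\<lambda>v. \<Sum>k \<in> K. f k v)"
proof (induction K rule: infinite_finite_induct)
  case (insert k K)
  then show ?case using trig_poly.add[of "f k" "\<lambda>v. \<Sum>k \<in> K. f k v"] by simp
qed (simp_all add: trig_poly_const)

text \<open>Each new coordinate sin (v_j / L) is itself a sine of a projection, along a scaled axis;
  closure under sums and products does the rest.\<close>

lemma trig_poly_polynomial_sin:
  fixes q :: "real ^ 'm \<Rightarrow> real"
  assumes "real_polynomial_function q"
  shows "trig_poly (\<lambda>v. q (\<chi> j. sin (v $ j / L)))"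
  using assms
proof (induction rule: real_polynomial_function.induct)
  case (linear f)
  interpret f: bounded_linear f by (rule linear)
  have *: "f (\<chi> j. sin (v $ j / L)) = (\<Sum>j \<in> UNIV. f (axis j 1) * sin (axis j (1 / L) \<bullet> v))" for v
    by (subst basis_expansion[symmetric])
      (simp add: f.sum f.scaleR scalar_mult_eq_scaleR inner_axis' mult.commute)
  have "trig_poly (\<lambda>v :: real ^ 'm. \<Sum>j \<in> UNIV. f (axis j 1) * sin (axis j (1 / L) \<bullet> v))"
    by (intro trig_poly_sum trig_poly.intros)
  then show ?case by (simp only: *)
qed (auto intro: trig_poly_const trig_poly.add trig_poly_mult)

lemma trig_poly_bounded: "trig_poly f \<Longrightarrow> \<exists>B. \<forall>v. \<bar>f v\<bar> \<le> B"
proof (induction rule: trig_poly.induct)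
  case (cos c t)
  have "\<bar>c * cos (t \<bullet> v)\<bar> \<le> \<bar>c\<bar>" for v
    by (simp add: abs_mult mult_left_le)
  then show ?case by blast
next
  case (sin c t)
  have "\<bar>c * sin (t \<bullet> v)\<bar> \<le> \<bar>c\<bar>" for v
    by (simp add: abs_mult mult_left_le)
  then show ?case by blast
next
  case (add f g)
  then obtain B B' where "\<And>v. \<bar>f v\<bar> \<le> B" "\<And>v. \<bar>g v\<bar> \<le> B'" by blast
  then have "\<bar>f v + g v\<bar> \<le> B + B'" for v by (meson abs_triangle_ineq add_mono order_trans)
  then show ?case by blast
qed

lemma trig_poly_continuous: "trig_poly f \<Longrightarrow> continuous_on A f"
  by (induction rule: trig_poly.induct) (auto intro!: continuous_intros)

text \<open>The generators are bounded continuous functions of a projection, and boundedness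
  supplies the integrability needed to split a sum.\<close>

lemma (in prob_space) trig_poly_expectation_limit:
  fixes Y :: "nat \<Rightarrow> 'a \<Rightarrow> real ^ 'm"
  assumes Y[measurable]: "\<And>n. Y n \<in> borel_measurable M"
    and mu: "prob_space \<mu>" and sets[measurable_cong]: "sets \<mu> = sets borel"
    and proj: "\<And>t f. continuous_on UNIV f \<Longrightarrow> bounded (range f) \<Longrightarrow>
      (\<lambda>n. \<integral>\<omega>. f (t \<bullet> Y n \<omega>) \<partial>M) \<longlonglongrightarrow> (\<integral>v. f (t \<bullet> v) \<partial>\<mu> :: real)"
    and "trig_poly g"
  shows "(\<lambda>n. \<integral>\<omega>. g (Y n \<omega>) \<partial>M) \<longlonglongrightarrow> (\<integral>v. g v \<partial>\<mu>)"
  using \<open>trig_poly g\<close>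
proof (induction rule: trig_poly.induct)
  case (cos c t)
  have "bounded (range (\<lambda>x :: real. c * cos x))"
    by (rule boundedI[of _ "\<bar>c\<bar>"]) (auto simp: abs_mult mult_left_le)
  then show ?case by (intro proj[of "\<lambda>x. c * cos x"] continuous_intros)
next
  case (sin c t)
  have "bounded (range (\<lambda>x :: real. c * sin x))"
    by (rule boundedI[of _ "\<bar>c\<bar>"]) (auto simp: abs_mult mult_left_le)
  then show ?case by (intro proj[of "\<lambda>x. c * sin x"] continuous_intros)
next
  case (add f g)
  interpret mu: prob_space \<mu> by (rule mu)
  have m[measurable]: "f \<in> borel_measurable borel" "g \<in> borel_measurable borel"
    using add by (auto intro!: borel_measurable_continuous_onI trig_poly_continuous)
  obtain B B' where "\<And>v. \<bar>f v\<bar> \<le> B" "\<And>v. \<bar>g v\<bar> \<le> B'"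
    using trig_poly_bounded add by meson
  then have "integrable M (\<lambda>\<omega>. f (Y n \<omega>))" "integrable M (\<lambda>\<omega>. g (Y n \<omega>))" "integrable \<mu> f" "integrable \<mu> g" for n
    by (simp_all add: integrable_const_bound[of _ B] integrable_const_bound[of _ B']
        mu.integrable_const_bound[of _ B] mu.integrable_const_bound[of _ B'])
  then show ?case using tendsto_add[OF add.IH] by simp
qed

text \<open>
  On the cube \<open>\<bar>v\<^sub>j\<bar> \<le> L\<close> a test function \<open>f\<close> is a continuous function of the coordinates
  \<open>sin (v\<^sub>j / L)\<close>.  Polynomial approximation in these coordinates is uniform in \<open>v\<close>, so that the
  approximating trigonometric polynomial stays bounded off the cube.
\<close>

lemma trig_poly_approximation:
  fixes f :: "real ^ 'm \<Rightarrow> real"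
  assumes f: "continuous_on UNIV f" and B: "\<And>v. \<bar>f v\<bar> \<le> B" and "0 < L" "0 < \<epsilon>"
  obtains g where "trig_poly g" "\<And>v. \<bar>g v\<bar> \<le> B + \<epsilon>" "\<And>v. (\<And>j. \<bar>v $ j\<bar> \<le> L) \<Longrightarrow> \<bar>f v - g v\<bar> \<le> \<epsilon>"
proof -
  define F where "F w = f (\<chi> j. L * arcsin (w $ j))" for w :: "real ^ 'm"
  define Q where "Q = (cbox (- 1) 1 :: (real ^ 'm) set)"
  have Q: "w \<in> Q \<longleftrightarrow> (\<forall>j. - 1 \<le> w $ j \<and> w $ j \<le> 1)" for w
    by (simp add: Q_def mem_box_cart)
  have "continuous_on Q (\<lambda>w. \<chi> j. L * arcsin (w $ j))"
    by (intro continuous_on_vec_lambda continuous_intros) (auto simp: Q)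
  then have "continuous_on Q F"
    unfolding F_def using f by (auto intro: continuous_on_compose2)
  then obtain q where q: "real_polynomial_function q" "\<And>w. w \<in> Q \<Longrightarrow> \<bar>F w - q w\<bar> < \<epsilon>"
    using Stone_Weierstrass_real_polynomial_function[of Q F \<epsilon>] \<open>0 < \<epsilon>\<close> by (auto simp: Q_def)
  define s where "s v = (\<chi> j. sin (v $ j / L))" for v :: "real ^ 'm"
  have sQ: "s v \<in> Q" for v by (simp add: Q s_def)
  show thesis
  proof (rule that)
    show "trig_poly (\<lambda>v. q (s v))" unfolding s_def by (rule trig_poly_polynomial_sin[OF q(1)])
    show "\<bar>q (s v)\<bar> \<le> B + \<epsilon>" for v
      using q(2)[OF sQ, of v] B[of "\<chi> j. L * arcsin (s v $ j)"] by (simp add: F_def)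
    show "\<bar>f v - q (s v)\<bar> \<le> \<epsilon>" if v: "\<And>j. \<bar>v $ j\<bar> \<le> L" for v
    proof -
      have "L * arcsin (s v $ j) = v $ j" for j
      proof -
        have "\<bar>v $ j / L\<bar> \<le> 1" using v[of j] \<open>0 < L\<close> by simp
        \<comment> \<open>On the cube the argument v_j / L stays in [-1, 1], inside the interval on
          which arcsin inverts sin.\<close>
        moreover have "1 \<le> pi / 2" using pi_ge_two by simp
        ultimately have "arcsin (sin (v $ j / L)) = v $ j / L"
          by (intro arcsin_sin) linarith+
        then show ?thesis using \<open>0 < L\<close> by (simp add: s_def)
      qed
      then have "F (s v) = f v" by (simp add: F_def)
      then show ?thesis using q(2)[OF sQ, of v] by simp
    qed
  qed
qed

text \<open>Both integrals of \<open>f\<close>, for the sequence and for the limit, are compared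
  with those of one trigonometric polynomial; off a cube, tightness and its global bound control the
  error.\<close>

theorem (in prob_space) cramer_wold:
  fixes Y :: "nat \<Rightarrow> 'a \<Rightarrow> real ^ 'm"
  assumes Y[measurable]: "\<And>n. Y n \<in> borel_measurable M"
    and mu: "prob_space \<mu>" and sets[measurable_cong]: "sets \<mu> = sets borel"
    and proj: "\<And>t f. continuous_on UNIV f \<Longrightarrow> bounded (range f) \<Longrightarrow>
      (\<lambda>n. \<integral>\<omega>. f (t \<bullet> Y n \<omega>) \<partial>M) \<longlonglongrightarrow> (\<integral>v. f (t \<bullet> v) \<partial>\<mu> :: real)"
  shows "conv_in_distr M Y \<mu>"
  unfolding conv_in_distr_def
proof (intro conjI allI impI mu sets Y)
  interpret mu: prob_space \<mu> by (rule mu)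
  have sp: "space \<mu> = UNIV" using sets_eq_imp_space_eq[OF sets] by simp
  fix f :: "real ^ 'm \<Rightarrow> real"
  assume f: "continuous_on UNIV f \<and> bounded (range f)"
  have [measurable]: "f \<in> borel_measurable borel" using f by (intro borel_measurable_continuous_onI) simp
  obtain B where B: "0 < B" "\<And>x. \<bar>f x\<bar> \<le> B" using f bounded_range_real by blast
  \<comment> \<open>Coordinates are projections along the axes, so tightness too follows from the
    one-dimensional hypothesis.\<close>
  have tight: "\<exists>K > 0. (\<forall>\<^sub>F n in sequentially. prob {\<omega> \<in> space M. \<bar>Y n \<omega> $ j\<bar> > K} < \<epsilon>) \<and>
      measure \<mu> {v. \<bar>v $ j\<bar> > K} < \<epsilon>" if "0 < \<epsilon>" for \<epsilon> j
  proof -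
    let ?\<mu> = "distr \<mu> borel (\<lambda>v. axis j 1 \<bullet> v)"
    obtain K :: real where K: "0 < K" "\<forall>\<^sub>F n in sequentially. prob {\<omega> \<in> space M. norm (axis j 1 \<bullet> Y n \<omega>) > K} < \<epsilon>"
      "measure ?\<mu> {x. norm x > K} < \<epsilon>"
    proof (rule tight_of_ramp_limits[of "\<lambda>n \<omega>. axis j 1 \<bullet> Y n \<omega>" ?\<mu> \<epsilon>])
      fix K :: real
      have "continuous_on UNIV (\<lambda>x :: real. max 0 (min 1 (norm x - K)))" by (intro continuous_intros)
      moreover have "bounded (range (\<lambda>x :: real. max 0 (min 1 (norm x - K))))"
        by (rule boundedI[of _ 1]) auto
      ultimately have "(\<lambda>n. \<integral>\<omega>. max 0 (min 1 (norm (axis j 1 \<bullet> Y n \<omega>) - K)) \<partial>M)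
          \<longlonglongrightarrow> (\<integral>v. max 0 (min 1 (norm (axis j 1 \<bullet> v) - K)) \<partial>\<mu>)"
        by (rule proj)
      then show "(\<lambda>n. \<integral>\<omega>. max 0 (min 1 (norm (axis j 1 \<bullet> Y n \<omega>) - K)) \<partial>M)
          \<longlonglongrightarrow> (\<integral>x. max 0 (min 1 (norm x - K)) \<partial>?\<mu>)"
        by (simp add: integral_distr)
    qed (simp_all add: that mu.prob_space_distr \<open>0 < \<epsilon>\<close>)
    have "measure ?\<mu> {x. norm x > K} = measure \<mu> {v. \<bar>v $ j\<bar> > K}"
      by (subst measure_distr) (auto simp: sp inner_axis' vimage_def)
    then show ?thesis using K by (auto simp: inner_axis')
  qed
  show "(\<lambda>n. \<integral>\<omega>. f (Y n \<omega>) \<partial>M) \<longlonglongrightarrow> (\<integral>v. f v \<partial>\<mu>)"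
  proof (rule tendstoI)
    fix \<epsilon> :: real assume \<epsilon>: "0 < \<epsilon>"
    \<comment> \<open>\<open>e \<le> 1\<close> bounds the approximant by \<open>B + 1\<close>. With
      \<eta> as below, the union over the coordinates costs 2 (B + 1) CARD('m) \<eta> = \<epsilon> /
      6, and together with \<open>e \<le> \<epsilon> / 6\<close> each comparison stays within
      \<epsilon> / 3.\<close>
    define e where "e = min 1 (\<epsilon> / 6)"
    have e: "0 < e" "e \<le> 1" "e \<le> \<epsilon> / 6" using \<epsilon> by (auto simp: e_def)
    define \<eta> where "\<eta> = \<epsilon> / (12 * (B + 1) * real CARD('m))"
    have \<eta>: "0 < \<eta>" using \<epsilon> B by (simp add: \<eta>_def)
    have "\<exists>K. \<forall>j. 0 < K j \<and> (\<forall>\<^sub>F n in sequentially. prob {\<omega> \<in> space M. \<bar>Y n \<omega> $ j\<bar> > K j} < \<eta>) \<and>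
        measure \<mu> {v. \<bar>v $ j\<bar> > K j} < \<eta>"
      by (rule choice) (use tight[OF \<eta>] in blast)
    then obtain K where K: "\<And>j. 0 < K j" "\<And>j. \<forall>\<^sub>F n in sequentially. prob {\<omega> \<in> space M. \<bar>Y n \<omega> $ j\<bar> > K j} < \<eta>"
      "\<And>j. measure \<mu> {v. \<bar>v $ j\<bar> > K j} < \<eta>"
      by blast
    define L where "L = (\<Sum>j \<in> UNIV. K j)"
    have KL: "K j \<le> L" for j unfolding L_def using K(1) by (intro member_le_sum) (auto intro: less_imp_le)
    have L: "0 < L" using K(1) KL by (meson less_le_trans)
    obtain g where g: "trig_poly g" "\<And>v. \<bar>g v\<bar> \<le> B + e" "\<And>v. (\<And>j. \<bar>v $ j\<bar> \<le> L) \<Longrightarrow> \<bar>f v - g v\<bar> \<le> e"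
      using trig_poly_approximation[of f B L e] f B L e by blast
    have [measurable]: "g \<in> borel_measurable borel"
      using trig_poly_continuous[OF g(1)] by (rule borel_measurable_continuous_onI)
    have bound: "e + 2 * (B + 1) * (real CARD('m) * \<eta>) \<le> \<epsilon> / 3"
    proof -
      have *: "b * (c * (\<epsilon> / (12 * b * c))) = \<epsilon> / 12" if "b \<noteq> 0" "c \<noteq> 0" for b c :: real
        using that by simp
      have "(B + 1) * (real CARD('m) * \<eta>) = \<epsilon> / 12" unfolding \<eta>_def by (rule *) (use B in auto)
      then show ?thesis using e unfolding mult.assoc by linarith
    qed
    have "\<bar>(\<integral>v. f v \<partial>\<mu>) - (\<integral>v. g v \<partial>\<mu>)\<bar> \<le> e + 2 * (B + 1) * measure \<mu> (\<Union>j. {v. \<bar>v $ j\<bar> > K j})"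
    proof (rule mu.abs_expectation_diff_le)
      fix v assume "v \<notin> (\<Union>j. {v. \<bar>v $ j\<bar> > K j})"
      then have "\<bar>v $ j\<bar> \<le> L" for j using KL[of j] by (auto simp: not_less intro: order_trans)
      then show "\<bar>f v - g v\<bar> \<le> e" by (rule g(3))
    next
      show "\<bar>f v\<bar> \<le> B + 1" "\<bar>g v\<bar> \<le> B + 1" for v using B(2)[of v] g(2)[of v] e by auto
    qed (use e in auto)
    also have "measure \<mu> (\<Union>j. {v. \<bar>v $ j\<bar> > K j}) \<le> (\<Sum>j \<in> UNIV. measure \<mu> {v. \<bar>v $ j\<bar> > K j})"
      by (rule measure_UNION_le) auto
    also have "\<dots> \<le> (\<Sum>j \<in> (UNIV :: 'm set). \<eta>)" by (intro sum_mono less_imp_le K)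
    finally have mu_le: "\<bar>(\<integral>v. f v \<partial>\<mu>) - (\<integral>v. g v \<partial>\<mu>)\<bar> \<le> \<epsilon> / 3" using bound B by simp
    have "(\<lambda>n. \<integral>\<omega>. g (Y n \<omega>) \<partial>M) \<longlonglongrightarrow> (\<integral>v. g v \<partial>\<mu>)"
      by (rule trig_poly_expectation_limit[OF Y mu sets proj g(1)])
    then have "\<forall>\<^sub>F n in sequentially. dist (\<integral>\<omega>. g (Y n \<omega>) \<partial>M) (\<integral>v. g v \<partial>\<mu>) < \<epsilon> / 3"
      using \<epsilon> by (intro tendstoD) auto
    moreover have "\<forall>\<^sub>F n in sequentially. \<forall>j. prob {\<omega> \<in> space M. \<bar>Y n \<omega> $ j\<bar> > K j} < \<eta>"
      using K(2) by (rule eventually_all_finite)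
    ultimately show "\<forall>\<^sub>F n in sequentially. dist (\<integral>\<omega>. f (Y n \<omega>) \<partial>M) (\<integral>v. f v \<partial>\<mu>) < \<epsilon>"
    proof eventually_elim
      case (elim n)
      let ?E = "\<lambda>j. {\<omega> \<in> space M. \<bar>Y n \<omega> $ j\<bar> > K j}"
      have "\<bar>(\<integral>\<omega>. f (Y n \<omega>) \<partial>M) - (\<integral>\<omega>. g (Y n \<omega>) \<partial>M)\<bar> \<le> e + 2 * (B + 1) * prob (\<Union>j. ?E j)"
      proof (rule abs_expectation_diff_le)
        fix \<omega> assume "\<omega> \<in> space M" "\<omega> \<notin> (\<Union>j. ?E j)"
        then have "\<bar>Y n \<omega> $ j\<bar> \<le> L" for j using KL[of j] by (auto simp: not_less intro: order_trans)
        then show "\<bar>f (Y n \<omega>) - g (Y n \<omega>)\<bar> \<le> e" by (rule g(3))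
      next
        show "\<bar>f (Y n \<omega>)\<bar> \<le> B + 1" "\<bar>g (Y n \<omega>)\<bar> \<le> B + 1" for \<omega>
          using B(2)[of "Y n \<omega>"] g(2)[of "Y n \<omega>"] e by auto
      qed (use e in auto)
      also have "prob (\<Union>j. ?E j) \<le> (\<Sum>j \<in> UNIV. prob (?E j))"
        by (rule measure_UNION_le) auto
      also have "\<dots> \<le> (\<Sum>j \<in> (UNIV :: 'm set). \<eta>)" using elim by (intro sum_mono less_imp_le) auto
      finally have "\<bar>(\<integral>\<omega>. f (Y n \<omega>) \<partial>M) - (\<integral>\<omega>. g (Y n \<omega>) \<partial>M)\<bar> \<le> \<epsilon> / 3" using bound B by simp
      then show ?case using elim mu_le unfolding dist_real_def by linarith
    qed
  qed
qed

subsection \<open>The multivariate central limit theorem\<close>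

text \<open>An affine image of the standard normal law describes the point mass and the density
  alike, so later arguments need not separate variance 0.\<close>

lemma normal_law_eq_distr:
  assumes "0 \<le> v"
  shows "normal_law m v = distr std_normal_distribution borel (\<lambda>x. m + sqrt v * x)"
proof -
  interpret N: real_distribution std_normal_distribution by (rule real_dist_normal_dist)
  show ?thesis
  proof (cases "v = 0")
    case True
    then show ?thesis by (simp add: normal_law_def N.distr_const)
  next
    case False
    have "distr std_normal_distribution lborel (\<lambda>x. x) = density lborel std_normal_density"
      by (rule distr_id2) simp
    then have "distributed std_normal_distribution lborel (\<lambda>x. x) std_normal_density"
      by (simp add: distributed_def)
    from N.normal_density_affine[OF this, of "sqrt v" m]
    have "distributed std_normal_distribution lborel (\<lambda>x. m + sqrt v * x) (normal_density m (sqrt v))"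
      using assms False by simp
    then have "distr std_normal_distribution lborel (\<lambda>x. m + sqrt v * x) = density lborel (normal_density m (sqrt v))"
      by (simp add: distributed_def)
    then show ?thesis
      using False by (simp add: normal_law_def cong: distr_cong)
  qed
qed

lemma char_normal_law_zero_mean:
  assumes "0 \<le> v"
  shows "char (normal_law 0 v) s = exp (- (v * s\<^sup>2) / 2)"
proof -
  have "char (normal_law 0 v) s = char std_normal_distribution (s * sqrt v)"
    using assms by (simp add: normal_law_eq_distr char_def integral_distr mult.assoc)
  then show ?thesis
    using assms by (simp add: char_std_normal_distribution power_mult_distrib mult.commute)
qed

lemma real_distribution_normal_law: "0 \<le> v \<Longrightarrow> real_distribution (normal_law m v)"
proof -
  assume v: "0 \<le> v"
  interpret N: real_distribution std_normal_distribution by (rule real_dist_normal_dist)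
  show ?thesis unfolding normal_law_eq_distr[OF v] by (rule N.real_distribution_distr) simp
qed

text \<open>Independence means that the joint law is the product law, and the joint law of the
  coordinates is that of the identity map.\<close>

lemma indep_vars_PiM_components:
  fixes M :: "'i::finite \<Rightarrow> 'a measure"
  assumes "\<And>i. prob_space (M i)"
  shows "prob_space.indep_vars (PiM UNIV M) M (\<lambda>i \<omega>. \<omega> i) UNIV"
proof -
  interpret product_prob_space M UNIV
    by (rule product_prob_spaceI) (rule assms)
  have "(\<lambda>\<omega>. \<lambda>i\<in>UNIV. \<omega> i) = (\<lambda>\<omega> :: 'i \<Rightarrow> 'a. \<omega>)" by (simp add: fun_eq_iff)
  then have "distr (PiM UNIV M) (PiM UNIV M) (\<lambda>\<omega>. \<lambda>i\<in>UNIV. \<omega> i) = PiM UNIV M"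
    by (simp add: distr_id2)
  moreover have "distr (PiM UNIV M) (M i) (\<lambda>\<omega>. \<omega> i) = M i" for i
    by (rule distr_PiM_component) (auto intro: assms)
  ultimately show ?thesis
    by (subst indep_vars_iff_distr_eq_PiM') (auto intro: measurable_component_singleton)
qed

lemma borel_measurable_vec_lambda:
  fixes f :: "'a \<Rightarrow> 'n::finite \<Rightarrow> real"
  assumes "\<And>i. (\<lambda>x. f x i) \<in> borel_measurable M"
  shows "(\<lambda>x. \<chi> i. f x i) \<in> borel_measurable M"
  unfolding borel_measurable_euclidean_space[of "\<lambda>x. \<chi> i. f x i"]
  using assms by (auto simp: Basis_vec_def inner_axis)

lemma borel_measurable_matrix_vector: "(*v) B \<in> borel_measurable borel"
  for B :: "real ^ 'a ^ 'b"
  by (intro borel_measurable_continuous_onI linear_continuous_on) (simp add: linear_linear)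

text \<open>The law of \<open>B\<close> applied to independent standard normal coordinates. Along
  \<open>t\<close>, independence multiplies characteristic functions, the exponents add up to the
  squared norm of \<open>t v* B\<close>, and Levy uniqueness identifies the law.\<close>

theorem ex_mv_normal:
  fixes B :: "real ^ 'n ^ 'm"
  shows "\<exists>\<mu>. mv_normal \<mu> 0 (B ** transpose B)"
proof -
  let ?N = "PiM UNIV (\<lambda>_ :: 'n. std_normal_distribution)"
  interpret N: real_distribution std_normal_distribution by (rule real_dist_normal_dist)
  interpret product_prob_space "\<lambda>_ :: 'n. std_normal_distribution" UNIV
    by (rule product_prob_spaceI) (rule N.prob_space_axioms)
  define X where "X = (\<lambda>\<xi> :: 'n \<Rightarrow> real. \<chi> j. \<xi> j)"
  have comp: "(\<lambda>\<xi>. \<xi> j) \<in> borel_measurable ?N" for j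
    using measurable_component_singleton[of j UNIV "\<lambda>_. std_normal_distribution"] by (simp cong: measurable_cong_sets)
  have X: "X \<in> borel_measurable ?N"
    unfolding X_def by (rule borel_measurable_vec_lambda[OF comp])
  define \<mu> where "\<mu> = distr ?N borel (\<lambda>\<xi>. B *v X \<xi>)"
  note [measurable] = borel_measurable_matrix_vector X comp
  have quad: "t \<bullet> ((B ** transpose B) *v t) = (\<Sum>j \<in> UNIV. ((t v* B) $ j)\<^sup>2)" for t
    by (simp add: matrix_vector_mul_assoc[symmetric] dot_lmul_matrix[symmetric])
      (simp add: inner_vec_def power2_eq_square)
  have indep: "P.indep_vars (\<lambda>_. borel) (\<lambda>j \<xi>. \<xi> j) UNIV"
    using indep_vars_PiM_components[of "\<lambda>_ :: 'n. std_normal_distribution"] N.prob_space_axioms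
    unfolding P.indep_vars_def by simp
  have "distr \<mu> borel (\<lambda>v. t \<bullet> v) = normal_law 0 (t \<bullet> ((B ** transpose B) *v t))" for t
  proof (rule Levy_uniqueness)
    define c where "c = t v* B"
    have "distr \<mu> borel (\<lambda>v. t \<bullet> v) = distr ?N borel (\<lambda>\<xi>. \<Sum>j \<in> UNIV. c $ j * \<xi> j)"
      unfolding \<mu>_def
      by (subst distr_distr) (simp_all add: comp_def dot_lmul_matrix[symmetric] c_def[symmetric], simp add: X_def inner_vec_def)
    moreover have "char (distr ?N borel (\<lambda>\<xi>. \<Sum>j \<in> UNIV. c $ j * \<xi> j)) s
        = char (normal_law 0 (t \<bullet> ((B ** transpose B) *v t))) s" for s
    proof -
      have "P.indep_vars (\<lambda>_. borel) (\<lambda>j \<xi>. c $ j * \<xi> j) UNIV"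
        by (rule P.indep_vars_compose2[OF indep, of "\<lambda>j x. c $ j * x"]) simp
      then have "char (distr ?N borel (\<lambda>\<xi>. \<Sum>j \<in> UNIV. c $ j * \<xi> j)) s
          = (\<Prod>j \<in> UNIV. char (distr ?N borel (\<lambda>\<xi>. c $ j * \<xi> j)) s)"
        by (rule P.char_distr_sum)
      also have "\<dots> = (\<Prod>j \<in> UNIV. complex_of_real (exp (- ((c $ j)\<^sup>2 * s\<^sup>2) / 2)))"
      proof (rule prod.cong)
        fix j
        have "distr ?N std_normal_distribution (\<lambda>\<xi>. \<xi> j) = std_normal_distribution"
          by (rule distr_PiM_component) (auto intro: N.prob_space_axioms)
        then have "distr ?N borel (\<lambda>\<xi>. \<xi> j) = std_normal_distribution"
          by (simp cong: distr_cong)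
        then have "char std_normal_distribution (s * c $ j) = char (distr ?N borel (\<lambda>\<xi>. \<xi> j)) (s * c $ j)" by simp
        then have "char (distr ?N borel (\<lambda>\<xi>. c $ j * \<xi> j)) s = char std_normal_distribution (s * c $ j)"
          by (simp add: char_def integral_distr mult.assoc)
        then show "char (distr ?N borel (\<lambda>\<xi>. c $ j * \<xi> j)) s = complex_of_real (exp (- ((c $ j)\<^sup>2 * s\<^sup>2) / 2))"
          by (simp add: char_std_normal_distribution power_mult_distrib mult.commute)
      qed simp
      also have "\<dots> = exp (\<Sum>j \<in> UNIV. - ((c $ j)\<^sup>2 * s\<^sup>2) / 2)"
        by (simp add: exp_sum)
      also have "(\<Sum>j \<in> UNIV. - ((c $ j)\<^sup>2 * s\<^sup>2) / 2) = - ((\<Sum>j \<in> UNIV. (c $ j)\<^sup>2) * s\<^sup>2) / 2"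
        by (simp add: sum_distrib_right sum_divide_distrib sum_negf)
      also have "complex_of_real (exp \<dots>) = char (normal_law 0 (t \<bullet> ((B ** transpose B) *v t))) s"
        by (subst char_normal_law_zero_mean) (simp_all add: quad c_def sum_nonneg)
      finally show ?thesis .
    qed
    ultimately show "char (distr \<mu> borel (\<lambda>v. t \<bullet> v)) = char (normal_law 0 (t \<bullet> ((B ** transpose B) *v t)))"
      by (simp add: fun_eq_iff)
    show "real_distribution (distr \<mu> borel (\<lambda>v. t \<bullet> v))"
      unfolding \<mu>_def by (intro prob_space.real_distribution_distr P.prob_space_distr) auto
    show "real_distribution (normal_law 0 (t \<bullet> ((B ** transpose B) *v t)))"
      by (rule real_distribution_normal_law) (simp add: quad sum_nonneg)
  qed
  moreover have "prob_space \<mu>" unfolding \<mu>_def by (rule P.prob_space_distr) simp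
  ultimately have "mv_normal \<mu> 0 (B ** transpose B)"
    unfolding mv_normal_def
    by (simp add: \<mu>_def quad sum_nonneg matrix_transpose_mul)
  then show ?thesis by blast
qed

text \<open>Testing the image against \<open>t\<close> tests \<mu> against
  \<open>transpose J *v t\<close>. Since the defining property sees a covariance only through its
  quadratic form, symmetry and \<open>quad\<close> suffice to identify \<open>W\<close>.\<close>

lemma mv_normal_linear_image:
  fixes J :: "real ^ 'a ^ 'b"
  assumes \<mu>: "mv_normal \<mu> 0 V" and sym: "transpose W = W"
    and quad: "\<And>t. t \<bullet> (W *v t) = (transpose J *v t) \<bullet> (V *v (transpose J *v t))"
  shows "mv_normal (distr \<mu> borel ((*v) J)) 0 W"
proof -
  note [measurable] = borel_measurable_matrix_vector
  have sets[measurable_cong]: "sets \<mu> = sets borel" using \<mu> by (simp add: mv_normal_def)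
  have "distr (distr \<mu> borel ((*v) J)) borel (\<lambda>v. t \<bullet> v) = normal_law 0 (t \<bullet> (W *v t))" for t
  proof -
    have "distr (distr \<mu> borel ((*v) J)) borel (\<lambda>v. t \<bullet> v) = distr \<mu> borel (\<lambda>v. (transpose J *v t) \<bullet> v)"
      by (subst distr_distr) (simp_all add: comp_def dot_lmul_matrix[symmetric])
    also have "\<dots> = normal_law 0 (t \<bullet> (W *v t))"
      unfolding quad using \<mu> by (simp add: mv_normal_def del: transpose_matrix_vector)
    finally show ?thesis .
  qed
  moreover have "0 \<le> t \<bullet> (W *v t)" for t
    unfolding quad using \<mu> by (simp add: mv_normal_def del: transpose_matrix_vector)
  moreover have "prob_space (distr \<mu> borel ((*v) J))"
    using \<mu> by (intro prob_space.prob_space_distr) (auto simp: mv_normal_def)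
  ultimately show ?thesis using sym by (simp add: mv_normal_def)
qed

text \<open>Cramer-Wold reduces this to real variables. Directions of variance 0 are treated apart,
  as the limit theorem on the line divides by the standard deviation; they do occur, because the
  multinomial covariance annihilates the constant vector.\<close>

theorem (in prob_space) multivariate_central_limit_theorem:
  fixes \<xi> :: "nat \<Rightarrow> 'a \<Rightarrow> real ^ 'm"
  assumes indep: "indep_vars (\<lambda>_. borel) \<xi> UNIV"
    and distr: "\<And>n. distr M borel (\<xi> n) = \<nu>"
    and int: "\<And>n t. integrable M (\<lambda>\<omega>. (t \<bullet> \<xi> n \<omega>)\<^sup>2)"
    and mean: "\<And>n t. expectation (\<lambda>\<omega>. t \<bullet> \<xi> n \<omega>) = 0"
    and var: "\<And>n t. expectation (\<lambda>\<omega>. (t \<bullet> \<xi> n \<omega>)\<^sup>2) = t \<bullet> (V *v t)"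
    and \<mu>: "mv_normal \<mu> 0 V"
  shows "conv_in_distr M (\<lambda>n \<omega>. (1 / sqrt (real n)) *\<^sub>R (\<Sum>i<n. \<xi> i \<omega>)) \<mu>"
proof (rule cramer_wold)
  have [measurable]: "\<And>n. \<xi> n \<in> borel_measurable M"
    using indep unfolding indep_vars_def by auto
  show "(\<lambda>\<omega>. (1 / sqrt (real n)) *\<^sub>R (\<Sum>i<n. \<xi> i \<omega>)) \<in> borel_measurable M" for n
    by measurable
  show "prob_space \<mu>" and sets[measurable_cong]: "sets \<mu> = sets borel"
    using \<mu> by (auto simp: mv_normal_def)
  fix t :: "real ^ 'm" and f :: "real \<Rightarrow> real"
  assume f: "continuous_on UNIV f" "bounded (range f)"
  have [measurable]: "f \<in> borel_measurable borel" using f by (intro borel_measurable_continuous_onI)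
  obtain B where B: "\<And>x. \<bar>f x\<bar> \<le> B" using f bounded_range_real by blast
  define v where "v = t \<bullet> (V *v t)"
  have v: "0 \<le> v" using \<mu> by (simp add: v_def mv_normal_def)
  have law: "distr \<mu> borel (\<lambda>w. t \<bullet> w) = normal_law 0 v"
    using \<mu> by (simp add: v_def mv_normal_def)
  have "(\<integral>w. f (t \<bullet> w) \<partial>\<mu>) = (\<integral>x. f x \<partial>distr \<mu> borel (\<lambda>w. t \<bullet> w))"
    by (simp add: integral_distr)
  also have "\<dots> = (\<integral>x. f (sqrt v * x) \<partial>std_normal_distribution)"
    unfolding law normal_law_eq_distr[OF v] by (simp add: integral_distr)
  finally have lim: "(\<integral>w. f (t \<bullet> w) \<partial>\<mu>) = (\<integral>x. f (sqrt v * x) \<partial>std_normal_distribution)" .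
  show "(\<lambda>n. \<integral>\<omega>. f (t \<bullet> ((1 / sqrt (real n)) *\<^sub>R (\<Sum>i<n. \<xi> i \<omega>))) \<partial>M) \<longlonglongrightarrow> (\<integral>w. f (t \<bullet> w) \<partial>\<mu>)"
  proof (cases "v = 0")
    case True
    \<comment> \<open>A centred variable with variance 0 vanishes almost surely, for all indices at
      once by countability.\<close>
    have "AE \<omega> in M. t \<bullet> \<xi> n \<omega> = 0" for n
      using integral_nonneg_eq_0_iff_AE[OF int[of t n]] var[of t n] True by (simp add: v_def)
    then have "AE \<omega> in M. \<forall>n. t \<bullet> \<xi> n \<omega> = 0" by (simp add: AE_all_countable)
    then have "(\<integral>\<omega>. f (t \<bullet> ((1 / sqrt (real n)) *\<^sub>R (\<Sum>i<n. \<xi> i \<omega>))) \<partial>M) = (\<integral>\<omega>. f 0 \<partial>M)" for n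
      by (intro integral_cong_AE) (auto simp: inner_sum_right elim!: eventually_mono)
    moreover interpret N: real_distribution std_normal_distribution by (rule real_dist_normal_dist)
    have "(\<integral>x. f (sqrt v * x) \<partial>std_normal_distribution) = f 0"
      using True N.prob_space by (simp del: N.space_eq_univ)
    ultimately show ?thesis unfolding lim by (simp add: prob_space)
  next
    case False
    define \<sigma> where "\<sigma> = sqrt v"
    have \<sigma>: "0 < \<sigma>" "\<sigma>\<^sup>2 = v" using v False by (auto simp: \<sigma>_def)
    have wc: "weak_conv_m (\<lambda>n. distr M borel (\<lambda>\<omega>. (\<Sum>i<n. t \<bullet> \<xi> i \<omega>) / sqrt (real n * \<sigma>\<^sup>2))) std_normal_distribution"
    proof (rule central_limit_theorem_zero_mean)
      show "indep_vars (\<lambda>_. borel) (\<lambda>i \<omega>. t \<bullet> \<xi> i \<omega>) UNIV"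
        by (rule indep_vars_compose2[OF indep, of "\<lambda>_ w. t \<bullet> w"]) simp
      show "variance (\<lambda>\<omega>. t \<bullet> \<xi> n \<omega>) = \<sigma>\<^sup>2" for n
        using var[of t n] by (simp add: mean \<sigma> v_def)
      show "distr M borel (\<lambda>\<omega>. t \<bullet> \<xi> n \<omega>) = distr \<nu> borel (\<lambda>w. t \<bullet> w)" for n
        unfolding distr[of n, symmetric] by (subst distr_distr) (auto simp: comp_def)
    qed (use mean int \<sigma> in auto)
    have rd: "real_distribution (distr M borel (\<lambda>\<omega>. (\<Sum>i<n. t \<bullet> \<xi> i \<omega>) / sqrt (real n * \<sigma>\<^sup>2)))" for n
      by (rule real_distribution_distr) simp
    have "(\<lambda>n. \<integral>x. f (\<sigma> * x) \<partial>distr M borel (\<lambda>\<omega>. (\<Sum>i<n. t \<bullet> \<xi> i \<omega>) / sqrt (real n * \<sigma>\<^sup>2)))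
        \<longlonglongrightarrow> (\<integral>x. f (\<sigma> * x) \<partial>std_normal_distribution)"
    proof (rule weak_conv_imp_integral_bdd_continuous_conv[OF rd real_dist_normal_dist wc, where B = B])
      have "isCont f (\<sigma> * x)" for x
        using f(1) by (simp add: continuous_on_eq_continuous_at)
      moreover have "isCont (\<lambda>x. \<sigma> * x) x" for x by (intro continuous_intros)
      ultimately show "isCont (\<lambda>x. f (\<sigma> * x)) x" for x by (rule isCont_o2[rotated])
    qed (use B in simp)
    moreover have "(\<integral>x. f (\<sigma> * x) \<partial>distr M borel (\<lambda>\<omega>. (\<Sum>i<n. t \<bullet> \<xi> i \<omega>) / sqrt (real n * \<sigma>\<^sup>2)))
        = (\<integral>\<omega>. f (t \<bullet> ((1 / sqrt (real n)) *\<^sub>R (\<Sum>i<n. \<xi> i \<omega>))) \<partial>M)" for n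
      using \<sigma>(1) by (simp add: integral_distr real_sqrt_mult inner_sum_right)
    ultimately show ?thesis unfolding lim \<sigma>_def by simp
  qed
qed

subsection \<open>Sampling\<close>

text \<open>As a box of singletons, a grid point is measurable in the product sigma-algebra.\<close>

lemma singleton_grid_point: "{grid_point d x i} = (\<Pi>\<^sub>E l\<in>{1..d}. {x l (i l)})"
proof -
  have "(\<Pi>\<^sub>E l\<in>{1..d}. {x l (i l)}) = (\<Pi>\<^sub>E l\<in>{1..d}. {grid_point d x i l})"
    by (rule PiE_cong) (simp add: grid_point_def)
  also have "\<dots> = {grid_point d x i}" by (rule PiE_singleton) (simp add: grid_point_def extensional_def)
  finally show ?thesis by simp
qed

lemma singleton_grid_point_sets: "{grid_point d x i} \<in> sets (borel_pow d)"
  unfolding singleton_grid_point by (rule sets_PiM_I_finite) auto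

lemma inj_on_grid_point:
  assumes "\<And>l. l \<in> {1..d} \<Longrightarrow> strict_mono_on {1..r l} (x l)"
  shows "inj_on (grid_point d x) (idx_set d r)"
proof (rule inj_onI)
  fix i j assume ij: "i \<in> idx_set d r" "j \<in> idx_set d r" and eq: "grid_point d x i = grid_point d x j"
  have "i l = j l" if l: "l \<in> {1..d}" for l
  proof -
    have "x l (i l) = x l (j l)" using fun_cong[OF eq, of l] l by (simp add: grid_point_def)
    moreover have "i l \<in> {1..r l}" "j l \<in> {1..r l}" using ij l by (auto simp: idx_set_def)
    ultimately show ?thesis using strict_mono_on_imp_inj_on[OF assms[OF l]] by (auto dest: inj_onD)
  qed
  then show "i = j" using ij by (auto simp: idx_set_def intro: PiE_ext)
qed

text \<open>The sample is numbered from 1, the partial sums of the limit theorem from 0.\<close>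

lemma (in prob_space) indep_vars_Suc:
  assumes "indep_vars (\<lambda>_. N) X {1..}"
  shows "indep_vars (\<lambda>_. N) (\<lambda>k. X (Suc k)) UNIV"
  unfolding indep_vars_def2
proof (intro conjI ballI)
  show "random_variable N (X (Suc k))" for k
    using assms by (auto simp: indep_vars_def2)
  have ind: "indep_sets (\<lambda>i. {X i -` A \<inter> space M |A. A \<in> sets N}) {1..}"
    using assms by (auto simp: indep_vars_def2)
  show "indep_sets (\<lambda>k. {X (Suc k) -` A \<inter> space M |A. A \<in> sets N}) UNIV"
    unfolding indep_sets_def
  proof (intro conjI ballI allI impI)
    show "{X (Suc k) -` A \<inter> space M |A. A \<in> sets N} \<subseteq> events" for k
      using ind by (auto simp: indep_sets_def)
    fix J :: "nat set" and A
    assume J: "J \<noteq> {}" "finite J" and A: "A \<in> (\<Pi> j\<in>J. {X (Suc j) -` A \<inter> space M |A. A \<in> sets N})"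
    have "prob (\<Inter>j \<in> Suc ` J. A (j - 1)) = (\<Prod>j \<in> Suc ` J. prob (A (j - 1)))"
      by (rule indep_setsD[OF ind]) (use J A in auto)
    then show "prob (\<Inter> (A ` J)) = (\<Prod>j \<in> J. prob (A j))"
      by (simp add: prod.reindex image_image)
  qed
qed

context copula_support
begin

text \<open>Near \<open>p\<close> the logarithm of an entry has Lipschitz constant at most 2 / m,
  which converts the bound in logarithmic coordinates into one in the arrays themselves.\<close>

lemma I_proj_local_lipschitz:
  assumes p: "positive_on p"
  obtains C \<delta> where "0 \<le> C" "0 < \<delta>" "\<And>q. positive_on q \<Longrightarrow> array_dist d r q p < \<delta> \<Longrightarrow>
    array_dist d r (I_proj d r q) (I_proj d r p) \<le> C * array_dist d r q p"
proof -
  define m where "m = Min (insert 1 (p ` S))"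
  have m: "0 < m" unfolding m_def using finite_S p
    by (subst Min_gr_iff) (auto simp: positive_on_def)
  have mp: "m \<le> p i" if "i \<in> S" for i
    unfolding m_def using finite_S that by (auto intro!: Min_le)
  define C where "C = real (card S) * (2 / m)"
  have "0 \<le> C" using m by (simp add: C_def)
  moreover have "0 < m / 2" using m by simp
  moreover have "array_dist d r (I_proj d r q) (I_proj d r p) \<le> C * array_dist d r q p"
    if q: "positive_on q" and less: "array_dist d r q p < m / 2" for q
  proof -
    have D: "array_dist d r q p = L2_set (\<lambda>i. q i - p i) S"
      by (rule array_dist_S) (use p q in \<open>auto simp: positive_on_def\<close>)
    have qp: "\<bar>q i - p i\<bar> \<le> array_dist d r q p" if "i \<in> S" for i
      using member_le_L2_set[OF finite_S that, of "\<lambda>i. \<bar>q i - p i\<bar>"] by (simp add: D L2_set_def)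
    have "array_dist d r (I_proj d r q) (I_proj d r p) \<le> L2_set (\<lambda>i. ln (q i) - ln (p i)) S"
      by (rule I_proj_lipschitz_ln[OF p q])
    also have "\<dots> \<le> (\<Sum>i \<in> S. \<bar>ln (q i) - ln (p i)\<bar>)" by (rule L2_set_le_sum_abs)
    also have "\<dots> \<le> (\<Sum>i \<in> S. 2 * (array_dist d r q p / m))"
      by (intro sum_mono abs_ln_diff_minus_quotient_le[OF m mp qp]) (use less in auto)
    also have "\<dots> = C * array_dist d r q p" by (simp add: C_def)
    finally show ?thesis .
  qed
  ultimately show thesis by (rule that)
qed

end

section \<open>The sample, its smoothed array and consistency\<close>

locale copula_sample = copula_support d r S + prob_space M
  for d r S and M :: "'w measure" +
  fixes x :: "nat \<Rightarrow> nat \<Rightarrow> real" and P :: "(nat \<Rightarrow> real) measure"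
    and X :: "nat \<Rightarrow> 'w \<Rightarrow> (nat \<Rightarrow> real)" and p :: real_array
  assumes x_mono: "\<And>l. l \<in> {1..d} \<Longrightarrow> strict_mono_on {1..r l} (x l)"
    and P_prob: "prob_space P" and P_sets: "sets P = sets (borel_pow d)"
    and p_def: "p = prob_array_of d r x P"
    and p_prob: "p \<in> prob_arrays d r"
    and S_def: "S = supp d r p"
    and X_rv: "\<And>k. 1 \<le> k \<Longrightarrow> X k \<in> measurable M (borel_pow d)"
    and X_distr: "\<And>k. 1 \<le> k \<Longrightarrow> distr M (borel_pow d) (X k) = P"
begin

abbreviation phat :: "nat \<Rightarrow> 'w \<Rightarrow> real_array" where "phat \<equiv> smoothed_array d r x S X"

lemma p_nth: "i \<in> idx_set d r \<Longrightarrow> p i = measure P {grid_point d x i}"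
  by (simp add: p_def prob_array_of_def)

lemma positive_p: "positive_on p"
  by (rule positive_onI) (use p_prob in \<open>auto simp: S_def prob_arrays_def arrays_def supp_def less_le\<close>)

lemma inj_on_grid: "inj_on (grid_point d x) (idx_set d r)"
  by (rule inj_on_grid_point) (rule x_mono)

lemma grid_point_eq_iff:
  "i \<in> idx_set d r \<Longrightarrow> j \<in> idx_set d r \<Longrightarrow> grid_point d x i = grid_point d x j \<longleftrightarrow> i = j"
  using inj_on_grid by (auto dest: inj_onD)

text \<open>The entries of \<open>p\<close> sum to 1, so the finitely many grid points with index in
  \<open>S\<close> carry all of \<open>P\<close>; countability of the sample gives one null
  set.\<close>

lemma AE_sample_in_support: "AE \<omega> in M. \<forall>k\<ge>1. X k \<omega> \<in> grid_point d x ` S"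
proof -
  interpret P: prob_space P by (rule P_prob)
  have "measure P (grid_point d x ` S) = (\<Sum>z \<in> grid_point d x ` S. measure P {z})"
    by (rule P.finite_measure_eq_sum_singleton)
      (use finite_S singleton_grid_point_sets P_sets in auto)
  also have "\<dots> = (\<Sum>i \<in> S. measure P {grid_point d x i})"
    by (rule sum.reindex_cong) (use inj_on_subset[OF inj_on_grid S_subset] in auto)
  also have "\<dots> = (\<Sum>i \<in> idx_set d r. p i)"
    using sum_S[of p] S_subset by (auto simp: S_def[symmetric] p_nth intro!: sum.cong)
  also have "\<dots> = 1" using p_prob by (simp add: prob_arrays_def)
  finally have AEP: "AE z in P. z \<in> grid_point d x ` S" by (rule P.AE_prob_1)
  have "AE \<omega> in M. X k \<omega> \<in> grid_point d x ` S" if "1 \<le> k" for k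
    using AEP unfolding X_distr[OF that, symmetric] by (rule AE_distrD[OF X_rv[OF that]])
  then show ?thesis by (simp add: AE_all_countable)
qed

text \<open>The purpose of the smoothing: the empirical array may miss points of \<open>S\<close>,
  and the uniform term fills them for every \<open>n\<close>, while off \<open>S\<close> both terms
  vanish almost surely.\<close>

lemma AE_phat_positive: "AE \<omega> in M. \<forall>n. positive_on (phat n \<omega>)"
  using AE_sample_in_support
proof eventually_elim
  case (elim \<omega>)
  show ?case
  proof (intro allI positive_onI)
    fix n i
    show "phat n \<omega> i = 0" if "i \<notin> S"
    proof -
      have "indicator {grid_point d x i} (X k \<omega>) = (0 :: real)" if i: "i \<in> idx_set d r" and k: "k \<in> {1..n}" for k
      proof -
        obtain j where "j \<in> S" "X k \<omega> = grid_point d x j" using elim k by auto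
        then show ?thesis using i \<open>i \<notin> S\<close> S_subset grid_point_eq_iff[of i j] by (auto simp: indicator_def)
      qed
      then show ?thesis using that by (simp add: smoothed_array_def empirical_array_def)
    qed
    show "0 < phat n \<omega> i" if "i \<in> S"
    proof -
      have "0 < card S" using that finite_S card_gt_0_iff by blast
      then have "0 < 1 / (real n + 1) * (1 / real (card S) * indicator S i)" using that by simp
      moreover have "0 \<le> real n / (real n + 1) * empirical_array d r x X n \<omega> i"
        unfolding empirical_array_def by (auto intro!: divide_nonneg_nonneg mult_nonneg_nonneg sum_nonneg)
      ultimately show ?thesis by (simp add: smoothed_array_def)
    qed
  qed
qed

text \<open>
  The smoothed array takes finitely many values, and off a null set it lies in the domain where the
  projection is well behaved.  Hence measurability holds for every function of it, however the
  projection is chosen off that domain.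
\<close>

lemma phat_functional_measurable: "(\<lambda>\<omega>. F (phat n \<omega>) :: real) \<in> borel_measurable M"
proof -
  define D where "D = {1..n} \<times> idx_set d r"
  \<comment> \<open>The pattern of which observation hits which grid point; it takes finitely many
    values and determines the smoothed array.\<close>
  define c where "c \<omega> = {e \<in> D. X (fst e) \<omega> = grid_point d x (snd e)}" for \<omega>
  have D: "finite D" by (simp add: D_def finite_idx_set)
  define \<Psi> :: "(nat \<times> multi_index) set \<Rightarrow> real_array" where
    "\<Psi> a = (\<lambda>i. real n / (real n + 1) *
        (if i \<in> idx_set d r then 1 / real n * (\<Sum>k = 1..n. if (k, i) \<in> a then 1 else 0) else 0)
        + 1 / (real n + 1) * (1 / real (card S) * indicator S i))" for a
  have phat: "phat n \<omega> = \<Psi> (c \<omega>)" for \<omega>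
    by (rule ext) (auto simp: smoothed_array_def empirical_array_def \<Psi>_def c_def D_def intro!: sum.cong)
  have c: "c \<in> measurable M (count_space (Pow D))"
  proof (subst measurable_count_space_eq2, simp add: D, intro conjI ballI)
    show "c \<in> space M \<rightarrow> Pow D" by (auto simp: c_def)
    fix a assume a: "a \<in> Pow D"
    have *: "{e \<in> D. Q e} = a \<longleftrightarrow> (\<forall>e \<in> D. Q e \<longleftrightarrow> e \<in> a)" for Q
      using a by auto
    have "c -` {a} \<inter> space M = {\<omega> \<in> space M. \<forall>e \<in> D. X (fst e) \<omega> = grid_point d x (snd e) \<longleftrightarrow> e \<in> a}"
      by (simp only: vimage_def Int_def c_def singleton_iff mem_Collect_eq * conj_commute)
    also have "\<dots> \<in> sets M"
    proof (rule sets.sets_Collect_finite_All[OF _ D])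
      fix e assume "e \<in> D"
      then have "1 \<le> fst e" by (auto simp: D_def)
      from measurable_sets[OF X_rv[OF this] singleton_grid_point_sets[of d x "snd e"]]
      have "{\<omega> \<in> space M. X (fst e) \<omega> = grid_point d x (snd e)} \<in> sets M"
        by (simp add: vimage_def Int_def conj_commute)
      then show "{\<omega> \<in> space M. X (fst e) \<omega> = grid_point d x (snd e) \<longleftrightarrow> e \<in> a} \<in> sets M"
        by (cases "e \<in> a") (auto intro: sets.sets_Collect_neg)
    qed
    finally show "c -` {a} \<inter> space M \<in> sets M" .
  qed
  have "(\<lambda>a. F (\<Psi> a)) \<in> borel_measurable (count_space (Pow D))" by simp
  from measurable_compose[OF c this] show ?thesis unfolding phat .
qed

lemma phat_vectorise_measurable:
  "(\<lambda>\<omega>. vectorise d r (F (phat n \<omega>)) :: real ^ 'n::{finite,linorder}) \<in> borel_measurable M"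
  unfolding vectorise_def
  by (rule borel_measurable_vec_lambda) (rule phat_functional_measurable[of "\<lambda>a. F a _"])

theorem consistent_in_prob:
  assumes "conv_in_prob d r M phat p"
  shows "conv_in_prob d r M (\<lambda>n \<omega>. I_proj d r (phat n \<omega>)) (I_proj d r p)"
  unfolding conv_in_prob_def
proof (intro conjI allI impI ballI)
  show "(\<lambda>\<omega>. I_proj d r (phat n \<omega>) i) \<in> borel_measurable M" for n i
    by (rule phat_functional_measurable[of "\<lambda>a. I_proj d r a i"])
  fix \<epsilon> :: real assume \<epsilon>: "0 < \<epsilon>"
  obtain C \<delta> where C: "0 \<le> C" "0 < \<delta>" "\<And>q. positive_on q \<Longrightarrow> array_dist d r q p < \<delta> \<Longrightarrow>
    array_dist d r (I_proj d r q) (I_proj d r p) \<le> C * array_dist d r q p"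
    using I_proj_local_lipschitz[OF positive_p] by blast
  \<comment> \<open>The first bound enters the Lipschitz neighbourhood, the second makes the image
    error at most \<epsilon>; \<open>C + 1\<close> avoids division by 0.\<close>
  define \<delta>' where "\<delta>' = min (\<delta> / 2) (\<epsilon> / (C + 1))"
  have \<delta>': "0 < \<delta>'" using C \<epsilon> by (simp add: \<delta>'_def)
  show "(\<lambda>n. prob {\<omega> \<in> space M. array_dist d r (I_proj d r (phat n \<omega>)) (I_proj d r p) > \<epsilon>}) \<longlonglongrightarrow> 0"
  proof (rule tendsto_sandwich[of "\<lambda>_. 0"])
    show "(\<lambda>n. prob {\<omega> \<in> space M. array_dist d r (phat n \<omega>) p > \<delta>'}) \<longlonglongrightarrow> 0"
      using assms \<delta>' by (simp add: conv_in_prob_def)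
    show "\<forall>\<^sub>F n in sequentially. prob {\<omega> \<in> space M. array_dist d r (I_proj d r (phat n \<omega>)) (I_proj d r p) > \<epsilon>}
        \<le> prob {\<omega> \<in> space M. array_dist d r (phat n \<omega>) p > \<delta>'}"
    proof (rule always_eventually, rule allI, rule finite_measure_mono_AE)
      fix n
      show "AE \<omega> in M. \<omega> \<in> {\<omega> \<in> space M. array_dist d r (I_proj d r (phat n \<omega>)) (I_proj d r p) > \<epsilon>} \<longrightarrow>
          \<omega> \<in> {\<omega> \<in> space M. array_dist d r (phat n \<omega>) p > \<delta>'}"
        using AE_phat_positive
      proof eventually_elim
        case (elim \<omega>)
        have "array_dist d r (I_proj d r (phat n \<omega>)) (I_proj d r p) \<le> \<epsilon>" if "array_dist d r (phat n \<omega>) p \<le> \<delta>'"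
        proof -
          have "array_dist d r (phat n \<omega>) p < \<delta>" using that C(2) by (simp add: \<delta>'_def)
          then have "array_dist d r (I_proj d r (phat n \<omega>)) (I_proj d r p) \<le> C * array_dist d r (phat n \<omega>) p"
            using elim by (intro C(3)) auto
          also have "\<dots> \<le> C * (\<epsilon> / (C + 1))" using that C(1) by (intro mult_left_mono) (auto simp: \<delta>'_def)
          also have "\<dots> \<le> \<epsilon>" using C(1) \<epsilon> by (simp add: pos_divide_le_eq algebra_simps)
          finally show ?thesis .
        qed
        then show ?case by force
      qed
      show "{\<omega> \<in> space M. array_dist d r (phat n \<omega>) p > \<delta>'} \<in> events"
        using phat_functional_measurable[of "\<lambda>a. array_dist d r a p" n] by measurable
    qed
  qed auto
qed

theorem consistent_almost_surely:
  assumes "conv_almost_surely d r M phat p"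
  shows "conv_almost_surely d r M (\<lambda>n \<omega>. I_proj d r (phat n \<omega>)) (I_proj d r p)"
  unfolding conv_almost_surely_def
proof (intro conjI allI ballI)
  show "(\<lambda>\<omega>. I_proj d r (phat n \<omega>) i) \<in> borel_measurable M" for n i
    by (rule phat_functional_measurable[of "\<lambda>a. I_proj d r a i"])
  obtain C \<delta> where C: "0 \<le> C" "0 < \<delta>" "\<And>q. positive_on q \<Longrightarrow> array_dist d r q p < \<delta> \<Longrightarrow>
    array_dist d r (I_proj d r q) (I_proj d r p) \<le> C * array_dist d r q p"
    using I_proj_local_lipschitz[OF positive_p] by blast
  have "AE \<omega> in M. (\<lambda>n. array_dist d r (phat n \<omega>) p) \<longlonglongrightarrow> 0"
    using assms by (simp add: conv_almost_surely_def)
  then show "AE \<omega> in M. (\<lambda>n. array_dist d r (I_proj d r (phat n \<omega>)) (I_proj d r p)) \<longlonglongrightarrow> 0"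
    using AE_phat_positive
  proof eventually_elim
    case (elim \<omega>)
    have "\<forall>\<^sub>F n in sequentially. array_dist d r (phat n \<omega>) p < \<delta>"
      using elim(1) C(2) by (rule order_tendstoD)
    then have le: "\<forall>\<^sub>F n in sequentially. array_dist d r (I_proj d r (phat n \<omega>)) (I_proj d r p) \<le> C * array_dist d r (phat n \<omega>) p"
      by eventually_elim (use elim C(3) in auto)
    have lim: "(\<lambda>n. C * array_dist d r (phat n \<omega>) p) \<longlonglongrightarrow> 0"
      using tendsto_mult_left[OF elim(1), of C] by simp
    have "\<forall>\<^sub>F n in sequentially. 0 \<le> array_dist d r (I_proj d r (phat n \<omega>)) (I_proj d r p)"
      by (simp add: array_dist_def L2_set_nonneg)
    from tendsto_sandwich[OF this le tendsto_const lim] show ?case .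
  qed
qed

end

section \<open>Limit laws of the empirical copula array\<close>

locale copula_sample_coordinates = copula_sample d r S M x P X p
    + copula_coordinates d r S p \<Delta> A R At G H J \<Sigma>\<^sub>\<gamma>
  for d r S and M :: "'w measure" and x P X p and \<Delta> :: "'k::finite \<Rightarrow> real_array"
    and A :: "real ^ 'k ^ 'n::{finite,linorder}"
    and R :: "real ^ 'n::{finite,linorder} ^ 's::{finite,linorder}"
    and At G H J \<Sigma>\<^sub>\<gamma>
begin

theorem copula_delta_method:
  assumes \<rho>: "filterlim \<rho> at_top sequentially"
    and conv: "conv_in_distr M (\<lambda>n \<omega>. \<rho> n *\<^sub>R (vct (phat n \<omega>) - vct p)) \<mu>"
  shows "conv_in_distr M (\<lambda>n \<omega>. \<rho> n *\<^sub>R (vct (I_proj d r (phat n \<omega>)) - vct (I_proj d r p)))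
    (distr \<mu> borel ((*v) J))"
proof -
  obtain C \<delta> where C: "0 < \<delta>" "0 \<le> C"
    "\<And>q. positive_on q \<Longrightarrow> norm (vct q - vct p) < \<delta> \<Longrightarrow>
      norm (vct (I_proj d r q) - vct (I_proj d r p) - J *v (vct q - vct p)) \<le> C * (norm (vct q - vct p))\<^sup>2"
    using I_proj_expansion by blast
  show ?thesis
  proof (rule delta_method[OF conv \<rho> _ _ C(1,2)])
    show "(\<lambda>\<omega>. vct (phat n \<omega>) - vct p) \<in> borel_measurable M" for n
      using phat_vectorise_measurable[of "\<lambda>a. a" n] by measurable
    show "(\<lambda>\<omega>. vct (I_proj d r (phat n \<omega>)) - vct (I_proj d r p)) \<in> borel_measurable M" for n
      using phat_vectorise_measurable[of "I_proj d r" n] by measurable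
    show "AE \<omega> in M. norm (vct (phat n \<omega>) - vct p) < \<delta> \<longrightarrow>
      norm (vct (I_proj d r (phat n \<omega>)) - vct (I_proj d r p) - J *v (vct (phat n \<omega>) - vct p))
        \<le> C * (norm (vct (phat n \<omega>) - vct p))\<^sup>2" for n
      using AE_phat_positive by eventually_elim (use C(3) in blast)
  qed
qed

text \<open>The covariance of a single multinomial trial.\<close>

abbreviation (input) V :: "real ^ 'n::{finite,linorder} ^ 'n::{finite,linorder}" where
  "V \<equiv> diag_matrix (vct p) - outer_product (vct p) (vct p)"

lemma sum_vct_p: "(\<Sum>c \<in> UNIV. vct p $ c) = 1"
proof -
  have "(\<Sum>c \<in> (UNIV :: 'n set). p (entry d r c)) = (\<Sum>i \<in> idx_set d r. p i)"
    by (rule sum.reindex_bij_betw[OF entry_bij[OF d_pos card_n]])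
  then show ?thesis using p_prob by (simp add: vectorise_nth prob_arrays_def)
qed

lemma vct_p_nonneg: "0 \<le> vct p $ c"
  by (simp add: vectorise_nth p_def prob_array_of_def)

lemma V_nth: "V $ i $ j = (if i = j then vct p $ i else 0) - vct p $ i * vct p $ j"
  by (simp add: diag_matrix_def outer_product_def)

text \<open>With \<open>s = \<surd>p\<close> the matrix \<open>B = diag s - p s\<^sup>T\<close> satisfies \<open>B B\<^sup>T = V\<close>, because \<open>s\<^sup>T s = 1\<close>.\<close>

lemma ex_mv_normal_V: "\<exists>\<mu>. mv_normal \<mu> 0 V"
proof -
  define B :: "real ^ 'n::{finite,linorder} ^ 'n::{finite,linorder}" where
    "B = (\<chi> i k. ((if i = k then 1 else 0) - vct p $ i) * sqrt (vct p $ k))"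
  have "(B ** transpose B) $ i $ j = V $ i $ j" for i j
  proof -
    have "(B ** transpose B) $ i $ j = (\<Sum>k \<in> UNIV. (sqrt (vct p $ k) * sqrt (vct p $ k)) *
        (((if i = k then 1 else 0) - vct p $ i) * ((if j = k then 1 else 0) - vct p $ j)))"
      by (simp add: matrix_matrix_mult_def transpose_def B_def mult_ac del: real_sqrt_mult_self)
    also have "\<dots> = (\<Sum>k \<in> UNIV. (if i = k then (if j = k then vct p $ k else 0) else 0)
        - (if i = k then vct p $ k * vct p $ j else 0) - (if j = k then vct p $ k * vct p $ i else 0)
        + vct p $ k * (vct p $ i * vct p $ j))"
      by (rule sum.cong) (auto simp: vct_p_nonneg algebra_simps)
    also have "\<dots> = V $ i $ j"
      unfolding sum.distrib sum_subtractf V_nth sum_distrib_right[symmetric] sum_vct_p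
      by (auto simp: algebra_simps)
    finally show ?thesis .
  qed
  then have "B ** transpose B = V" by (simp add: vec_eq_iff)
  then show ?thesis using ex_mv_normal[of B] by metis
qed

text \<open>One-hot encoding of an observation: the vectorised empirical array is the mean of these
  vectors, to which the central limit theorem applies.\<close>

definition cell :: "(nat \<Rightarrow> real) \<Rightarrow> real ^ 'n::{finite,linorder}" where
  "cell z = (\<chi> c. indicator {grid_point d x (entry d r c)} z)"

lemma cell_measurable: "cell \<in> borel_measurable (borel_pow d)"
  unfolding cell_def
  by (intro borel_measurable_vec_lambda borel_measurable_indicator singleton_grid_point_sets)

lemma cell_nth_mult: "cell z $ c * cell z $ c' = (if c = c' then cell z $ c else 0)"
proof -
  have "entry d r c \<in> idx_set d r" "entry d r c' \<in> idx_set d r" "entry d r c = entry d r c' \<longleftrightarrow> c = c'"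
    using entry_bij[OF d_pos card_n] by (auto simp: bij_betw_def inj_eq)
  then show ?thesis
    using grid_point_eq_iff[of "entry d r c" "entry d r c'"] by (auto simp: cell_def indicator_def)
qed

text \<open>Distinct cells exclude each other, so the cross terms vanish and the square is again
  linear in \<open>cell z\<close>. Second moments thereby reduce to the means.\<close>

lemma inner_cell_square: "(t \<bullet> cell z)\<^sup>2 = (\<chi> c. (t $ c)\<^sup>2) \<bullet> cell z"
proof -
  have "(t \<bullet> cell z)\<^sup>2 = (\<Sum>c \<in> UNIV. \<Sum>c' \<in> UNIV. t $ c * t $ c' * (cell z $ c * cell z $ c'))"
    by (simp add: power2_eq_square inner_vec_def sum_product mult_ac)
  also have "\<dots> = (\<chi> c. (t $ c)\<^sup>2) \<bullet> cell z"
    by (simp add: cell_nth_mult inner_vec_def power2_eq_square if_distrib[of "\<lambda>x. _ * x"] cong: if_cong)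
  finally show ?thesis .
qed

lemma cell_integral:
  assumes "1 \<le> k"
  shows "integrable M (\<lambda>\<omega>. t \<bullet> cell (X k \<omega>))" "expectation (\<lambda>\<omega>. t \<bullet> cell (X k \<omega>)) = t \<bullet> vct p"
proof -
  have ent: "entry d r c \<in> idx_set d r" for c :: 'n
    using entry_bij[OF d_pos card_n] by (auto simp: bij_betw_def)
  have *: "integrable M (\<lambda>\<omega>. cell (X k \<omega>) $ c) \<and> expectation (\<lambda>\<omega>. cell (X k \<omega>) $ c) = vct p $ c" for c
  proof -
    let ?z = "grid_point d x (entry d r c)"
    have m: "X k -` {?z} \<inter> space M \<in> sets M"
      by (rule measurable_sets[OF X_rv[OF assms] singleton_grid_point_sets])
    have eq: "cell (X k \<omega>) $ c = indicator (X k -` {?z} \<inter> space M) \<omega>" if "\<omega> \<in> space M" for \<omega>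
      using that by (auto simp: cell_def indicator_def)
    have "vct p $ c = measure (distr M (borel_pow d) (X k)) {?z}"
      unfolding vectorise_nth X_distr[OF assms] by (rule p_nth[OF ent])
    also have "\<dots> = prob (X k -` {?z} \<inter> space M)"
      by (rule measure_distr[OF X_rv[OF assms] singleton_grid_point_sets])
    finally have "expectation (\<lambda>\<omega>. cell (X k \<omega>) $ c) = vct p $ c"
      using m by (simp add: eq cong: Bochner_Integration.integral_cong)
    moreover have "integrable M (\<lambda>\<omega>. cell (X k \<omega>) $ c)"
      using m by (simp add: eq cong: Bochner_Integration.integrable_cong)
        (auto intro!: integrable_real_indicator simp: emeasure_eq_measure)
    ultimately show ?thesis by simp
  qed
  show "integrable M (\<lambda>\<omega>. t \<bullet> cell (X k \<omega>))"
    using * by (simp add: inner_vec_def)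
  show "expectation (\<lambda>\<omega>. t \<bullet> cell (X k \<omega>)) = t \<bullet> vct p"
    using * by (simp add: inner_vec_def)
qed

text \<open>The variance of \<open>t \<bullet> cell\<close> as second moment minus squared
  mean.\<close>

lemma V_quadratic: "t \<bullet> (V *v t) = (\<chi> c. (t $ c)\<^sup>2) \<bullet> vct p - (t \<bullet> vct p)\<^sup>2"
proof -
  have "V *v t = (\<chi> c. vct p $ c * t $ c) - (t \<bullet> vct p) *\<^sub>R vct p"
    by (simp add: matrix_vector_mult_diff_rdistrib diag_matrix_vector)
      (simp add: vec_eq_iff outer_product_def matrix_vector_mult_def inner_vec_def sum_distrib_left sum_distrib_right mult_ac)
  then have "t \<bullet> (V *v t) = t \<bullet> (\<chi> c. vct p $ c * t $ c) - (t \<bullet> vct p)\<^sup>2"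
    by (simp add: inner_diff_right power2_eq_square)
  also have "t \<bullet> (\<chi> c. vct p $ c * t $ c) = (\<chi> c. (t $ c)\<^sup>2) \<bullet> vct p"
    by (simp add: inner_vec_def power2_eq_square mult_ac)
  finally show ?thesis .
qed

lemma cell_sums_conv:
  assumes indep: "indep_vars (\<lambda>_. borel_pow d) X {1..}" and \<mu>: "mv_normal \<mu> 0 V"
  shows "conv_in_distr M (\<lambda>n \<omega>. (1 / sqrt (real n)) *\<^sub>R (\<Sum>i<n. cell (X (Suc i) \<omega>) - vct p)) \<mu>"
proof (rule multivariate_central_limit_theorem[OF _ _ _ _ _ \<mu>])
  have m: "(\<lambda>z. cell z - vct p) \<in> borel_measurable (borel_pow d)"
    using cell_measurable by measurable
  show "indep_vars (\<lambda>_. borel) (\<lambda>i \<omega>. cell (X (Suc i) \<omega>) - vct p) UNIV"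
    by (rule indep_vars_compose2[OF indep_vars_Suc[OF indep], of "\<lambda>_ z. cell z - vct p"]) (rule m)
  show "distr M borel (\<lambda>\<omega>. cell (X (Suc n) \<omega>) - vct p) = distr P borel (\<lambda>z. cell z - vct p)" for n
  proof -
    have "distr (distr M (borel_pow d) (X (Suc n))) borel (\<lambda>z. cell z - vct p)
        = distr M borel (\<lambda>\<omega>. cell (X (Suc n) \<omega>) - vct p)"
      by (subst distr_distr[OF m X_rv]) (simp_all add: comp_def)
    moreover have "distr M (borel_pow d) (X (Suc n)) = P" by (rule X_distr) simp
    ultimately show ?thesis by (simp only:)
  qed
  fix n and t :: "real ^ 'n::{finite,linorder}"
  note int = cell_integral[of "Suc n", simplified]
  show "expectation (\<lambda>\<omega>. t \<bullet> (cell (X (Suc n) \<omega>) - vct p)) = 0"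
    using int[of t] by (simp add: inner_diff_right prob_space)
  have sq: "(t \<bullet> (cell z - vct p))\<^sup>2 = (\<chi> c. (t $ c)\<^sup>2) \<bullet> cell z - 2 * (t \<bullet> vct p) * (t \<bullet> cell z) + (t \<bullet> vct p)\<^sup>2" for z
    unfolding inner_diff_right power2_diff inner_cell_square by simp
  show "integrable M (\<lambda>\<omega>. (t \<bullet> (cell (X (Suc n) \<omega>) - vct p))\<^sup>2)"
    unfolding sq using int by simp
  have "expectation (\<lambda>\<omega>. (t \<bullet> (cell (X (Suc n) \<omega>) - vct p))\<^sup>2)
      = (\<chi> c. (t $ c)\<^sup>2) \<bullet> vct p - 2 * (t \<bullet> vct p) * (t \<bullet> vct p) + (t \<bullet> vct p)\<^sup>2"
    unfolding sq using int by (simp add: prob_space)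
  also have "\<dots> = t \<bullet> (V *v t)" unfolding V_quadratic by (simp add: power2_eq_square)
  finally show "expectation (\<lambda>\<omega>. (t \<bullet> (cell (X (Suc n) \<omega>) - vct p))\<^sup>2) = t \<bullet> (V *v t)" .
qed

text \<open>Per entry, the smoothed minus the empirical value is (q - a) / (n + 1) with both values
  in [0, 1]; times sqrt n this is at most 1 / sqrt n, for every outcome.\<close>

lemma smoothing_negligible:
  assumes "1 \<le> n"
  shows "norm (sqrt (real n) *\<^sub>R (vct (phat n \<omega>) - vct p)
      - (1 / sqrt (real n)) *\<^sub>R (\<Sum>i<n. cell (X (Suc i) \<omega>) - vct p)) \<le> real CARD('n) / sqrt (real n)"
proof -
  let ?D = "sqrt (real n) *\<^sub>R (vct (phat n \<omega>) - vct p) - (1 / sqrt (real n)) *\<^sub>R (\<Sum>i<n. cell (X (Suc i) \<omega>) - vct p)"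
  have n: "0 < real n" using assms by simp
  have "\<bar>?D $ c\<bar> \<le> 1 / sqrt (real n)" for c
  proof -
    define a where "a = empirical_array d r x X n \<omega> (entry d r c)"
    define q where "q = 1 / real (card S) * indicator S (entry d r c)"
    have ent: "entry d r c \<in> idx_set d r"
      using entry_bij[OF d_pos card_n] by (auto simp: bij_betw_def)
    have sum: "(\<Sum>i<n. cell (X (Suc i) \<omega>) $ c) = real n * a"
    proof -
      have "(\<Sum>i<n. cell (X (Suc i) \<omega>) $ c) = (\<Sum>k = 1..n. indicator {grid_point d x (entry d r c)} (X k \<omega>))"
        unfolding cell_def vec_lambda_beta
        by (rule sum.reindex_bij_witness[of _ "\<lambda>k. k - 1" Suc]) auto
      then show ?thesis using ent n by (simp add: a_def empirical_array_def)
    qed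
    have "0 \<le> (\<Sum>i<n. cell (X (Suc i) \<omega>) $ c)" "(\<Sum>i<n. cell (X (Suc i) \<omega>) $ c) \<le> (\<Sum>i<n. 1)"
      by (intro sum_nonneg sum_mono; simp add: cell_def)+
    then have a: "0 \<le> a" "a \<le> 1" using n by (simp_all add: sum zero_le_mult_iff)
    have q: "0 \<le> q" "q \<le> 1"
      by (auto simp: q_def indicator_def divide_le_eq_1 Suc_le_eq)
    have sq: "(1 / sqrt (real n)) * (real n * b) = sqrt (real n) * b" for b
      using n by (metis mult.assoc real_div_sqrt less_imp_le times_divide_eq_left mult_1)
    have "(\<Sum>i<n. cell (X (Suc i) \<omega>) - vct p) $ c = (\<Sum>i<n. cell (X (Suc i) \<omega>) $ c - vct p $ c)"
      by (subst sum_component) simp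
    also have "\<dots> = real n * (a - vct p $ c)"
      unfolding sum_subtractf sum by (simp add: right_diff_distrib)
    finally have "((1 / sqrt (real n)) *\<^sub>R (\<Sum>i<n. cell (X (Suc i) \<omega>) - vct p)) $ c = sqrt (real n) * (a - vct p $ c)"
      unfolding vector_scaleR_component real_scaleR_def by (simp only: sq)
    then have "?D $ c = sqrt (real n) * (real n / (real n + 1) * a + 1 / (real n + 1) * q - vct p $ c)
        - sqrt (real n) * (a - vct p $ c)"
      by (simp add: vectorise_nth smoothed_array_def a_def q_def)
    also have "\<dots> = sqrt (real n) * ((q - a) / (real n + 1))"
    proof -
      have *: "k / m * a + 1 / m * q - a = (q - a) / m" if "m = k + 1" "0 < k" for k m :: real
      proof -
        have "k / m * a + 1 / m * q - a = (k * a + q - m * a) / m"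
          using that by (simp add: add_divide_distrib diff_divide_distrib)
        then show ?thesis using that(1) by (simp add: algebra_simps)
      qed
      have "real n / (real n + 1) * a + 1 / (real n + 1) * q - a = (q - a) / (real n + 1)"
        by (rule *) (use n in auto)
      then show ?thesis by (simp add: right_diff_distrib[symmetric] algebra_simps)
    qed
    finally have "\<bar>?D $ c\<bar> = sqrt (real n) * (\<bar>q - a\<bar> / (real n + 1))"
      using n by (simp add: abs_mult)
    also have "\<dots> \<le> sqrt (real n) * (1 / real n)"
      using a q n by (intro mult_left_mono frac_le) auto
    also have "\<dots> = 1 / sqrt (real n)" using n by (simp add: real_div_sqrt field_simps)
    finally show ?thesis .
  qed
  then have "norm ?D \<le> (\<Sum>c \<in> (UNIV :: 'n set). 1 / sqrt (real n))"
    by (intro order.trans[OF norm_le_l1_cart] sum_mono)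
  then show ?thesis by simp
qed

lemma smoothed_array_conv:
  assumes indep: "indep_vars (\<lambda>_. borel_pow d) X {1..}" and \<mu>: "mv_normal \<mu> 0 V"
  shows "conv_in_distr M (\<lambda>n \<omega>. sqrt (real n) *\<^sub>R (vct (phat n \<omega>) - vct p)) \<mu>"
proof (rule conv_in_distr_slutsky[OF cell_sums_conv[OF indep \<mu>]])
  show "(\<lambda>\<omega>. sqrt (real n) *\<^sub>R (vct (phat n \<omega>) - vct p)) \<in> borel_measurable M" for n
    using phat_vectorise_measurable[of "\<lambda>a. a" n] by measurable
  fix \<epsilon> :: real assume \<epsilon>: "0 < \<epsilon>"
  have "filterlim (\<lambda>n. sqrt (real n)) at_top sequentially"
    by (rule filterlim_compose[OF sqrt_at_top filterlim_real_sequentially])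
  then have "(\<lambda>n. real CARD('n) / sqrt (real n)) \<longlonglongrightarrow> 0"
    by (rule real_tendsto_divide_at_top[OF tendsto_const])
  then have "\<forall>\<^sub>F n in sequentially. real CARD('n) / sqrt (real n) < \<epsilon>"
    using \<epsilon> by (rule order_tendstoD)
  \<comment> \<open>The bound is deterministic, so these probabilities are eventually equal to
    0.\<close>
  then have "\<forall>\<^sub>F n in sequentially. prob {\<omega> \<in> space M. norm (sqrt (real n) *\<^sub>R (vct (phat n \<omega>) - vct p)
      - (1 / sqrt (real n)) *\<^sub>R (\<Sum>i<n. cell (X (Suc i) \<omega>) - vct p)) > \<epsilon>} = 0"
    using eventually_ge_at_top[of 1]
  proof eventually_elim
    case (elim n)
    have "\<not> \<epsilon> < norm (sqrt (real n) *\<^sub>R (vct (phat n \<omega>) - vct p)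
      - (1 / sqrt (real n)) *\<^sub>R (\<Sum>i<n. cell (X (Suc i) \<omega>) - vct p))" for \<omega>
      using smoothing_negligible[OF elim(2), of \<omega>] elim(1) by linarith
    then show ?case by simp
  qed
  then show "(\<lambda>n. prob {\<omega> \<in> space M. norm (sqrt (real n) *\<^sub>R (vct (phat n \<omega>) - vct p)
      - (1 / sqrt (real n)) *\<^sub>R (\<Sum>i<n. cell (X (Suc i) \<omega>) - vct p)) > \<epsilon>}) \<longlonglongrightarrow> 0"
    by (rule tendsto_eventually)
qed

theorem iid_limits:
  assumes indep: "indep_vars (\<lambda>_. borel_pow d) X {1..}"
  shows "conv_to_normal M (\<lambda>n \<omega>. sqrt (real n) *\<^sub>R (vct (phat n \<omega>) - vct p)) 0 V"
    and "conv_to_normal M (\<lambda>n \<omega>. sqrt (real n) *\<^sub>R (vct (I_proj d r (phat n \<omega>)) - vct (I_proj d r p))) 0 \<Sigma>\<^sub>\<gamma>"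
proof -
  obtain \<mu> where \<mu>: "mv_normal \<mu> 0 V" using ex_mv_normal_V by blast
  note conv = smoothed_array_conv[OF indep \<mu>]
  show "conv_to_normal M (\<lambda>n \<omega>. sqrt (real n) *\<^sub>R (vct (phat n \<omega>) - vct p)) 0 V"
    unfolding conv_to_normal_def using \<mu> conv by blast
  have "filterlim (\<lambda>n. sqrt (real n)) at_top sequentially"
    by (rule filterlim_compose[OF sqrt_at_top filterlim_real_sequentially])
  from copula_delta_method[OF this conv]
  show "conv_to_normal M (\<lambda>n \<omega>. sqrt (real n) *\<^sub>R (vct (I_proj d r (phat n \<omega>)) - vct (I_proj d r p))) 0 \<Sigma>\<^sub>\<gamma>"
    unfolding conv_to_normal_def
    using mv_normal_linear_image[OF \<mu> transpose_Sigma Sigma_quadratic] by blast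
qed

end

text \<open>The dimensions N, |S| and that of the zero-margin space are carried by the types
  \<open>'n\<close>, \<open>'s\<close> and \<open>'k\<close>; the equations for their cardinalities
  therefore appear as premises of the distributional part.\<close>

theorem theorem4p1:
  fixes d :: nat and r :: "nat \<Rightarrow> nat" and x :: "nat \<Rightarrow> nat \<Rightarrow> real"
    and P :: "(nat \<Rightarrow> real) measure"
    and M :: "'w measure" and X :: "nat \<Rightarrow> 'w \<Rightarrow> (nat \<Rightarrow> real)"
    and p \<gamma>\<^sub>p :: real_array and phat \<gamma>hat :: "nat \<Rightarrow> 'w \<Rightarrow> real_array"
    and S :: "multi_index set"
    and \<Delta> :: "'k::finite \<Rightarrow> real_array"
    and A :: "real ^ 'k ^ 'n::{finite,linorder}"
    and R :: "real ^ 'n::{finite,linorder} ^ 's::{finite,linorder}"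
    and At :: "real ^ 'k ^ 's::{finite,linorder}"
    and G H :: "real ^ 'k ^ 'k"
    and J \<Sigma>\<^sub>\<gamma> :: "real ^ 'n::{finite,linorder} ^ 'n::{finite,linorder}"
  assumes d_pos: "1 \<le> d"
    and r_pos: "\<And>l. l \<in> {1..d} \<Longrightarrow> 1 \<le> r l"
    and x_mono: "\<And>l. l \<in> {1..d} \<Longrightarrow> strict_mono_on {1..r l} (x l)"
    and P_prob: "prob_space P" and P_sets: "sets P = sets (borel_pow d)"
    and P_grid: "measure P (grid d r x) = 1"
    and p_def: "p = prob_array_of d r x P"
    and p_prob: "p \<in> prob_arrays d r"
    and S_def: "S = supp d r p"
    and copula_ex: "copula_arrays_on d r S \<noteq> {}"
    and M_prob: "prob_space M"
    and X_rv: "\<And>k. 1 \<le> k \<Longrightarrow> X k \<in> measurable M (borel_pow d)"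
    and X_distr: "\<And>k. 1 \<le> k \<Longrightarrow> distr M (borel_pow d) (X k) = P"
    and gamma_def: "\<gamma>\<^sub>p = I_proj d r p"
    and phat_def: "phat = smoothed_array d r x S X"
    and gammahat_def: "\<gamma>hat = (\<lambda>n \<omega>. I_proj d r (phat n \<omega>))"
    and A_def: "A = (\<chi> c j. (vectorise d r (\<Delta> j) :: real ^ 'n::{finite,linorder}) $ c)"
    and R_def: "R = selection_matrix d r S"
    and At_def: "At = R ** A"
    and G_def: "G = transpose At ** diag_matrix_inv (R *v vectorise d r \<gamma>\<^sub>p) ** At"
    and H_def: "H = transpose At ** diag_matrix_inv (R *v vectorise d r p) ** At"
    and J_def: "J = A ** matrix_inv G ** transpose At
                      ** diag_matrix_inv (R *v vectorise d r p) ** R"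
    and Sigma_def: "\<Sigma>\<^sub>\<gamma> = A ** matrix_inv G ** H ** matrix_inv G ** transpose A"
  shows
    "(conv_in_prob d r M phat p \<longrightarrow> conv_in_prob d r M \<gamma>hat \<gamma>\<^sub>p) \<and>
     (conv_almost_surely d r M phat p \<longrightarrow> conv_almost_surely d r M \<gamma>hat \<gamma>\<^sub>p) \<and>
     (CARD('n) = (\<Prod>l = 1..d. r l) \<and> CARD('s) = card S \<and>
      1 \<le> dim (zero_margin_space d r S) \<and> CARD('k) = dim (zero_margin_space d r S) \<and>
      inj \<Delta> \<and> independent (range \<Delta>) \<and> span (range \<Delta>) = zero_margin_space d r S \<longrightarrow>
        invertible G \<and>
        (\<forall>(\<rho> :: nat \<Rightarrow> real) (M' :: 'z measure) (Z :: 'z \<Rightarrow> real ^ 'n::{finite,linorder}).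
           filterlim \<rho> at_top sequentially \<and> prob_space M' \<and> Z \<in> borel_measurable M' \<and>
           conv_in_distr M (\<lambda>n \<omega>. \<rho> n *\<^sub>R (vectorise d r (phat n \<omega>) - vectorise d r p))
             (distr M' borel Z) \<longrightarrow>
           conv_in_distr M (\<lambda>n \<omega>. \<rho> n *\<^sub>R (vectorise d r (\<gamma>hat n \<omega>) - vectorise d r \<gamma>\<^sub>p))
             (distr M' borel (\<lambda>z. J *v Z z))) \<and>
        (prob_space.indep_vars M (\<lambda>_. borel_pow d) X {1..} \<longrightarrow>
           conv_to_normal M
             (\<lambda>n \<omega>. sqrt (real n) *\<^sub>R (vectorise d r (phat n \<omega>) - (vectorise d r p :: real ^ 'n::{finite,linorder}))) 0
             (diag_matrix (vectorise d r p) - outer_product (vectorise d r p) (vectorise d r p)) \<and>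
           conv_to_normal M
             (\<lambda>n \<omega>. sqrt (real n) *\<^sub>R (vectorise d r (\<gamma>hat n \<omega>) - vectorise d r \<gamma>\<^sub>p)) 0 \<Sigma>\<^sub>\<gamma>))"
proof -
  interpret copula_sample d r S M x P X p
    by (intro copula_sample.intro copula_support.intro copula_sample_axioms.intro)
      (fact d_pos r_pos copula_ex M_prob x_mono P_prob P_sets p_def p_prob S_def X_rv X_distr)+
  show ?thesis
    unfolding gammahat_def phat_def gamma_def
  proof (intro conjI impI consistent_in_prob consistent_almost_surely)
    assume basis: "CARD('n) = (\<Prod>l = 1..d. r l) \<and> CARD('s) = card S \<and>
      1 \<le> dim (zero_margin_space d r S) \<and> CARD('k) = dim (zero_margin_space d r S) \<and>
      inj \<Delta> \<and> independent (range \<Delta>) \<and> span (range \<Delta>) = zero_margin_space d r S"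
    interpret copula_sample_coordinates d r S M x P X p \<Delta> A R At G H J \<Sigma>\<^sub>\<gamma>
    proof (intro copula_sample_coordinates.intro copula_coordinates.intro copula_coordinates_axioms.intro)
      show "G = transpose At ** diag_matrix_inv (R *v vectorise d r (I_proj d r p)) ** At"
        unfolding G_def gamma_def ..
      show "CARD('n) = (\<Prod>l = 1..d. r l)" "CARD('s) = card S"
        "inj \<Delta>" "independent (range \<Delta>)" "span (range \<Delta>) = zero_margin_space d r S"
        using basis by blast+
    qed (rule copula_sample_axioms copula_support_axioms positive_p A_def R_def At_def H_def J_def Sigma_def)+
    show "invertible G" by (rule G_invertible)
    show "\<forall>(\<rho> :: nat \<Rightarrow> real) (M' :: 'z measure) (Z :: 'z \<Rightarrow> real ^ 'n::{finite,linorder}).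
       filterlim \<rho> at_top sequentially \<and> prob_space M' \<and> Z \<in> borel_measurable M' \<and>
       conv_in_distr M (\<lambda>n \<omega>. \<rho> n *\<^sub>R (vectorise d r (smoothed_array d r x S X n \<omega>) - vectorise d r p))
         (distr M' borel Z) \<longrightarrow>
       conv_in_distr M (\<lambda>n \<omega>. \<rho> n *\<^sub>R (vectorise d r (I_proj d r (smoothed_array d r x S X n \<omega>))
           - vectorise d r (I_proj d r p)))
         (distr M' borel (\<lambda>z. J *v Z z))"
    proof (intro allI impI, elim conjE)
      fix \<rho> :: "nat \<Rightarrow> real" and M' :: "'z measure" and Z :: "'z \<Rightarrow> real ^ 'n::{finite,linorder}"
      assume \<rho>: "filterlim \<rho> at_top sequentially" and Z: "Z \<in> borel_measurable M'"
        and conv: "conv_in_distr M (\<lambda>n \<omega>. \<rho> n *\<^sub>R (vectorise d r (smoothed_array d r x S X n \<omega>) - vectorise d r p))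
          (distr M' borel Z)"
      have "distr (distr M' borel Z) borel ((*v) J) = distr M' borel (\<lambda>z. J *v Z z)"
        by (subst distr_distr[OF borel_measurable_matrix_vector Z]) (simp add: comp_def)
      with copula_delta_method[OF \<rho> conv]
      show "conv_in_distr M (\<lambda>n \<omega>. \<rho> n *\<^sub>R (vectorise d r (I_proj d r (smoothed_array d r x S X n \<omega>))
          - vectorise d r (I_proj d r p))) (distr M' borel (\<lambda>z. J *v Z z))"
        by simp
    qed
    assume "indep_vars (\<lambda>_. borel_pow d) X {1..}"
    note iid_limits[OF this]
    then show "conv_to_normal M (\<lambda>n \<omega>. sqrt (real n) *\<^sub>R (vectorise d r (smoothed_array d r x S X n \<omega>)
          - (vectorise d r p :: real ^ 'n::{finite,linorder}))) 0
        (diag_matrix (vectorise d r p) - outer_product (vectorise d r p) (vectorise d r p))"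
      and "conv_to_normal M (\<lambda>n \<omega>. sqrt (real n) *\<^sub>R (vectorise d r (I_proj d r (smoothed_array d r x S X n \<omega>))
          - vectorise d r (I_proj d r p))) 0 \<Sigma>\<^sub>\<gamma>"
      by auto
  qed
qed

end
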